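(* Among nonzero integers whose absolute value is a power of two (including $2^0=1$), the members of the three determinant sets are exactly: - for $S(C_{24})$: $\{-1,1\}\cup\{\pm2^j:j\ge8\}$; - for $S(C_2\times C_{12})$: $\{1,2^8,2^{12}\}\cup\{(-2)^j:13\le j\le19\}\cup\{\pm2^j:j\ge20\}$; - for $S(C_2\times C_2\times C_6)$: $\{1,2^8,2^{12}\}\cup\{(-2)^j:14\le j\le31\}\cup\{\pm2^j:j\ge32\}$.
   Context: For a finite group $G$, $S(G)=\{\det(a_{gh^{-1}})_{g,h\in G}:a_g\in\mathbb Z\}$ is its integer group determinant set. $C_n$ is the cyclic group of order $n$. *)

theory Defs
  imports "HOL-Analysis.Analysis" "HOL-Library.Numeral_Type" "HOL-Library.Product_Plus"
begin

text \<open>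
  A finite group is a finite type of class \<^class>\<open>group_add\<close>, which need not be commutative.
  It is written additively, so \<open>g - h\<close> stands for \<open>g h\<^sup>-\<^sup>1\<close>. The numeral type \<open>n\<close> (for \<open>n \<ge> 2\<close>)
  is the ring of integers modulo \<open>n\<close>, so its additive group is cyclic of order \<open>n\<close>; a product
  type carries the componentwise operations, so it is the direct product.
\<close>

definition group_matrix :: "('g::{finite,group_add} \<Rightarrow> int) \<Rightarrow> int ^ 'g::{finite,group_add} ^ 'g::{finite,group_add}"
  where "group_matrix a = (\<chi> g h. a (g - h))"

definition int_group_dets :: "'g::{finite,group_add} itself \<Rightarrow> int set"
  where "int_group_dets _ = {det (group_matrix a) | a :: 'g \<Rightarrow> int. True}"

definition signed_two_powers :: "int set"
  where "signed_two_powers = {x. \<exists>k::nat. \<bar>x\<bar> = 2 ^ k}"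

end

theory Submission
  imports Defs "HOL-Number_Theory.Cong"
begin

text \<open>
  All three groups are \<open>H \<times> C\<^sub>3\<close> with \<open>H\<close> of order \<open>8\<close>. Splitting off the characters of \<open>C\<^sub>3\<close>, a group
  determinant becomes the determinant of an integral element \<open>f\<close> of the group ring of \<open>H\<close> times the norm
  of the determinant of an element \<open>g\<close> with Eisenstein coefficients, where \<open>f\<close> and \<open>g\<close> are arbitrary
  up to the congruence \<open>f = g\<close> modulo \<open>1 - \<omega>\<close>. The factors of each determinant (one for every
  rational character of \<open>H\<close>) are all even or all odd. If the determinant is a signed power of two and
  the factors of \<open>g\<close> are odd, then they are units, and reduction modulo \<open>1 - \<omega>\<close> both fixes the sign of the
  determinant of \<open>f\<close> as a power of \<open>-2\<close> and forces the norms from the Gaussian integers among its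
  factors to be powers of \<open>4\<close>; parity then rules out the missing exponents. If the factors of
  \<open>f\<close> are odd, Parseval leaves a single nonzero coefficient. The wrong sign thus needs both \<open>f\<close> and \<open>g\<close>
  to be even, which makes the exponent large. Conversely, explicit \<open>f\<close> and \<open>g\<close> realise finitely many
  values, and multiplication by \<open>2\<^sup>8\<close> gives the rest.
\<close>

subsection \<open>Group determinants and characters\<close>

text \<open>The norm coming from \<open>g\<close> is positive and congruent to 1 modulo 3 once it is
  a power of two, so only \<open>f\<close> can spoil the sign: the question is whether its
  determinant is 1 modulo 3. For the cyclic group this is void. Translation by an element of order 8
  is a product of three odd 8-cycles, so -1 itself is a determinant and only the gap below 2^8
  remains. In the other two groups every translation is an even permutation. There the exponents 20
  and 32 are sums of least contributions: 8 from \<open>f\<close> and 12 from \<open>g\<close> for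
  C_2 x C_12, and 12 from \<open>f\<close> and 20 from \<open>g\<close> for C_2 x C_2 x C_6. In the
  last group evenness alone gives only 8 and 16. The improvement has two sources: the halved
  character values, reduced modulo 2, form an affine function on F_2^3, so a few of them cannot be
  even without many being so; and a product of eight odd integers is determined modulo 4 by their
  sum, which Fourier inversion makes a multiple of 4.\<close>

lemma one_in_int_group_dets: "1 \<in> int_group_dets TYPE('g::{finite,group_add})"
proof -
  have "group_matrix (\<lambda>g. if g = 0 then 1 else 0) = (mat 1 :: int ^ 'g::{finite,group_add} ^ 'g::{finite,group_add})"
    by (simp add: group_matrix_def mat_def)
  then have "det (group_matrix (\<lambda>g::'g. if g = 0 then 1 else 0)) = 1"
    by simp
  then show ?thesis
    unfolding int_group_dets_def by (metis (mono_tags, lifting) mem_Collect_eq)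
qed

text \<open>Group matrices multiply as group ring elements do: \<open>c\<close> is the convolution
  of \<open>a\<close> and \<open>b\<close>.\<close>

lemma int_group_dets_mult:
  assumes "x \<in> int_group_dets TYPE('g::{finite,group_add})" "y \<in> int_group_dets TYPE('g)"
  shows "x * y \<in> int_group_dets TYPE('g)"
proof -
  obtain a b :: "'g \<Rightarrow> int" where x: "x = det (group_matrix a)" and y: "y = det (group_matrix b)"
    using assms unfolding int_group_dets_def by blast
  define c where "c = (\<lambda>g. \<Sum>k\<in>UNIV. a (g - k) * b k)"
  have "(\<Sum>k\<in>UNIV. a (g - k) * b (k - h)) = c (g - h)" for g h
    unfolding c_def
    by (rule sum.reindex_bij_witness[of _ "\<lambda>k. k + h" "\<lambda>k. k - h"]) (simp_all add: algebra_simps)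
  then have "group_matrix a ** group_matrix b = group_matrix c"
    by (simp add: group_matrix_def matrix_matrix_mult_def)
  then have "x * y = det (group_matrix c)"
    by (simp add: x y det_mul[symmetric])
  then show ?thesis
    unfolding int_group_dets_def by blast
qed

definition character :: "('g::group_add \<Rightarrow> complex) \<Rightarrow> bool"
  where "character c \<longleftrightarrow> c 0 = 1 \<and> (\<forall>g h. c (g + h) = c g * c h)"

text \<open>A shift by some \<open>h\<close> with \<open>c h\<close> different from
  \<open>\<psi> h\<close> multiplies the sum by \<open>c h * \<psi> (- h)\<close>, which is not 1,
  so the sum vanishes. The value \<open>\<psi> (- g)\<close> is the inverse of
  \<open>\<psi> g\<close> and stands in for its conjugate.\<close>

lemma character_orthogonality:
  fixes c \<psi> :: "'g::{finite,group_add} \<Rightarrow> complex"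
  assumes "character c" "character \<psi>"
  shows "(\<Sum>g\<in>UNIV. c g * \<psi> (- g)) = (if c = \<psi> then of_nat CARD('g) else 0)"
proof -
  have inv: "\<phi> g * \<phi> (- g) = 1" if "character \<phi>" for \<phi> :: "'g \<Rightarrow> complex" and g
    using that unfolding character_def by (metis add.right_inverse)
  show ?thesis
  proof (cases "c = \<psi>")
    case True
    then show ?thesis by (simp add: inv[OF assms(2)])
  next
    case False
    then obtain h where h: "c h \<noteq> \<psi> h" by blast
    let ?S = "\<Sum>g\<in>UNIV. c g * \<psi> (- g)"
    have "?S = (\<Sum>g\<in>UNIV. c (h + g) * \<psi> (- (h + g)))"
      by (rule sum.reindex_bij_witness[of _ "\<lambda>g. h + g" "\<lambda>g. - h + g"])
        (simp_all add: add.assoc[symmetric])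
    also have "\<dots> = (\<Sum>g\<in>UNIV. (c h * \<psi> (- h)) * (c g * \<psi> (- g)))"
    proof (rule sum.cong)
      fix g
      have "\<psi> (- (h + g)) = \<psi> (- g) * \<psi> (- h)"
        using assms(2) by (simp add: character_def minus_add del: add_uminus_conv_diff)
      then show "c (h + g) * \<psi> (- (h + g)) = (c h * \<psi> (- h)) * (c g * \<psi> (- g))"
        using assms(1) by (simp add: character_def)
    qed simp
    also have "\<dots> = (c h * \<psi> (- h)) * ?S"
      by (simp add: sum_distrib_left)
    finally have "(1 - c h * \<psi> (- h)) * ?S = 0"
      by (simp add: algebra_simps)
    moreover have "c h * \<psi> (- h) \<noteq> 1"
    proof
      assume "c h * \<psi> (- h) = 1"
      then have "c h * (\<psi> h * \<psi> (- h)) = \<psi> h"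
        by (metis mult.left_commute mult.right_neutral)
      then show False using h inv[OF assms(2), of h] by simp
    qed
    ultimately show ?thesis using False by simp
  qed
qed

text \<open>The character table diagonalises every group matrix, and it is invertible by orthogonality.\<close>

lemma det_group_matrix_characters:
  fixes a :: "'g::{finite,group_add} \<Rightarrow> int" and c :: "'i \<Rightarrow> 'g \<Rightarrow> complex"
  assumes K: "finite K" "card K = CARD('g)"
    and char: "\<And>k. k \<in> K \<Longrightarrow> character (c k)" and inj: "inj_on c K"
  shows "of_int (det (group_matrix a)) = (\<Prod>k\<in>K. \<Sum>g\<in>UNIV. of_int (a g) * c k g)"
proof -
  \<comment> \<open>Indexing the characters by group elements makes the character table a square
    matrix of the same type as the group matrix.\<close>
  obtain e :: "'g \<Rightarrow> 'i" where e: "bij_betw e UNIV K"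
    using finite_same_card_bij[of "UNIV :: 'g set" K] K by auto
  have eK: "e g \<in> K" for g using e by (auto simp: bij_betw_def)
  have einj: "c (e g) = c (e h) \<longleftrightarrow> g = h" for g h
    using e inj eK by (metis bij_betw_imp_inj_on inj_onD UNIV_I)
  define M :: "complex ^ 'g::{finite,group_add} ^ 'g::{finite,group_add}" where "M = (\<chi> g h. of_int (a (g - h)))"
  define X :: "complex ^ 'g::{finite,group_add} ^ 'g::{finite,group_add}" where "X = (\<chi> g k. c (e k) (- g))"
  define Y :: "complex ^ 'g::{finite,group_add} ^ 'g::{finite,group_add}" where "Y = (\<chi> k g. c (e k) g)"
  define lam where "lam = (\<lambda>k. \<Sum>g\<in>UNIV. of_int (a g) * c (e k) g)"
  define L :: "complex ^ 'g::{finite,group_add} ^ 'g::{finite,group_add}" where "L = (\<chi> i j. if i = j then lam i else 0)"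
  have M: "det M = of_int (det (group_matrix a))"
    by (simp add: det_def M_def group_matrix_def)
  have YX: "Y ** X = mat (of_nat CARD('g))"
    using character_orthogonality[OF char char, OF eK eK]
    by (simp add: Y_def X_def matrix_matrix_mult_def mat_def vec_eq_iff einj)
  \<comment> \<open>Each row of \<open>Y\<close> is a left eigenvector of \<open>M\<close>, with the
    character sum \<open>lam k\<close> as eigenvalue.\<close>
  have "Y ** M = L ** Y"
  proof -
    have "(\<Sum>g\<in>UNIV. c (e k) g * of_int (a (g - h))) = lam k * c (e k) h" for k h
    proof -
      have "(\<Sum>g\<in>UNIV. c (e k) g * of_int (a (g - h))) = (\<Sum>g\<in>UNIV. c (e k) (g + h) * of_int (a g))"
        by (rule sum.reindex_bij_witness[of _ "\<lambda>g. g + h" "\<lambda>g. g - h"]) simp_all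
      also have "\<dots> = lam k * c (e k) h"
        using char[OF eK[of k]] by (simp add: lam_def character_def sum_distrib_left sum_distrib_right mult_ac)
      finally show ?thesis .
    qed
    moreover have "(\<Sum>j\<in>UNIV. (if k = j then lam k else 0) * c (e j) h) = lam k * c (e k) h" for k h
      by (simp add: if_distrib[of "\<lambda>x. x * _"] cong: if_cong)
    ultimately show ?thesis
      by (simp add: Y_def M_def L_def matrix_matrix_mult_def vec_eq_iff)
  qed
  then have "det Y * det M = det L * det Y" by (metis det_mul)
  moreover have "det Y \<noteq> 0"
  proof
    assume "det Y = 0"
    then have "det (Y ** X) = 0" by (simp add: det_mul)
    moreover have "det (mat (of_nat CARD('g)) :: complex ^ 'g::{finite,group_add} ^ 'g::{finite,group_add}) \<noteq> 0"
      by (subst det_diagonal) (simp_all add: mat_def)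
    ultimately show False using YX by simp
  qed
  ultimately have "det M = det L" by simp
  also have "det L = (\<Prod>k\<in>UNIV. lam k)"
    by (subst det_diagonal) (simp_all add: L_def)
  also have "\<dots> = (\<Prod>k\<in>K. \<Sum>g\<in>UNIV. of_int (a g) * c k g)"
    unfolding lam_def by (rule prod.reindex_bij_betw[OF e])
  finally show ?thesis by (simp add: M)
qed

subsection \<open>Eisenstein integers\<close>

text \<open>\<open>Eis a b\<close> stands for \<open>a + b \<omega>\<close>, where \<open>\<omega>\<close> is a primitive cube root of unity.\<close>

datatype eis = Eis (eis_re: int) (eis_om: int)

instantiation eis :: comm_ring_1
begin

definition "0 = Eis 0 0"
definition "1 = Eis 1 0"
definition "x + y = Eis (eis_re x + eis_re y) (eis_om x + eis_om y)"
definition "x - y = Eis (eis_re x - eis_re y) (eis_om x - eis_om y)"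
definition "- x = Eis (- eis_re x) (- eis_om x)"
definition "x * y = Eis (eis_re x * eis_re y - eis_om x * eis_om y)
  (eis_re x * eis_om y + eis_om x * eis_re y - eis_om x * eis_om y)"

instance
  by standard (auto simp: zero_eis_def one_eis_def plus_eis_def minus_eis_def uminus_eis_def
      times_eis_def algebra_simps)

end

lemma eis_sel [simp]:
  "eis_re 0 = 0" "eis_om 0 = 0" "eis_re 1 = 1" "eis_om 1 = 0"
  "eis_re (x + y) = eis_re x + eis_re y" "eis_om (x + y) = eis_om x + eis_om y"
  "eis_re (x - y) = eis_re x - eis_re y" "eis_om (x - y) = eis_om x - eis_om y"
  "eis_re (- x) = - eis_re x" "eis_om (- x) = - eis_om x"
  "eis_re (x * y) = eis_re x * eis_re y - eis_om x * eis_om y"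
  "eis_om (x * y) = eis_re x * eis_om y + eis_om x * eis_re y - eis_om x * eis_om y"
  by (simp_all add: zero_eis_def one_eis_def plus_eis_def minus_eis_def uminus_eis_def times_eis_def)

lemma eis_sel_of_nat [simp]: "eis_re (of_nat n) = int n" "eis_om (of_nat n) = 0"
  by (induction n) auto

lemma eis_sel_numeral [simp]: "eis_re (numeral n) = numeral n" "eis_om (numeral n) = 0"
  using eis_sel_of_nat[of "numeral n"] by simp_all

definition enorm :: "eis \<Rightarrow> int"
  where "enorm x = (eis_re x)\<^sup>2 - eis_re x * eis_om x + (eis_om x)\<^sup>2"

text \<open>Reduction modulo the prime above \<open>3\<close>: an Eisenstein integer \<open>x\<close> is congruent to \<open>emod x\<close>
  modulo \<open>1 - \<omega>\<close>.\<close>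

definition emod :: "eis \<Rightarrow> int"
  where "emod x = eis_re x + eis_om x"

definition omega :: complex
  where "omega = Complex (- 1 / 2) (sqrt 3 / 2)"

definition complex_of_eis :: "eis \<Rightarrow> complex"
  where "complex_of_eis x = of_int (eis_re x) + of_int (eis_om x) * omega"

lemma omega_power2: "omega\<^sup>2 = - 1 - omega"
  by (simp add: omega_def complex_eq_iff power2_eq_square field_simps)

lemma omega_mult_omega: "omega * omega = - 1 - omega" "omega * (omega * x) = - x - omega * x"
proof -
  show *: "omega * omega = - 1 - omega" using omega_power2 by (simp only: power2_eq_square)
  show "omega * (omega * x) = - x - omega * x"
    by (simp only: mult.assoc[symmetric] *) (simp add: left_diff_distrib)
qed

lemma omega_power3: "omega ^ 3 = 1"
proof -
  have "omega ^ 3 = omega * omega\<^sup>2" by (simp add: eval_nat_numeral)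
  also have "\<dots> = - omega - omega\<^sup>2" by (simp add: omega_power2 algebra_simps power2_eq_square[symmetric])
  also have "\<dots> = 1" by (simp add: omega_power2)
  finally show ?thesis .
qed

lemma cnj_omega: "cnj omega = omega\<^sup>2"
  unfolding omega_power2 by (simp add: omega_def complex_eq_iff)

lemma omega_power_inj:
  assumes "omega ^ s = omega ^ t" "s < 3" "t < 3"
  shows "s = t"
proof -
  have "omega \<noteq> 1" "omega\<^sup>2 \<noteq> 1" "omega\<^sup>2 \<noteq> omega"
    unfolding omega_power2 by (simp_all add: omega_def complex_eq_iff)
  moreover have "s = 0 \<or> s = 1 \<or> s = 2" "t = 0 \<or> t = 1 \<or> t = 2" using assms by auto
  ultimately show ?thesis using assms(1) by (metis power_0 power_one_right)
qed

lemma complex_of_eis_simps [simp]: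
  "complex_of_eis (x + y) = complex_of_eis x + complex_of_eis y"
  "complex_of_eis (x - y) = complex_of_eis x - complex_of_eis y"
  "complex_of_eis (x * y) = complex_of_eis x * complex_of_eis y"
  "complex_of_eis 1 = 1"
proof -
  show "complex_of_eis (x * y) = complex_of_eis x * complex_of_eis y"
  proof -
    have "complex_of_eis x * complex_of_eis y =
      of_int (eis_re x * eis_re y) + of_int (eis_re x * eis_om y + eis_om x * eis_re y) * omega
      + of_int (eis_om x * eis_om y) * omega\<^sup>2"
      by (simp add: complex_of_eis_def algebra_simps power2_eq_square)
    then show ?thesis by (simp add: omega_power2) (simp add: complex_of_eis_def algebra_simps)
  qed
qed (simp_all add: complex_of_eis_def algebra_simps)

lemma complex_of_eis_power [simp]: "complex_of_eis (x ^ n) = complex_of_eis x ^ n"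
  by (induction n) simp_all

lemma complex_of_eis_numeral [simp]: "complex_of_eis (numeral n) = numeral n"
  by (simp add: complex_of_eis_def)

lemma complex_of_eis_mult_cnj: "complex_of_eis x * cnj (complex_of_eis x) = of_int (enorm x)"
proof -
  have "complex_of_eis x * cnj (complex_of_eis x) = of_int (eis_re x * eis_re x)
      + of_int (eis_re x * eis_om x) * (omega + omega\<^sup>2) + of_int (eis_om x * eis_om x) * omega ^ 3"
    by (simp add: complex_of_eis_def cnj_omega algebra_simps power2_eq_square power3_eq_cube)
  then show ?thesis
    by (simp add: omega_mult_omega omega_power3 enorm_def power2_eq_square)
qed

lemma enorm_mult: "enorm (x * y) = enorm x * enorm y"
  by (simp add: enorm_def power2_eq_square algebra_simps)

subsection \<open>Groups of the form $H \times C_3$\<close>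

lemma sum_lessThan_3: "(\<Sum>v<3. h v) = h 0 + h 1 + h (2::nat)"
  for h :: "nat \<Rightarrow> 'a::comm_monoid_add"
  by (simp add: eval_nat_numeral add.assoc)

lemma prod_lessThan_3: "(\<Prod>v<3. h v) = h 0 * h 1 * h (2::nat)"
  for h :: "nat \<Rightarrow> 'a::comm_monoid_mult"
  by (simp add: eval_nat_numeral mult.assoc)

text \<open>Here \<open>\<phi>\<close> identifies \<open>H \<times> C\<^sub>3\<close> with index pairs, \<open>X\<close> is the character table of \<open>H\<close>, and \<open>Dc\<close>,
  \<open>Dz\<close>, \<open>De\<close> are the group determinant of \<open>H\<close> over the complex numbers, the integers and the
  Eisenstein integers. The three cubic characters evaluate an element of the group ring of
  \<open>H \<times> C\<^sub>3\<close> to \<open>f\<close>, \<open>g\<close> and the conjugate of \<open>g\<close>.\<close>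

lemma int_group_dets_times_C3:
  fixes \<phi> :: "nat \<Rightarrow> nat \<Rightarrow> 'g::{finite,group_add}"
    and c :: "nat \<Rightarrow> nat \<Rightarrow> 'g \<Rightarrow> complex" and X :: "nat \<Rightarrow> nat \<Rightarrow> complex"
    and Dc :: "(nat \<Rightarrow> complex) \<Rightarrow> complex"
  assumes card: "CARD('g) = 24"
    and surj: "\<And>x. \<exists>u<8. \<exists>v<3. \<phi> u v = x"
    and char: "\<And>r s. r < 8 \<Longrightarrow> s < 3 \<Longrightarrow> character (c r s)"
    and val: "\<And>r s u v. r < 8 \<Longrightarrow> s < 3 \<Longrightarrow> u < 8 \<Longrightarrow> v < 3 \<Longrightarrow> c r s (\<phi> u v) = X r u * omega ^ (s * v)"
    and X0: "\<And>r. X r 0 = 1"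
    and Xinj: "\<And>r r'. r < 8 \<Longrightarrow> r' < 8 \<Longrightarrow> (\<And>u. u < 8 \<Longrightarrow> X r u = X r' u) \<Longrightarrow> r = r'"
    and DX: "\<And>F. (\<Prod>r<8. \<Sum>u<8. F u * X r u) = Dc F"
    and Dc_int: "\<And>f. Dc (\<lambda>u. of_int (f u)) = of_int (Dz f)"
    and Dc_eis: "\<And>g. Dc (\<lambda>u. complex_of_eis (g u)) = complex_of_eis (De g)"
    and Dc_cnj: "\<And>F. Dc (\<lambda>u. cnj (F u)) = cnj (Dc F)"
  shows "int_group_dets TYPE('g) =
    {Dz f * enorm (De g) | f g. \<forall>u<8. 3 dvd f u - emod (g u)}"
proof -
  let ?K = "{..<8::nat} \<times> {..<3::nat}"
  have cardK: "card ?K = CARD('g)" using card by simp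
  have im: "(\<lambda>(u, v). \<phi> u v) ` ?K = UNIV"
  proof -
    have "x \<in> (\<lambda>(u, v). \<phi> u v) ` ?K" for x
    proof -
      obtain u v where "u < 8" "v < 3" "\<phi> u v = x" using surj by blast
      then show ?thesis by (intro image_eqI[of _ _ "(u, v)"]) auto
    qed
    then show ?thesis by blast
  qed
  then have inj: "inj_on (\<lambda>(u, v). \<phi> u v) ?K"
    using cardK by (intro eq_card_imp_inj_on) simp_all
  with im have bij: "bij_betw (\<lambda>(u, v). \<phi> u v) ?K UNIV" by (simp add: bij_betw_def)
  have injc: "inj_on (\<lambda>(r, s). c r s) ?K"
  proof (rule inj_onI, clarsimp)
    fix r s r' s' assume *: "r < (8::nat)" "s < (3::nat)" "r' < (8::nat)" "s' < (3::nat)" "c r s = c r' s'"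
    have "X r u = X r' u" if "u < 8" for u
      using val[of r s u 0] val[of r' s' u 0] that * by simp
    then have "r = r'" by (intro Xinj) (use * in auto)
    moreover have "omega ^ s = omega ^ s'"
      using val[of r s 0 1] val[of r' s' 0 1] * by (simp add: X0)
    then have "s = s'" using * by (intro omega_power_inj)
    ultimately show "r = r' \<and> s = s'" by blast
  qed
  have det: "det (group_matrix a) = Dz f * enorm (De g)"
    if f: "\<And>u. u < 8 \<Longrightarrow> f u = a (\<phi> u 0) + a (\<phi> u 1) + a (\<phi> u 2)"
      and g: "\<And>u. u < 8 \<Longrightarrow> g u = Eis (a (\<phi> u 0) - a (\<phi> u 2)) (a (\<phi> u 1) - a (\<phi> u 2))"
    for a f g
  proof -
    define F where "F = (\<lambda>s u. \<Sum>v<3. of_int (a (\<phi> u v)) * omega ^ (s * v))"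
    have F0: "F 0 u = of_int (f u)" if "u < 8" for u
      using that by (simp add: F_def sum_lessThan_3 f)
    have F1: "F 1 u = complex_of_eis (g u)" if "u < 8" for u
      using that by (simp add: F_def sum_lessThan_3 g complex_of_eis_def omega_power2 omega_mult_omega algebra_simps)
    have F2: "F 2 u = cnj (complex_of_eis (g u))" if "u < 8" for u
    proof -
      have "omega ^ 4 = omega ^ 3 * omega" by (simp add: eval_nat_numeral)
      then have "omega ^ 4 = omega" by (simp add: omega_power3)
      then show ?thesis
        using that by (simp add: F_def sum_lessThan_3 g complex_of_eis_def cnj_omega omega_power2 algebra_simps)
    qed
    have val_sum: "(\<Sum>x\<in>UNIV. of_int (a x) * c r s x) = (\<Sum>u<8. F s u * X r u)" if "r < 8" "s < 3" for r s
    proof -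
      have "(\<Sum>x\<in>UNIV. of_int (a x) * c r s x) =
          (\<Sum>p\<in>?K. of_int (a ((\<lambda>(u, v). \<phi> u v) p)) * c r s ((\<lambda>(u, v). \<phi> u v) p))"
        by (rule sum.reindex_bij_betw[OF bij, symmetric])
      also have "\<dots> = (\<Sum>u<8. \<Sum>v<3. of_int (a (\<phi> u v)) * c r s (\<phi> u v))"
        by (subst sum.cartesian_product) (simp add: case_prod_unfold)
      also have "\<dots> = (\<Sum>u<8. \<Sum>v<3. of_int (a (\<phi> u v)) * (X r u * omega ^ (s * v)))"
        using that by (intro sum.cong refl) (simp add: val)
      also have "\<dots> = (\<Sum>u<8. F s u * X r u)"
        by (simp add: F_def sum_distrib_left sum_distrib_right mult_ac)
      finally show ?thesis .
    qed
    have "of_int (det (group_matrix a)) = (\<Prod>k\<in>?K. \<Sum>x\<in>UNIV. of_int (a x) * (\<lambda>(r, s). c r s) k x)"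
      by (rule det_group_matrix_characters) (use cardK injc in \<open>auto intro: char\<close>)
    also have "\<dots> = (\<Prod>r<8. \<Prod>s<3. \<Sum>x\<in>UNIV. of_int (a x) * c r s x)"
      by (subst prod.cartesian_product) (simp add: case_prod_unfold)
    also have "\<dots> = (\<Prod>r<8. \<Prod>s<3. \<Sum>u<8. F s u * X r u)"
      by (intro prod.cong refl val_sum) auto
    also have "\<dots> = (\<Prod>r<8. \<Sum>u<8. F 0 u * X r u) * (\<Prod>r<8. \<Sum>u<8. F 1 u * X r u)
        * (\<Prod>r<8. \<Sum>u<8. F 2 u * X r u)"
      by (simp only: prod_lessThan_3 prod.distrib)
    also have "\<dots> = (\<Prod>r<8. \<Sum>u<8. of_int (f u) * X r u) * (\<Prod>r<8. \<Sum>u<8. complex_of_eis (g u) * X r u)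
        * (\<Prod>r<8. \<Sum>u<8. cnj (complex_of_eis (g u)) * X r u)"
      by (simp add: F0 F1[simplified] F2)
    also have "\<dots> = of_int (Dz f * enorm (De g))"
      by (simp add: DX Dc_int Dc_cnj Dc_eis mult.assoc complex_of_eis_mult_cnj)
    finally show ?thesis by (simp only: of_int_eq_iff)
  qed
  show ?thesis
  proof (intro equalityI subsetI)
    fix x assume "x \<in> int_group_dets TYPE('g)"
    then obtain a :: "'g \<Rightarrow> int" where a: "x = det (group_matrix a)"
      unfolding int_group_dets_def by blast
    define f where "f = (\<lambda>u. a (\<phi> u 0) + a (\<phi> u 1) + a (\<phi> u 2))"
    define g where "g = (\<lambda>u. Eis (a (\<phi> u 0) - a (\<phi> u 2)) (a (\<phi> u 1) - a (\<phi> u 2)))"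
    have "f u - emod (g u) = 3 * a (\<phi> u 2)" for u
      by (simp add: f_def g_def emod_def)
    then have "\<forall>u<8. 3 dvd f u - emod (g u)" by simp
    moreover have "x = Dz f * enorm (De g)" unfolding a by (rule det) (simp_all add: f_def g_def)
    ultimately show "x \<in> {Dz f * enorm (De g) | f g. \<forall>u<8. 3 dvd f u - emod (g u)}" by blast
  next
    fix x assume "x \<in> {Dz f * enorm (De g) | f g. \<forall>u<8. 3 dvd f u - emod (g u)}"
    then obtain f g where x: "x = Dz f * enorm (De g)" and fg: "\<And>u. u < 8 \<Longrightarrow> 3 dvd f u - emod (g u)"
      by blast
    \<comment> \<open>Inverse Fourier transform on C_3. With last coefficient \<open>k u\<close>,
      the value \<open>g u\<close> forces the other two to be \<open>k u + eis_re (g u)\<close> and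
      \<open>k u + eis_om (g u)\<close>. Their total is \<open>3 * k u + emod (g u)\<close>, so the
      congruence is exactly the integrality of \<open>k u\<close>.\<close>
    define k where "k = (\<lambda>u. (f u - emod (g u)) div 3)"
    define b where "b = (\<lambda>(u, v :: nat). if v = 0 then k u + eis_re (g u) else if v = 1 then k u + eis_om (g u) else k u)"
    define a where "a = (\<lambda>x. b (inv_into ?K (\<lambda>(u, v). \<phi> u v) x))"
    have a: "a (\<phi> u v) = b (u, v)" if "u < 8" "v < 3" for u v
      using inv_into_f_f[OF inj, of "(u, v)"] that by (simp add: a_def)
    have k: "3 * k u = f u - emod (g u)" if "u < 8" for u
      using fg[OF that] by (simp add: k_def)
    have "det (group_matrix a) = Dz f * enorm (De g)"
    proof (rule det)
      fix u :: nat assume "u < 8"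
      then show "f u = a (\<phi> u 0) + a (\<phi> u 1) + a (\<phi> u 2)"
        using k[of u] by (simp add: a b_def emod_def)
      show "g u = Eis (a (\<phi> u 0) - a (\<phi> u 2)) (a (\<phi> u 1) - a (\<phi> u 2))"
        using \<open>u < 8\<close> by (simp add: a b_def)
    qed
    then show "x \<in> int_group_dets TYPE('g)"
      unfolding int_group_dets_def x by (metis (mono_tags, lifting) mem_Collect_eq)
  qed
qed

subsection \<open>Cyclic characters\<close>

text \<open>The exponent is an arbitrary natural representative of \<open>g\<close>; the choice is
  immaterial once \<open>z\<close> is a root of unity of order dividing the characteristic.\<close>

definition cyclic_char :: "complex \<Rightarrow> 'n::{comm_ring_1,finite} \<Rightarrow> complex"
  where "cyclic_char z g = z ^ (SOME k. of_nat k = g)"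

text \<open>Equality of characteristic and cardinality says that 1 generates the additive group. It
  treats all numeral types at once as rings of residues.\<close>

lemma of_nat_surj_if_CHAR:
  assumes "CHAR('n::{comm_ring_1,finite}) = CARD('n)"
  shows "\<exists>k. of_nat k = (g :: 'n)"
proof -
  have "inj_on (of_nat :: nat \<Rightarrow> 'n) {..<CARD('n)}"
    by (rule inj_onI) (simp add: of_nat_eq_iff_cong_CHAR assms cong_def)
  then have "card ((of_nat :: nat \<Rightarrow> 'n) ` {..<CARD('n)}) = CARD('n)"
    by (simp add: card_image)
  then have "(of_nat :: nat \<Rightarrow> 'n) ` {..<CARD('n)} = UNIV"
    by (intro card_subset_eq) simp_all
  then show ?thesis by (metis UNIV_I imageE)
qed

lemma of_nat_less_CARD_surj:
  assumes "CHAR('n::{comm_ring_1,finite}) = CARD('n)"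
  shows "\<exists>k<CARD('n). of_nat k = (g :: 'n)"
proof -
  obtain k where k: "of_nat k = g" using of_nat_surj_if_CHAR[OF assms] by blast
  have "of_nat (k mod CARD('n)) = (of_nat k :: 'n)"
    by (simp add: of_nat_eq_iff_cong_CHAR assms cong_def)
  then show ?thesis using k by (intro exI[of _ "k mod CARD('n)"]) simp
qed

lemma power_cong_order:
  fixes z :: complex
  assumes "z ^ n = 1" "[j = k] (mod n)"
  shows "z ^ j = z ^ k"
proof -
  have "z ^ j = z ^ (j mod n)" for j
  proof -
    have "z ^ j = z ^ (n * (j div n) + j mod n)" by simp
    also have "\<dots> = z ^ (j mod n)" by (simp only: power_add power_mult assms(1)) simp
    finally show ?thesis .
  qed
  then show ?thesis using assms(2) by (metis cong_def)
qed

lemma cyclic_char_of_nat: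
  assumes "CHAR('n::{comm_ring_1,finite}) = CARD('n)" "z ^ CARD('n) = 1"
  shows "cyclic_char z (of_nat k :: 'n) = z ^ k"
proof -
  have "of_nat (SOME j. of_nat j = (of_nat k :: 'n)) = (of_nat k :: 'n)"
    by (rule someI) simp
  then have "[(SOME j. of_nat j = (of_nat k :: 'n)) = k] (mod CARD('n))"
    by (simp only: of_nat_eq_iff_cong_CHAR assms(1))
  then show ?thesis
    unfolding cyclic_char_def by (rule power_cong_order[OF assms(2)])
qed

lemma character_cyclic_char:
  assumes "CHAR('n::{comm_ring_1,finite}) = CARD('n)" "z ^ CARD('n) = 1"
  shows "character (cyclic_char z :: 'n \<Rightarrow> complex)"
  unfolding character_def
proof safe
  show "cyclic_char z (0 :: 'n) = 1" using cyclic_char_of_nat[OF assms, of 0] by simp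
  fix g h :: 'n
  obtain j k where "g = of_nat j" "h = of_nat k" using of_nat_surj_if_CHAR[OF assms(1)] by metis
  then show "cyclic_char z (g + h) = cyclic_char z g * cyclic_char z h"
    using cyclic_char_of_nat[OF assms, of "j + k"]
    by (simp add: cyclic_char_of_nat[OF assms] power_add)
qed

lemma character_prod:
  assumes "character c" "character d"
  shows "character (\<lambda>p. c (fst p) * d (snd p))"
  using assms by (simp add: character_def mult_ac)

text \<open>The Chinese remainder theorem in the form \<open>C\<^bsub>3m\<^esub> = C\<^sub>m \<times> C\<^sub>3\<close>: \<open>\<alpha>\<close> and \<open>\<beta>\<close> are the
  idempotents modulo \<open>3 m\<close>.\<close>

lemma cyclic_char_times_C3:
  assumes "CHAR('n::{comm_ring_1,finite}) = CARD('n)" "CARD('n) = 3 * m" "z ^ m = 1"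
    and "[\<alpha> = 1] (mod m)" "[\<beta> = 0] (mod m)" "[\<alpha> = 0] (mod 3)" "[\<beta> = 1] (mod 3)"
  shows "cyclic_char (z * omega ^ s) (of_nat (\<alpha> * u + \<beta> * v) :: 'n) = z ^ u * omega ^ (s * v)"
    and "character (cyclic_char (z * omega ^ s) :: 'n \<Rightarrow> complex)"
proof -
  have "(z * omega ^ s) ^ CARD('n) = (z ^ m) ^ 3 * (omega ^ 3) ^ (s * m)"
    by (simp add: assms(2) power_mult_distrib power_mult[symmetric] mult_ac)
  then have order: "(z * omega ^ s) ^ CARD('n) = 1"
    by (simp add: assms(3) omega_power3)
  show "character (cyclic_char (z * omega ^ s) :: 'n \<Rightarrow> complex)"
    by (rule character_cyclic_char[OF assms(1) order])
  have "[\<alpha> * u + \<beta> * v = 1 * u + 0 * v] (mod m)" "[\<alpha> * u + \<beta> * v = 0 * u + 1 * v] (mod 3)"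
    by (intro cong_add cong_mult cong_refl assms)+
  then have m: "[\<alpha> * u + \<beta> * v = u] (mod m)" and "[\<alpha> * u + \<beta> * v = v] (mod 3)"
    by simp_all
  then have "[s * (\<alpha> * u + \<beta> * v) = s * v] (mod 3)"
    by (intro cong_mult cong_refl)
  then have "omega ^ (s * (\<alpha> * u + \<beta> * v)) = omega ^ (s * v)"
    by (rule power_cong_order[OF omega_power3])
  moreover have "z ^ (\<alpha> * u + \<beta> * v) = z ^ u"
    by (rule power_cong_order[OF assms(3) m])
  ultimately show "cyclic_char (z * omega ^ s) (of_nat (\<alpha> * u + \<beta> * v) :: 'n) = z ^ u * omega ^ (s * v)"
    unfolding cyclic_char_of_nat[OF assms(1) order] by (simp add: power_mult_distrib power_mult)
qed

lemma of_nat_times_C3_surj: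
  assumes "CHAR('n::{comm_ring_1,finite}) = CARD('n)" "CARD('n) = 3 * m" "m > 0"
    and "[\<alpha> = 1] (mod m)" "[\<beta> = 0] (mod m)" "[\<alpha> = 0] (mod 3)" "[\<beta> = 1] (mod 3)"
  shows "\<exists>u<m. \<exists>v<3. of_nat (\<alpha> * u + \<beta> * v) = (x :: 'n)"
proof -
  obtain k where k: "x = of_nat k" using of_nat_surj_if_CHAR[OF assms(1)] by metis
  let ?u = "k mod m" and ?v = "k mod 3"
  \<comment> \<open>The congruences for \<open>\<alpha>\<close> already make \<open>m\<close> and 3
    coprime: \<open>\<alpha>\<close> is a multiple of 3 and invertible modulo
    \<open>m\<close>.\<close>
  have "coprime \<alpha> m" "3 dvd \<alpha>"
    using assms(4,6) by (auto simp: cong_0_iff intro: cong_imp_coprime cong_sym)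
  then have "coprime m 3" by (meson coprime_commute coprime_divisors dvd_refl)
  have "[\<alpha> * ?u + \<beta> * ?v = 1 * k + 0 * ?v] (mod m)" "[\<alpha> * ?u + \<beta> * ?v = 0 * ?u + 1 * k] (mod 3)"
    by (intro cong_add cong_mult cong_refl assms; simp add: cong_def)+
  then have "[\<alpha> * ?u + \<beta> * ?v = k] (mod m * 3)"
    using \<open>coprime m 3\<close> by (intro coprime_cong_mult_nat) simp_all
  then have "of_nat (\<alpha> * ?u + \<beta> * ?v) = x"
    unfolding k of_nat_eq_iff_cong_CHAR assms by (simp add: mult.commute)
  then show ?thesis
    using assms(3) by (intro exI[of _ ?u] exI[of _ ?v] conjI) simp_all
qed

subsection \<open>The groups $C_8$, $C_2 \times C_4$ and $C_2^3$\<close>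

text \<open>In all three cases the group ring element with coefficient \<open>F u\<close> at the \<open>u\<close>-th group element is
  split into \<open>F u + F (u + 4)\<close> and \<open>F u - F (u + 4)\<close>, for \<open>u < 4\<close>. In \<open>det_C8\<close> the last factor is
  the norm of the value \<open>\<alpha> + \<beta> \<zeta>\<close> at \<open>\<zeta>\<close>, a primitive eighth root of unity; here
  \<open>\<alpha>\<close> and \<open>\<beta>\<close> are Gaussian and \<open>norm8_re + norm8_im i = \<alpha>\<^sup>2 - i \<beta>\<^sup>2\<close>.\<close>

definition det_C4 :: "'a::comm_ring_1 \<Rightarrow> 'a \<Rightarrow> 'a \<Rightarrow> 'a \<Rightarrow> 'a"
  where "det_C4 a b c d = (a + b + c + d) * (a - b + c - d) * ((a - c)\<^sup>2 + (b - d)\<^sup>2)"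

definition det_C2C2 :: "'a::comm_ring_1 \<Rightarrow> 'a \<Rightarrow> 'a \<Rightarrow> 'a \<Rightarrow> 'a"
  where "det_C2C2 a b c d = (a + b + c + d) * (a - b + c - d) * (a + b - c - d) * (a - b - c + d)"

definition norm8_re :: "'a::comm_ring_1 \<Rightarrow> 'a \<Rightarrow> 'a \<Rightarrow> 'a \<Rightarrow> 'a"
  where "norm8_re a b c d = a\<^sup>2 - c\<^sup>2 + 2 * b * d"

definition norm8_im :: "'a::comm_ring_1 \<Rightarrow> 'a \<Rightarrow> 'a \<Rightarrow> 'a \<Rightarrow> 'a"
  where "norm8_im a b c d = 2 * a * c - b\<^sup>2 + d\<^sup>2"

definition det_C8 :: "(nat \<Rightarrow> 'a::comm_ring_1) \<Rightarrow> 'a"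
  where "det_C8 F = det_C4 (F 0 + F 4) (F 1 + F 5) (F 2 + F 6) (F 3 + F 7) *
    ((norm8_re (F 0 - F 4) (F 1 - F 5) (F 2 - F 6) (F 3 - F 7))\<^sup>2 +
     (norm8_im (F 0 - F 4) (F 1 - F 5) (F 2 - F 6) (F 3 - F 7))\<^sup>2)"

definition det_C2C4 :: "(nat \<Rightarrow> 'a::comm_ring_1) \<Rightarrow> 'a"
  where "det_C2C4 F = det_C4 (F 0 + F 4) (F 1 + F 5) (F 2 + F 6) (F 3 + F 7) *
    det_C4 (F 0 - F 4) (F 1 - F 5) (F 2 - F 6) (F 3 - F 7)"

definition det_C2C2C2 :: "(nat \<Rightarrow> 'a::comm_ring_1) \<Rightarrow> 'a"
  where "det_C2C2C2 F = det_C2C2 (F 0 + F 4) (F 1 + F 5) (F 2 + F 6) (F 3 + F 7) *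
    det_C2C2 (F 0 - F 4) (F 1 - F 5) (F 2 - F 6) (F 3 - F 7)"

lemmas det_H_defs = det_C8_def det_C2C4_def det_C2C2C2_def det_C4_def det_C2C2_def norm8_re_def norm8_im_def

lemma sum_lessThan_8: "(\<Sum>u<8. h u) = h 0 + h 1 + h 2 + h 3 + h 4 + h 5 + h 6 + h (7::nat)"
  for h :: "nat \<Rightarrow> 'a::comm_monoid_add"
  by (simp add: eval_nat_numeral add.assoc)

lemma prod_lessThan_8: "(\<Prod>u<8. h u) = h 0 * h 1 * h 2 * h 3 * h 4 * h 5 * h 6 * h (7::nat)"
  for h :: "nat \<Rightarrow> 'a::comm_monoid_mult"
  by (simp add: eval_nat_numeral mult.assoc)

definition zeta8 :: complex
  where "zeta8 = cis (pi / 4)"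

lemma zeta8_power4: "zeta8 ^ 4 = - 1"
  unfolding zeta8_def Complex.DeMoivre by simp

lemma zeta8_power8: "zeta8 ^ 8 = 1"
proof -
  have "zeta8 ^ 8 = (zeta8 ^ 4)\<^sup>2" by (simp flip: power_mult)
  then show ?thesis by (simp add: zeta8_power4)
qed

lemma zeta8_power_inj:
  assumes "zeta8 ^ r = zeta8 ^ r'" "r < 8" "r' < 8"
  shows "r = r'"
proof -
  have main: False if "r < r'" "r' < 8" "zeta8 ^ r = zeta8 ^ r'" for r r'
  proof -
    define d where "d = r' - r"
    have "r' = r + d" using that by (simp add: d_def)
    then have "zeta8 ^ r * zeta8 ^ d = zeta8 ^ r" using that by (metis power_add)
    moreover have "zeta8 \<noteq> 0" by (simp add: zeta8_def)
    ultimately have d: "zeta8 ^ d = 1" by simp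
    have sq: "zeta8 ^ (2 * d) = 1" "zeta8 ^ (4 * d) = 1"
      by (metis d power_mult mult.commute power_one)+
    have "d = 1 \<or> d = 2 \<or> d = 3 \<or> d = 4 \<or> d = 5 \<or> d = 6 \<or> d = 7" using that by (auto simp: d_def)
    \<comment> \<open>Everything reduces to \<open>zeta8 ^ 4 = - 1\<close>: an odd \<open>d\<close>
      is refuted by the fourth power, 2 and 6 by the square, 4 directly.\<close>
    then consider "odd d" | "2 * d = 4" | "2 * d = 4 * 3" | "d = 4" by auto
    then show False
    proof cases
      case 1
      then show False using sq(2) by (simp add: power_mult zeta8_power4)
    next
      case 2
      then show False using sq(1) by (simp add: zeta8_power4)
    next
      case 3
      then have "(zeta8 ^ 4) ^ 3 = 1" using sq(1) by (metis power_mult)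
      then show False by (simp add: zeta8_power4)
    next
      case 4
      then show False using d by (simp add: zeta8_power4)
    qed
  qed
  show ?thesis using main[of r r'] main[of r' r] assms by (metis linorder_neqE_nat)
qed

text \<open>The odd characters are paired by Galois conjugation. The product of \<open>A r\<close>
  and \<open>A (r + 4)\<close> is the relative norm from the eighth cyclotomic field to the Gaussian
  field, since they differ by the sign of \<open>zeta8\<close>; the two Gaussian numbers so obtained
  are conjugate, and their product is a sum of two squares.\<close>

lemma prod_zeta8_sum: "(\<Prod>r<8. \<Sum>u<8. F u * zeta8 ^ (r * u)) = det_C8 F"
proof -
  let ?z = "zeta8" and ?i = "zeta8\<^sup>2"
  define A where "A = (\<lambda>r. \<Sum>u<8. F u * zeta8 ^ (r * u))"
  define a b c d where "a = F 0 - F 4" and "b = F 1 - F 5" and "c = F 2 - F 6" and "d = F 3 - F 7"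
  have i: "?i * ?i = - 1" "?i * (?i * x) = - x" for x
    using zeta8_power4 by (simp_all add: numeral_eq_Suc mult.assoc[symmetric])
  have red: "zeta8 ^ k = (if k mod 8 < 4 then zeta8 ^ (k mod 4) else - (zeta8 ^ (k mod 4)))" for k
  proof -
    have "zeta8 ^ k = zeta8 ^ (k mod 8)"
      by (rule power_cong_order[OF zeta8_power8]) (simp add: cong_def)
    moreover have "zeta8 ^ (k mod 8) = zeta8 ^ (4 + k mod 4)" if "\<not> k mod 8 < 4"
      using that by (intro arg_cong[of _ _ "\<lambda>k. zeta8 ^ k"]) presburger
    moreover have "zeta8 ^ (k mod 8) = zeta8 ^ (k mod 4)" if "k mod 8 < 4"
      using that by (intro arg_cong[of _ _ "\<lambda>k. zeta8 ^ k"]) presburger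
    ultimately show ?thesis by (simp add: power_add zeta8_power4)
  qed
  have z3: "zeta8 ^ 3 = ?z * ?i" by (simp add: numeral_eq_Suc)
  have A0: "A 0 = F 0 + F 4 + (F 1 + F 5) + (F 2 + F 6) + (F 3 + F 7)"
    by (simp add: A_def sum_lessThan_8)
  have A4: "A 4 = F 0 + F 4 - (F 1 + F 5) + (F 2 + F 6) - (F 3 + F 7)"
    by (simp add: A_def sum_lessThan_8 red)
  have A2: "A 2 = (F 0 + F 4 - (F 2 + F 6)) + ?i * (F 1 + F 5 - (F 3 + F 7))"
    by (simp add: A_def sum_lessThan_8 red algebra_simps)
  have A6: "A 6 = (F 0 + F 4 - (F 2 + F 6)) - ?i * (F 1 + F 5 - (F 3 + F 7))"
    by (simp add: A_def sum_lessThan_8 red algebra_simps)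
  have A1: "A 1 = (a + c * ?i) + ?z * (b + d * ?i)"
    by (simp add: A_def sum_lessThan_8 red z3 a_def b_def c_def d_def algebra_simps)
  have A5: "A 5 = (a + c * ?i) - ?z * (b + d * ?i)"
    by (simp add: A_def sum_lessThan_8 red z3 a_def b_def c_def d_def algebra_simps)
  have A3: "A 3 = (a - c * ?i) + ?z * (d + b * ?i)"
    by (simp add: A_def sum_lessThan_8 red z3 a_def b_def c_def d_def algebra_simps)
  have A7: "A 7 = (a - c * ?i) - ?z * (d + b * ?i)"
    by (simp add: A_def sum_lessThan_8 red z3 a_def b_def c_def d_def algebra_simps)
  have diff_sq: "(x + ?i * y) * (x - ?i * y) = x\<^sup>2 + y\<^sup>2" for x y
  proof -
    have "(x + ?i * y) * (x - ?i * y) = x * x - ?i * (?i * (y * y))" by (simp add: algebra_simps)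
    also have "\<dots> = x\<^sup>2 + y\<^sup>2" unfolding i by (simp add: power2_eq_square)
    finally show ?thesis .
  qed
  have zz: "(x + ?z * y) * (x - ?z * y) = x * x - ?i * (y * y)" for x y
    by (simp add: algebra_simps power2_eq_square)
  have "(a + c * j) * (a + c * j) - j * ((b + d * j) * (b + d * j)) = norm8_re a b c d + j * norm8_im a b c d"
    and "(a - c * j) * (a - c * j) - j * ((d + b * j) * (d + b * j)) = norm8_re a b c d - j * norm8_im a b c d"
    if j: "j * j = - 1" for j
  proof -
    have jj: "j * (j * x) = - x" for x using j by (simp flip: mult.assoc)
    show "(a + c * j) * (a + c * j) - j * ((b + d * j) * (b + d * j)) = norm8_re a b c d + j * norm8_im a b c d"
      and "(a - c * j) * (a - c * j) - j * ((d + b * j) * (d + b * j)) = norm8_re a b c d - j * norm8_im a b c d"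
      by (simp_all add: j jj norm8_re_def norm8_im_def power2_eq_square algebra_simps)
  qed
  from this[OF i(1)]
  have "A 1 * A 5 = norm8_re a b c d + ?i * norm8_im a b c d" "A 3 * A 7 = norm8_re a b c d - ?i * norm8_im a b c d"
    unfolding A1 A5 A3 A7 zz by simp_all
  then have odd: "(A 1 * A 5) * (A 3 * A 7) = (norm8_re a b c d)\<^sup>2 + (norm8_im a b c d)\<^sup>2"
    by (simp only: diff_sq)
  have "(\<Prod>r<8. A r) = (A 0 * A 4) * (A 2 * A 6) * ((A 1 * A 5) * (A 3 * A 7))"
    by (simp only: prod_lessThan_8 mult_ac)
  also have "\<dots> = det_C8 F"
    unfolding odd A2 A6 diff_sq A0 A4 det_C8_def det_C4_def a_def b_def c_def d_def
    by (simp only: mult.assoc)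
  finally show ?thesis unfolding A_def .
qed

lemma prod_C2C4_sum:
  "(\<Prod>r<8. \<Sum>u<8. F u * ((- 1) ^ ((r div 4) * (u div 4)) * \<i> ^ ((r mod 4) * (u mod 4)))) = det_C2C4 F"
proof -
  define A where "A = (\<lambda>r. \<Sum>u<8. F u * ((- 1) ^ ((r div 4) * (u div 4)) * \<i> ^ ((r mod 4) * (u mod 4))))"
  have i: "\<i> ^ 3 = - \<i>" "\<i> ^ 4 = 1" "\<i> ^ 6 = - 1" "\<i> ^ 9 = \<i>"
    by (simp_all add: eval_nat_numeral)
  have A: "A 0 = F 0 + F 4 + (F 1 + F 5) + (F 2 + F 6) + (F 3 + F 7)"
      "A 2 = F 0 + F 4 - (F 1 + F 5) + (F 2 + F 6) - (F 3 + F 7)"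
      "A 1 = (F 0 + F 4 - (F 2 + F 6)) + \<i> * (F 1 + F 5 - (F 3 + F 7))"
      "A 3 = (F 0 + F 4 - (F 2 + F 6)) - \<i> * (F 1 + F 5 - (F 3 + F 7))"
      "A 4 = F 0 - F 4 + (F 1 - F 5) + (F 2 - F 6) + (F 3 - F 7)"
      "A 6 = F 0 - F 4 - (F 1 - F 5) + (F 2 - F 6) - (F 3 - F 7)"
      "A 5 = (F 0 - F 4 - (F 2 - F 6)) + \<i> * (F 1 - F 5 - (F 3 - F 7))"
      "A 7 = (F 0 - F 4 - (F 2 - F 6)) - \<i> * (F 1 - F 5 - (F 3 - F 7))"
    by (simp_all add: A_def sum_lessThan_8 i algebra_simps)
  have diff_sq: "(x + \<i> * y) * (x - \<i> * y) = x\<^sup>2 + y\<^sup>2" for x y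
    by (simp add: algebra_simps power2_eq_square)
  have "(\<Prod>r<8. A r) = (A 0 * A 2 * (A 1 * A 3)) * (A 4 * A 6 * (A 5 * A 7))"
    by (simp only: prod_lessThan_8 mult_ac)
  also have "\<dots> = det_C2C4 F"
    unfolding A diff_sq det_C2C4_def det_C4_def by (rule refl)
  finally show ?thesis unfolding A_def .
qed

text \<open>The sign is -1 to the scalar product of the binary digits of \<open>r\<close> and
  \<open>u\<close>, both below 8. Thus \<open>r\<close> labels the characters of C_2^3, and the
  three factors match the three cyclic components.\<close>

definition walsh_sign :: "nat \<Rightarrow> nat \<Rightarrow> 'a::comm_ring_1"
  where "walsh_sign r u = (- 1) ^ ((r div 4) * (u div 4)) *
    ((- 1) ^ ((r div 2 mod 2) * (u div 2 mod 2)) * (- 1) ^ ((r mod 2) * (u mod 2)))"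

definition walsh :: "(nat \<Rightarrow> 'a::comm_ring_1) \<Rightarrow> nat \<Rightarrow> 'a"
  where "walsh F r = (\<Sum>u<8. F u * walsh_sign r u)"

lemma walsh_eqs:
  "walsh F 0 = F 0 + F 4 + (F 1 + F 5) + (F 2 + F 6) + (F 3 + F 7)"
  "walsh F 1 = F 0 + F 4 - (F 1 + F 5) + (F 2 + F 6) - (F 3 + F 7)"
  "walsh F 2 = F 0 + F 4 + (F 1 + F 5) - (F 2 + F 6) - (F 3 + F 7)"
  "walsh F 3 = F 0 + F 4 - (F 1 + F 5) - (F 2 + F 6) + (F 3 + F 7)"
  "walsh F 4 = F 0 - F 4 + (F 1 - F 5) + (F 2 - F 6) + (F 3 - F 7)"
  "walsh F 5 = F 0 - F 4 - (F 1 - F 5) + (F 2 - F 6) - (F 3 - F 7)"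
  "walsh F 6 = F 0 - F 4 + (F 1 - F 5) - (F 2 - F 6) - (F 3 - F 7)"
  "walsh F 7 = F 0 - F 4 - (F 1 - F 5) - (F 2 - F 6) + (F 3 - F 7)"
  by (simp_all add: walsh_def walsh_sign_def sum_lessThan_8 algebra_simps)

lemma prod_walsh: "(\<Prod>r<8. walsh F r) = det_C2C2C2 F"
  unfolding prod_lessThan_8 walsh_eqs det_C2C2C2_def det_C2C2_def by (simp only: mult.assoc)

lemma minus_one_power_inj:
  assumes "(- 1 :: complex) ^ a = (- 1) ^ b" "a < 2" "b < 2"
  shows "a = b"
  using assms by (auto simp: less_2_cases_iff)

lemma imaginary_unit_power_inj:
  assumes "\<i> ^ a = \<i> ^ b" "a < 4" "b < 4"
  shows "a = b"
proof -
  have "a = 0 \<or> a = 1 \<or> a = 2 \<or> a = 3" "b = 0 \<or> b = 1 \<or> b = 2 \<or> b = 3"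
    using assms(2,3) by auto
  moreover have "\<i> ^ 3 = - \<i>" by (simp add: eval_nat_numeral)
  ultimately show ?thesis using assms(1) by (elim disjE) (simp_all add: complex_eq_iff)
qed

section \<open>The three determinant sets as sets of products over congruent pairs\<close>

lemma int_group_dets_24:
  "int_group_dets TYPE(24) = {det_C8 f * enorm (det_C8 g) | f g. \<forall>u<8. 3 dvd f u - emod (g u)}"
proof (rule int_group_dets_times_C3)
  let ?\<phi> = "\<lambda>u v. of_nat (9 * u + 16 * v) :: 24"
  have 24: "CHAR(24) = CARD(24)" "CARD(24) = 3 * 8" by simp_all
  have idem: "[9 = 1] (mod 8::nat)" "[16 = 0] (mod 8::nat)" "[9 = 0] (mod 3::nat)" "[16 = 1] (mod 3::nat)"
    by (simp_all add: cong_def)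
  show "CARD(24) = 24" by simp
  show "\<exists>u<8. \<exists>v<3. ?\<phi> u v = x" for x
    by (rule of_nat_times_C3_surj[OF 24 _ idem]) simp
  have z: "(zeta8 ^ r) ^ 8 = 1" for r
    by (metis zeta8_power8 power_mult mult.commute power_one)
  show "character (cyclic_char (zeta8 ^ r * omega ^ s) :: 24 \<Rightarrow> complex)" for r s
    by (rule cyclic_char_times_C3(2)[OF 24 z idem])
  show "cyclic_char (zeta8 ^ r * omega ^ s) (?\<phi> u v) = zeta8 ^ (r * u) * omega ^ (s * v)" for r s u v
    unfolding cyclic_char_times_C3(1)[OF 24 z idem] by (simp add: power_mult)
  show "zeta8 ^ (r * 0) = 1" for r by simp
  show "r = r'" if "r < 8" "r' < 8" "\<And>u. u < 8 \<Longrightarrow> zeta8 ^ (r * u) = zeta8 ^ (r' * u)" for r r'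
    using that(3)[of 1] that(1,2) zeta8_power_inj by simp
  show "(\<Prod>r<8. \<Sum>u<8. F u * zeta8 ^ (r * u)) = det_C8 F" for F
    by (rule prod_zeta8_sum)
qed (simp_all add: det_H_defs)

lemma int_group_dets_2_12:
  "int_group_dets TYPE(2 \<times> 12) = {det_C2C4 f * enorm (det_C2C4 g) | f g. \<forall>u<8. 3 dvd f u - emod (g u)}"
proof (rule int_group_dets_times_C3)
  let ?X = "\<lambda>r u. (- 1) ^ ((r div 4) * (u div 4)) * \<i> ^ ((r mod 4) * (u mod 4))"
  let ?\<phi> = "\<lambda>u v. (of_nat (u div 4) :: 2, of_nat (9 * (u mod 4) + 4 * v) :: 12)"
  let ?c = "\<lambda>r s p. cyclic_char ((- 1) ^ (r div 4)) (fst p :: 2) * cyclic_char (\<i> ^ (r mod 4) * omega ^ s) (snd p :: 12)"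
  have 12: "CHAR(12) = CARD(12)" "CARD(12) = 3 * 4" by simp_all
  have 2: "CHAR(2) = CARD(2)" by simp
  have idem: "[9 = 1] (mod 4::nat)" "[4 = 0] (mod 4::nat)" "[9 = 0] (mod 3::nat)" "[4 = 1] (mod 3::nat)"
    by (simp_all add: cong_def)
  show "CARD(2 \<times> 12) = 24" by simp
  show "\<exists>u<8. \<exists>v<3. ?\<phi> u v = x" for x
  proof -
    obtain k where k: "k < 2" "of_nat k = fst x" using of_nat_less_CARD_surj[OF 2] by auto
    obtain u v where "u < 4" "v < 3" "of_nat (9 * u + 4 * v) = snd x"
      using of_nat_times_C3_surj[OF 12 _ idem, of "snd x"] by auto
    then have "?\<phi> (4 * k + u) v = x" "4 * k + u < 8" using k by (simp_all add: prod_eq_iff)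
    then show ?thesis using \<open>v < 3\<close> by blast
  qed
  have i: "(\<i> ^ r) ^ 4 = 1" for r
  proof -
    have "\<i> ^ 4 = 1" by (simp add: eval_nat_numeral)
    then show ?thesis by (metis power_mult mult.commute power_one)
  qed
  have m: "((- 1 :: complex) ^ r) ^ CARD(2) = 1" for r
    by (simp flip: power_mult)
  show "character (?c r s)" for r s
    by (rule character_prod[OF character_cyclic_char[OF 2 m] cyclic_char_times_C3(2)[OF 12 i idem]])
  show "?c r s (?\<phi> u v) = ?X r u * omega ^ (s * v)" for r s u v
    unfolding fst_conv snd_conv cyclic_char_times_C3(1)[OF 12 i idem] cyclic_char_of_nat[OF 2 m]
    by (simp add: power_mult)
  show "?X r 0 = 1" for r by simp
  show "r = r'" if "r < 8" "r' < 8" "\<And>u. u < 8 \<Longrightarrow> ?X r u = ?X r' u" for r r'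
  proof -
    have "?X r 1 = ?X r' 1" "?X r 4 = ?X r' 4" by (rule that(3); simp)+
    then have "(- 1 :: complex) ^ (r div 4) = (- 1) ^ (r' div 4)" "\<i> ^ (r mod 4) = \<i> ^ (r' mod 4)"
      by simp_all
    then have "r div 4 = r' div 4" "r mod 4 = r' mod 4"
      using minus_one_power_inj[of "r div 4" "r' div 4"] imaginary_unit_power_inj[of "r mod 4" "r' mod 4"] that(1,2)
      by linarith+
    then show ?thesis by (metis mult_div_mod_eq)
  qed
  show "(\<Prod>r<8. \<Sum>u<8. F u * ?X r u) = det_C2C4 F" for F
    by (rule prod_C2C4_sum)
qed (simp_all add: det_H_defs)

lemma int_group_dets_2_2_6:
  "int_group_dets TYPE(2 \<times> 2 \<times> 6) =
    {det_C2C2C2 f * enorm (det_C2C2C2 g) | f g. \<forall>u<8. 3 dvd f u - emod (g u)}"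
proof (rule int_group_dets_times_C3)
  let ?X = "\<lambda>r u. (- 1) ^ ((r div 4) * (u div 4)) * ((- 1) ^ ((r div 2 mod 2) * (u div 2 mod 2)) *
    (- 1) ^ ((r mod 2) * (u mod 2))) :: complex"
  let ?\<phi> = "\<lambda>u v. (of_nat (u div 4) :: 2, of_nat (u div 2 mod 2) :: 2, of_nat (3 * (u mod 2) + 4 * v) :: 6)"
  let ?c = "\<lambda>r s p. cyclic_char ((- 1) ^ (r div 4)) (fst p :: 2) *
    (cyclic_char ((- 1) ^ (r div 2 mod 2)) (fst (snd p) :: 2) *
     cyclic_char ((- 1) ^ (r mod 2) * omega ^ s) (snd (snd p) :: 6))"
  have 6: "CHAR(6) = CARD(6)" "CARD(6) = 3 * 2" by simp_all
  have 2: "CHAR(2) = CARD(2)" by simp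
  have idem: "[3 = 1] (mod 2::nat)" "[4 = 0] (mod 2::nat)" "[3 = 0] (mod 3::nat)" "[4 = 1] (mod 3::nat)"
    by (simp_all add: cong_def)
  show "CARD(2 \<times> 2 \<times> 6) = 24" by simp
  show "\<exists>u<8. \<exists>v<3. ?\<phi> u v = x" for x
  proof -
    obtain k where k: "k < 2" "of_nat k = fst x" using of_nat_less_CARD_surj[OF 2] by auto
    obtain l where l: "l < 2" "of_nat l = fst (snd x)" using of_nat_less_CARD_surj[OF 2] by auto
    obtain u v where uv: "u < 2" "v < 3" "of_nat (3 * u + 4 * v) = snd (snd x)"
      using of_nat_times_C3_surj[OF 6 _ idem, of "snd (snd x)"] by auto
    have "(4 * k + 2 * l + u) div 4 = k" "(4 * k + 2 * l + u) div 2 mod 2 = l" "(4 * k + 2 * l + u) mod 2 = u"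
      "4 * k + 2 * l + u < 8"
      using k(1) l(1) uv(1) by presburger+
    then have "?\<phi> (4 * k + 2 * l + u) v = x" "4 * k + 2 * l + u < 8"
      using k l uv by (simp_all add: prod_eq_iff)
    then show ?thesis using \<open>v < 3\<close> by blast
  qed
  have m: "((- 1 :: complex) ^ r) ^ CARD(2) = 1" for r
    by (simp flip: power_mult)
  have m2: "((- 1 :: complex) ^ r) ^ 2 = 1" for r
    by (simp flip: power_mult)
  show "character (?c r s)" for r s
    by (rule character_prod[OF character_cyclic_char[OF 2 m]
          character_prod[OF character_cyclic_char[OF 2 m] cyclic_char_times_C3(2)[OF 6 m2 idem]]])
  show "?c r s (?\<phi> u v) = ?X r u * omega ^ (s * v)" for r s u v
    unfolding fst_conv snd_conv cyclic_char_times_C3(1)[OF 6 m2 idem] cyclic_char_of_nat[OF 2 m]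
    by (simp add: power_mult)
  show "?X r 0 = 1" for r by simp
  show "r = r'" if "r < 8" "r' < 8" "\<And>u. u < 8 \<Longrightarrow> ?X r u = ?X r' u" for r r'
  proof -
    have "?X r 1 = ?X r' 1" "?X r 2 = ?X r' 2" "?X r 4 = ?X r' 4" by (rule that(3); simp)+
    then have "(- 1 :: complex) ^ (r div 4) = (- 1) ^ (r' div 4)"
        "(- 1 :: complex) ^ (r div 2 mod 2) = (- 1) ^ (r' div 2 mod 2)"
        "(- 1 :: complex) ^ (r mod 2) = (- 1) ^ (r' mod 2)"
      by simp_all
    then have "r div 4 = r' div 4" "r div 2 mod 2 = r' div 2 mod 2" "r mod 2 = r' mod 2"
      using minus_one_power_inj[of "r div 4" "r' div 4"] minus_one_power_inj[of "r div 2 mod 2" "r' div 2 mod 2"]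
        minus_one_power_inj[of "r mod 2" "r' mod 2"] that(1,2)
      by linarith+
    moreover have "r = 4 * (r div 4) + 2 * (r div 2 mod 2) + r mod 2" for r :: nat by presburger
    ultimately show ?thesis by metis
  qed
  show "(\<Prod>r<8. \<Sum>u<8. F u * ?X r u) = det_C2C2C2 F" for F
    by (rule prod_walsh[unfolded walsh_def walsh_sign_def])
qed (simp_all add: det_H_defs)

subsection \<open>Signed powers of two\<close>

lemma signed_two_powers_mult_iff:
  "x * y \<in> signed_two_powers \<longleftrightarrow> x \<in> signed_two_powers \<and> y \<in> signed_two_powers"
proof
  assume "x * y \<in> signed_two_powers"
  then obtain k where "\<bar>x * y\<bar> = 2 ^ k" by (auto simp: signed_two_powers_def)
  then have k: "x dvd 2 ^ k" "y dvd 2 ^ k" by (metis dvd_abs_iff dvd_triv_left dvd_triv_right)+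
  have "z \<in> signed_two_powers" if z: "z dvd 2 ^ k" for z
  proof -
    have "prime (2::int)" by simp
    then obtain i where "normalize z = 2 ^ i" using divides_primepow[OF \<open>prime (2::int)\<close> z] by metis
    then show ?thesis by (auto simp: signed_two_powers_def)
  qed
  then show "x \<in> signed_two_powers \<and> y \<in> signed_two_powers" using k by blast
next
  assume "x \<in> signed_two_powers \<and> y \<in> signed_two_powers"
  then show "x * y \<in> signed_two_powers"
    by (auto simp: signed_two_powers_def abs_mult simp flip: power_add)
qed

lemma signed_two_powers_odd: "x \<in> signed_two_powers \<Longrightarrow> odd x \<Longrightarrow> \<bar>x\<bar> = 1"
proof -
  assume "x \<in> signed_two_powers" "odd x"
  then obtain k where k: "\<bar>x\<bar> = 2 ^ k" by (auto simp: signed_two_powers_def)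
  then have "odd ((2::int) ^ k)" using \<open>odd x\<close> by (metis dvd_abs_iff)
  then have "k = 0" by simp
  then show "\<bar>x\<bar> = 1" using k by simp
qed

lemma signed_two_powers_even: "x \<in> signed_two_powers \<Longrightarrow> even x \<Longrightarrow> 2 \<le> \<bar>x\<bar>"
proof -
  assume "x \<in> signed_two_powers" "even x"
  then have "x \<noteq> 0" "\<bar>x\<bar> \<noteq> 1"
    by (auto simp: signed_two_powers_def) (metis dvd_abs_iff odd_one)
  then show "2 \<le> \<bar>x\<bar>" by linarith
qed

lemma square_mod_3: "\<not> 3 dvd z \<Longrightarrow> 3 dvd z\<^sup>2 - 1" for z :: int
proof -
  assume "\<not> 3 dvd z"
  then have "3 dvd z - 1 \<or> 3 dvd z + 1" by presburger
  moreover have "z\<^sup>2 - 1 = (z - 1) * (z + 1)" by (simp add: power2_eq_square algebra_simps)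
  ultimately show ?thesis by (metis dvd_mult dvd_mult2)
qed

lemma two_power_mod_3: "(2::int) ^ k mod 3 = (if even k then 1 else 2)"
proof (induction k)
  case (Suc k)
  have "(2::int) ^ Suc k mod 3 = (2 * (2 ^ k mod 3)) mod 3" by (simp add: mod_mult_right_eq)
  then show ?case using Suc by simp
qed simp

lemma signed_two_powers_not_dvd_3: "x \<in> signed_two_powers \<Longrightarrow> \<not> 3 dvd x"
proof
  assume "x \<in> signed_two_powers" "3 dvd x"
  then obtain k where "3 dvd (2::int) ^ k" by (auto simp: signed_two_powers_def) (metis dvd_abs_iff)
  then show False using two_power_mod_3[of k] by (simp add: dvd_eq_mod_eq_0 split: if_splits)
qed

text \<open>As -2 is 1 modulo 3, exactly one member of each pair 2^k, -(2^k) is 1 modulo 3, namely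
  the power of -2.\<close>

lemma signed_two_powers_mod_3:
  assumes "x \<in> signed_two_powers" "3 dvd x - 1"
  obtains k where "x = (- 2) ^ k"
proof -
  obtain k where k: "\<bar>x\<bar> = 2 ^ k" using assms(1) by (auto simp: signed_two_powers_def)
  have m: "(2::int) ^ k mod 3 = (if even k then 1 else 2)" by (rule two_power_mod_3)
  have "x = 2 ^ k \<or> x = - (2 ^ k)" using k by linarith
  then have "x = (- 2) ^ k"
  proof
    assume x: "x = 2 ^ k"
    then have "even k" using m assms(2) by (cases "even k"; simp; presburger)
    then show ?thesis using x by simp
  next
    assume x: "x = - (2 ^ k)"
    then have "odd k" using m assms(2) by (cases "even k"; simp; presburger)
    then show ?thesis using x by simp
  qed
  then show ?thesis by (rule that)
qed

section \<open>The inert prime 2 in the Eisenstein integers\<close>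

lemma enorm_nonneg: "0 \<le> enorm x"
proof -
  have "2 * enorm x = (eis_re x - eis_om x)\<^sup>2 + (eis_re x)\<^sup>2 + (eis_om x)\<^sup>2"
    by (simp add: enorm_def power2_eq_square algebra_simps)
  then have "0 \<le> 2 * enorm x" by simp
  then show ?thesis by simp
qed

lemma even_eis_iff: "2 dvd x \<longleftrightarrow> even (eis_re x) \<and> even (eis_om x)" for x :: eis
proof
  assume "2 dvd x"
  then show "even (eis_re x) \<and> even (eis_om x)" by (auto simp: dvd_def)
next
  assume "even (eis_re x) \<and> even (eis_om x)"
  then obtain a b where "eis_re x = 2 * a" "eis_om x = 2 * b" by (auto elim!: evenE)
  then have "x = 2 * Eis a b" by (simp add: eis.expand)
  then show "2 dvd x" by simp
qed

text \<open>The form x^2 - x y + y^2 is anisotropic modulo 2, that is, 2 is inert. Multiplicativity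
  of the norm then makes 2 a prime element.\<close>

lemma even_enorm_iff: "even (enorm x) \<longleftrightarrow> 2 dvd x"
  by (auto simp: enorm_def even_eis_iff)

lemma even_eis_mult_iff: "2 dvd x * y \<longleftrightarrow> 2 dvd x \<or> 2 dvd y" for x y :: eis
  by (simp add: even_enorm_iff[symmetric] enorm_mult)

lemma even_eis_power_iff: "2 dvd x ^ n \<longleftrightarrow> 2 dvd x \<and> n > 0" for x :: eis
  by (induction n) (auto simp: even_eis_mult_iff even_eis_iff[of 1])

lemma enorm_even_ge:
  assumes "2 dvd x" "enorm x \<in> signed_two_powers"
  shows "4 \<le> enorm x"
proof -
  obtain y where y: "x = 2 * y" using assms(1) by (auto simp: dvd_def)
  then have "enorm x = 4 * enorm y" by (simp add: enorm_def power2_eq_square)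
  moreover have "enorm x \<noteq> 0" using assms(2) by (auto simp: signed_two_powers_def)
  ultimately show ?thesis using enorm_nonneg[of y] by auto
qed

lemma enorm_odd_eq_1:
  assumes "\<not> 2 dvd x" "enorm x \<in> signed_two_powers"
  shows "enorm x = 1"
  using signed_two_powers_odd[OF assms(2)] assms(1) enorm_nonneg[of x] by (simp add: even_enorm_iff)

lemma dvd_diff_iff: "d dvd a - b \<Longrightarrow> d dvd a \<longleftrightarrow> d dvd b" for d a b :: "'a::comm_ring_1"
  by (metis diff_add_cancel dvd_add_right_iff dvd_add)

lemma emod_simps [simp]:
  "emod (x + y) = emod x + emod y" "emod (x - y) = emod x - emod y" "emod (numeral n) = numeral n" "emod 1 = 1"
  by (simp_all add: emod_def)

lemma emod_mult: "3 dvd emod (x * y) - emod x * emod y"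
proof -
  have "emod (x * y) - emod x * emod y = 3 * (- (eis_om x * eis_om y))"
    by (simp add: emod_def algebra_simps)
  then show ?thesis by simp
qed

subsection \<open>Units on $C_4$\<close>

text \<open>The numbers \<open>X + Y\<close>, \<open>X - Y\<close> and \<open>x + i y\<close> are the values at \<open>1\<close>, \<open>-1\<close> and \<open>i\<close> of a unit of the
  group ring of \<open>C\<^sub>4\<close> over the Eisenstein integers. The relative norm of \<open>x + i y\<close> to the Gaussian
  integers is the Gaussian unit \<open>enorm x - enorm y + 2 Re (x y') i\<close>, where \<open>y'\<close> is the conjugate of \<open>y\<close>.
  Congruence modulo \<open>2\<close> with the values at \<open>1\<close> and \<open>-1\<close> makes its imaginary part even, hence zero,
  so the square of \<open>p + i q\<close> is real modulo \<open>3\<close>.\<close>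

lemma C4_unit:
  assumes "enorm (X + Y) = 1" "enorm (X - Y) = 1" "enorm (x\<^sup>2 + y\<^sup>2) = 1"
    and "2 dvd X - x" "2 dvd Y - y"
    and "3 dvd p - emod x" "3 dvd q - emod y"
    and S: "p\<^sup>2 + q\<^sup>2 \<in> signed_two_powers"
  shows "\<exists>j. p\<^sup>2 + q\<^sup>2 = 4 ^ j"
proof -
  \<comment> \<open>The trace of x times the conjugate of y, which is the polarisation of the norm
    form.\<close>
  define tr where "tr = (\<lambda>x y. 2 * eis_re x * eis_re y - eis_re x * eis_om y - eis_om x * eis_re y
    + 2 * eis_om x * eis_om y)"
  have "2 * tr X Y = enorm (X + Y) - enorm (X - Y)"
    by (simp add: tr_def enorm_def power2_eq_square algebra_simps)
  then have "tr X Y = 0" using assms(1,2) by simp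
  moreover have "even (tr X Y) \<longleftrightarrow> even (tr x y)"
    using assms(4,5) by (auto simp: tr_def even_eis_iff)
  ultimately have even: "even (tr x y)" by simp
  have "(enorm x - enorm y)\<^sup>2 + (tr x y)\<^sup>2 = enorm (x\<^sup>2 + y\<^sup>2)"
    by (simp add: tr_def enorm_def power2_eq_square algebra_simps)
  then have "(tr x y)\<^sup>2 \<le> 1" using assms(3) by (smt (verit) zero_le_power2)
  then have "\<bar>tr x y\<bar> \<le> 1" by (simp add: abs_square_le_1)
  then have tr0: "tr x y = 0" using even by (auto elim!: evenE)
  \<comment> \<open>Conjugation is trivial modulo 1 - \<omega>, so the trace becomes twice a product
    of residues; its vanishing makes one of \<open>p\<close>, \<open>q\<close> divisible by
    3.\<close>
  have "tr x y - 2 * (emod x * emod y) = 3 * (- (eis_re x * eis_om y) - eis_om x * eis_re y)"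
    by (simp add: tr_def emod_def algebra_simps)
  then have "3 dvd emod x * emod y" using tr0 by presburger
  then have "3 dvd emod x \<or> 3 dvd emod y" by (simp add: prime_dvd_mult_iff)
  then have pq: "3 dvd p \<or> 3 dvd q" using assms(6,7) dvd_diff_iff by blast
  have sq: "3 dvd z \<or> 3 dvd z\<^sup>2 - 1" for z :: int
    using square_mod_3 by blast
  have not3: "\<not> (3 dvd p \<and> 3 dvd q)"
    using signed_two_powers_not_dvd_3[OF S] by (auto simp: power2_eq_square)
  have "3 dvd p\<^sup>2 + q\<^sup>2 - 1"
    using pq
  proof
    assume p: "3 dvd p"
    then have "3 dvd p\<^sup>2" "3 dvd q\<^sup>2 - 1" using not3 sq[of q] by (auto simp: power2_eq_square)
    then show ?thesis by presburger
  next
    assume q: "3 dvd q"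
    then have "3 dvd q\<^sup>2" "3 dvd p\<^sup>2 - 1" using not3 sq[of p] by (auto simp: power2_eq_square)
    then show ?thesis by presburger
  qed
  then obtain k where k: "p\<^sup>2 + q\<^sup>2 = (- 2) ^ k" using signed_two_powers_mod_3[OF S] by metis
  \<comment> \<open>A sum of two squares is not negative, so the power of -2 is in fact a power of
    4.\<close>
  have "even k"
  proof (rule ccontr)
    assume "odd k"
    then have "(- 2 :: int) ^ k < 0" by simp
    then show False using k by (smt (verit) zero_le_power2)
  qed
  then obtain j where "k = 2 * j" by (auto elim: evenE)
  then show ?thesis using k by (auto simp: power_mult)
qed

subsection \<open>Parity of the factors of a group determinant\<close>

text \<open>The characters of a 2-group agree modulo a prime above 2. The second factor is a product
  of two conjugate values, hence congruent to a square.\<close>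

lemma C4_parity:
  fixes a b c d :: "'a::comm_ring_1"
  shows "2 dvd (a - b + c - d) - (a + b + c + d)"
    and "2 dvd ((a - c)\<^sup>2 + (b - d)\<^sup>2) - (a + b + c + d)\<^sup>2"
proof -
  have "(a - b + c - d) - (a + b + c + d) = 2 * (- b - d)" by (simp add: algebra_simps)
  then show "2 dvd (a - b + c - d) - (a + b + c + d)" by (metis dvd_triv_left)
  have "((a - c)\<^sup>2 + (b - d)\<^sup>2) - (a + b + c + d)\<^sup>2 = 2 * (- (2 * a * c + 2 * b * d + a * b + a * d + b * c + c * d))"
    by (simp add: power2_eq_square algebra_simps)
  then show "2 dvd ((a - c)\<^sup>2 + (b - d)\<^sup>2) - (a + b + c + d)\<^sup>2" by (metis dvd_triv_left)
qed

text \<open>Here four conjugate values are multiplied, hence the fourth power of the coefficient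
  sum.\<close>

lemma C8_parity:
  fixes a b c d :: "'a::comm_ring_1"
  shows "2 dvd ((norm8_re a b c d)\<^sup>2 + (norm8_im a b c d)\<^sup>2) - ((a + b + c + d)\<^sup>2)\<^sup>2"
proof -
  have sq: "2 dvd (x\<^sup>2 + y\<^sup>2) - (x + y)\<^sup>2" for x y :: 'a
  proof -
    have "(x\<^sup>2 + y\<^sup>2) - (x + y)\<^sup>2 = 2 * (- (x * y))" by (simp add: power2_eq_square algebra_simps)
    then show ?thesis by (metis dvd_triv_left)
  qed
  have "2 dvd (norm8_re a b c d + norm8_im a b c d) - (a + b + c + d)\<^sup>2"
  proof -
    have "(norm8_re a b c d + norm8_im a b c d) - (a + b + c + d)\<^sup>2 =
      2 * (- (b\<^sup>2 + c\<^sup>2 + a * b + a * d + b * c + c * d))"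
      by (simp add: norm8_re_def norm8_im_def power2_eq_square algebra_simps)
    then show ?thesis by (metis dvd_triv_left)
  qed
  then have "2 dvd (norm8_re a b c d + norm8_im a b c d)\<^sup>2 - ((a + b + c + d)\<^sup>2)\<^sup>2"
    by (metis dvd_mult square_diff_square_factored power2_eq_square)
  from dvd_add[OF sq[of "norm8_re a b c d" "norm8_im a b c d"] this] show ?thesis
    by (simp only: diff_add_eq diff_diff_eq2 diff_add_cancel add_diff_eq add_diff_cancel)
qed

lemma emod_cong_add: "3 dvd m - emod x \<Longrightarrow> 3 dvd n - emod y \<Longrightarrow> 3 dvd (m + n) - emod (x + y)"
  by (simp add: algebra_simps) presburger

lemma emod_cong_diff: "3 dvd m - emod x \<Longrightarrow> 3 dvd n - emod y \<Longrightarrow> 3 dvd (m - n) - emod (x - y)"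
  by (simp add: algebra_simps) presburger

lemma emod_cong_mult:
  assumes "3 dvd m - emod x" "3 dvd n - emod y"
  shows "3 dvd m * n - emod (x * y)"
proof -
  have eq: "m * n - emod (x * y) = (m - emod x) * n + emod x * (n - emod y) - (emod (x * y) - emod x * emod y)"
    by (simp add: algebra_simps)
  show ?thesis
    unfolding eq by (intro dvd_diff dvd_add dvd_mult dvd_mult2 assms emod_mult)
qed

lemma emod_cong_power2: "3 dvd m - emod x \<Longrightarrow> 3 dvd m\<^sup>2 - emod (x\<^sup>2)"
  unfolding power2_eq_square by (rule emod_cong_mult)

lemma emod_cong_numeral: "3 dvd numeral k - emod (numeral k)"
  by simp

text \<open>Rules that follow the syntax of a polynomial and reduce its congruence modulo 1 -
  \<omega> to that of its coefficients.\<close>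

lemmas emod_cong = emod_cong_add emod_cong_diff emod_cong_mult emod_cong_power2 emod_cong_numeral

lemma enorm_power2: "enorm (x\<^sup>2) = (enorm x)\<^sup>2"
  by (simp add: power2_eq_square enorm_mult)

lemma dvd_power2_diff: "d dvd a - b \<Longrightarrow> d dvd a\<^sup>2 - b\<^sup>2" for d a b :: "'a::comm_ring_1"
  by (simp add: power2_eq_square square_diff_square_factored)

subsection \<open>The group $C_{24}$\<close>

lemma even_if_4_dvd_sum_squares:
  fixes x y :: int
  assumes "4 dvd x\<^sup>2 + y\<^sup>2"
  shows "even x \<and> even y"
proof -
  have "even (x\<^sup>2 + y\<^sup>2)" by (rule dvd_trans[OF _ assms]) simp
  then have par: "even x \<longleftrightarrow> even y" by simp
  have "even x"
  proof (rule ccontr)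
    assume "odd x"
    then obtain k l where "x = 2 * k + 1" "y = 2 * l + 1" using par by (metis oddE)
    then have "x\<^sup>2 + y\<^sup>2 = 4 * (k\<^sup>2 + k + l\<^sup>2 + l) + 2" by (simp add: power2_eq_square algebra_simps)
    then have "4 dvd 4 * (k\<^sup>2 + k + l\<^sup>2 + l) + 2" using assms by metis
    then show False by presburger
  qed
  then show ?thesis using par by simp
qed

text \<open>With all coefficients of one parity,
  \<open>a + b \<zeta> + c \<zeta>^2 + d \<zeta>^3\<close> is, modulo 2, a multiple of 1 + \<zeta> +
  \<zeta>^2 + \<zeta>^3, which is -2/(\<zeta> - 1) and has norm 8. So the norm is a multiple of 8.
  In elementary terms, both parts are even and their difference is divisible by 4.\<close>

lemma norm8_square_neq_4:
  fixes a b c d :: int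
  assumes "even (a - b)" "even (a - c)" "even (a - d)"
  shows "(norm8_re a b c d)\<^sup>2 + (norm8_im a b c d)\<^sup>2 \<noteq> 4"
proof
  assume *: "(norm8_re a b c d)\<^sup>2 + (norm8_im a b c d)\<^sup>2 = 4"
  have "even (norm8_re a b c d)" "even (norm8_im a b c d)"
    using assms by (auto simp: norm8_re_def norm8_im_def)
  then obtain p q where p: "norm8_re a b c d = 2 * p" and q: "norm8_im a b c d = 2 * q"
    by (metis evenE)
  obtain k l m where "a - b = 2 * k" "a - c = 2 * l" "a - d = 2 * m"
    using assms by (meson evenE)
  then have bcd: "b = a - 2 * k" "c = a - 2 * l" "d = a - 2 * m" by simp_all
  have "norm8_re a b c d - norm8_im a b c d =
      4 * (2 * a * l - l\<^sup>2 - 2 * a * k + 2 * k * m + k\<^sup>2 - m\<^sup>2)"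
    unfolding bcd by (simp add: norm8_re_def norm8_im_def power2_eq_square algebra_simps)
  then have "even (p - q)" unfolding p q by presburger
  then have "even (p\<^sup>2 + q\<^sup>2)" by simp
  moreover have "p\<^sup>2 + q\<^sup>2 = 1" using * unfolding p q by (simp add: power_mult_distrib)
  ultimately show False by simp
qed

lemma det_C8_two_power:
  assumes fg: "\<forall>u<8. 3 dvd f u - emod (g u)"
    and S: "det_C8 f * enorm (det_C8 g) \<in> signed_two_powers"
  shows "\<bar>det_C8 f * enorm (det_C8 g)\<bar> = 1 \<or> 2 ^ 8 \<le> \<bar>det_C8 f * enorm (det_C8 g)\<bar>"
proof -
  define r where "r = (\<lambda>u. f u + f (u + 4))"
  define f1 f2 n4 where "f1 = r 0 + r 1 + r 2 + r 3" and "f2 = r 0 - r 1 + r 2 - r 3"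
    and "n4 = (r 0 - r 2)\<^sup>2 + (r 1 - r 3)\<^sup>2"
  define P Q where "P = norm8_re (f 0 - f 4) (f 1 - f 5) (f 2 - f 6) (f 3 - f 7)"
    and "Q = norm8_im (f 0 - f 4) (f 1 - f 5) (f 2 - f 6) (f 3 - f 7)"
  define n8 where "n8 = P\<^sup>2 + Q\<^sup>2"
  define s where "s = (\<lambda>u. g u + g (u + 4))"
  define g1 g2 m4 where "g1 = s 0 + s 1 + s 2 + s 3" and "g2 = s 0 - s 1 + s 2 - s 3"
    and "m4 = (s 0 - s 2)\<^sup>2 + (s 1 - s 3)\<^sup>2"
  define P' Q' where "P' = norm8_re (g 0 - g 4) (g 1 - g 5) (g 2 - g 6) (g 3 - g 7)"
    and "Q' = norm8_im (g 0 - g 4) (g 1 - g 5) (g 2 - g 6) (g 3 - g 7)"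
  define m8 where "m8 = P'\<^sup>2 + Q'\<^sup>2"
  have detf: "det_C8 f = f1 * f2 * n4 * n8"
    by (simp add: det_C8_def det_C4_def f1_def f2_def n4_def n8_def P_def Q_def r_def)
  have detg: "det_C8 g = g1 * g2 * m4 * m8"
    by (simp add: det_C8_def det_C4_def g1_def g2_def m4_def m8_def P'_def Q'_def s_def)
  have Sf: "f1 \<in> signed_two_powers" "f2 \<in> signed_two_powers" "n4 \<in> signed_two_powers" "n8 \<in> signed_two_powers"
    and Sg: "enorm g1 \<in> signed_two_powers" "enorm g2 \<in> signed_two_powers"
      "enorm m4 \<in> signed_two_powers" "enorm m8 \<in> signed_two_powers"
    using S by (simp_all add: detf detg enorm_mult signed_two_powers_mult_iff)
  have parf: "even f2 \<longleftrightarrow> even f1" "even n4 \<longleftrightarrow> even f1" "even n8 \<longleftrightarrow> even f1"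
    by (auto simp: f1_def f2_def n4_def n8_def P_def Q_def r_def norm8_re_def norm8_im_def)
  have cong2: "2 dvd g2 - g1" "2 dvd m4 - g1\<^sup>2" "2 dvd m8 - (g1\<^sup>2)\<^sup>2"
  proof -
    show "2 dvd g2 - g1" "2 dvd m4 - g1\<^sup>2"
      unfolding g1_def g2_def m4_def by (rule C4_parity)+
    let ?h = "(g 0 - g 4) + (g 1 - g 5) + (g 2 - g 6) + (g 3 - g 7)"
    have "?h - g1 = 2 * (- g 4 - g 5 - g 6 - g 7)" by (simp add: g1_def s_def algebra_simps)
    then have "2 dvd ?h - g1" by (metis dvd_triv_left)
    then have "2 dvd (?h\<^sup>2)\<^sup>2 - (g1\<^sup>2)\<^sup>2" by (intro dvd_power2_diff)
    from dvd_add[OF C8_parity[of "g 0 - g 4" "g 1 - g 5" "g 2 - g 6" "g 3 - g 7"] this]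
    show "2 dvd m8 - (g1\<^sup>2)\<^sup>2"
      by (simp only: m8_def P'_def Q'_def diff_add_eq diff_diff_eq2 diff_add_cancel add_diff_eq add_diff_cancel)
  qed
  have parg: "2 dvd g2 \<longleftrightarrow> 2 dvd g1" "2 dvd m4 \<longleftrightarrow> 2 dvd g1" "2 dvd m8 \<longleftrightarrow> 2 dvd g1"
    using cong2[THEN dvd_diff_iff] by (simp_all add: even_eis_power_iff)
  have pos: "\<bar>det_C8 f\<bar> \<ge> 1"
    using S unfolding signed_two_powers_mult_iff by (auto simp: signed_two_powers_def)
  have mono4: "a * b * c * d \<le> x * y * z * w" if "a \<le> x" "b \<le> y" "c \<le> z" "d \<le> w" "0 \<le> a" "0 \<le> b" "0 \<le> c" "0 \<le> d"
    for a b c d x y z w :: int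
    using that by (intro mult_mono) auto
  show ?thesis
  proof (cases "2 dvd g1")
    case True
    have "4 * 4 * 4 * 4 \<le> enorm g1 * enorm g2 * enorm m4 * enorm m8"
      using True parg Sg by (intro mono4 enorm_even_ge) simp_all
    then have "256 \<le> enorm (det_C8 g)" by (simp add: detg enorm_mult)
    then have "1 * 256 \<le> \<bar>det_C8 f\<bar> * \<bar>enorm (det_C8 g)\<bar>" using pos by (intro mult_mono) auto
    then show ?thesis by (simp add: abs_mult)
  next
    case False
    then have g1: "enorm g1 = 1" "enorm g2 = 1" "enorm m4 = 1" "enorm m8 = 1"
      using parg Sg by (auto intro: enorm_odd_eq_1)
    then have det: "det_C8 f * enorm (det_C8 g) = f1 * f2 * n4 * n8" by (simp add: detf detg enorm_mult)
    have fg': "3 dvd f u - emod (g u)" if "u < 8" for u using fg that by blast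
    have n4: "\<exists>j. n4 = 4 ^ j"
      unfolding n4_def
    proof (rule C4_unit)
      show "enorm ((s 0 + s 2) + (s 1 + s 3)) = 1" "enorm ((s 0 + s 2) - (s 1 + s 3)) = 1"
        using g1(1,2) by (simp_all add: g1_def g2_def algebra_simps)
      show "enorm ((s 0 - s 2)\<^sup>2 + (s 1 - s 3)\<^sup>2) = 1" using g1(3) by (simp add: m4_def)
      show "2 dvd s 0 + s 2 - (s 0 - s 2)" "2 dvd s 1 + s 3 - (s 1 - s 3)" by (simp_all flip: mult_2)
      show "3 dvd r 0 - r 2 - emod (s 0 - s 2)" "3 dvd r 1 - r 3 - emod (s 1 - s 3)"
        unfolding r_def s_def by (intro emod_cong fg'; simp)+
      show "(r 0 - r 2)\<^sup>2 + (r 1 - r 3)\<^sup>2 \<in> signed_two_powers" using Sf(3) by (simp add: n4_def)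
    qed
    have n8: "\<exists>j. n8 = 4 ^ j"
      unfolding n8_def
    proof (rule C4_unit)
      \<comment> \<open>The unit criterion on C_4 is applied to g(x) g(-x), a polynomial in y = x^2.
        Modulo y^2 - 1 it is \<open>?X + ?Y y\<close>, with values \<open>g1 * g2\<close> at y = 1
        and \<open>m4\<close> at y = -1, while its value at y = i is
        \<open>P' + Q' i\<close>.\<close>
      let ?X = "(s 0)\<^sup>2 + (s 2)\<^sup>2 - 2 * s 1 * s 3" and ?Y = "2 * s 0 * s 2 - (s 1)\<^sup>2 - (s 3)\<^sup>2"
      have "?X + ?Y = g1 * g2" "?X - ?Y = m4"
        by (simp_all add: g1_def g2_def m4_def power2_eq_square algebra_simps)
      then show "enorm (?X + ?Y) = 1" "enorm (?X - ?Y) = 1" using g1 by (simp_all add: enorm_mult)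
      show "enorm (P'\<^sup>2 + Q'\<^sup>2) = 1" using g1(4) by (simp add: m8_def)
      have "?X - P' = 2 * (2 * g 0 * g 4 + (g 2)\<^sup>2 + (g 6)\<^sup>2 - s 1 * s 3 - (g 1 - g 5) * (g 3 - g 7))"
        "?Y - Q' = 2 * (s 0 * s 2 - (g 0 - g 4) * (g 2 - g 6) - 2 * g 1 * g 5 - (g 3)\<^sup>2 - (g 7)\<^sup>2)"
        by (simp_all add: s_def P'_def Q'_def norm8_re_def norm8_im_def power2_eq_square algebra_simps)
      then show "2 dvd ?X - P'" "2 dvd ?Y - Q'" by (metis dvd_triv_left)+
      show "3 dvd P - emod P'" "3 dvd Q - emod Q'"
        unfolding P_def Q_def P'_def Q'_def norm8_re_def norm8_im_def by (intro emod_cong fg'; simp)+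
      show "P\<^sup>2 + Q\<^sup>2 \<in> signed_two_powers" using Sf(4) by (simp add: n8_def)
    qed
    show ?thesis
    proof (cases "odd f1")
      case True
      then have "\<bar>f1\<bar> = 1" "\<bar>f2\<bar> = 1" "\<bar>n4\<bar> = 1" "\<bar>n8\<bar> = 1"
        using parf Sf by (auto intro!: signed_two_powers_odd)
      then show ?thesis unfolding det by (simp add: abs_mult)
    next
      case False
      then have even: "even f1" "even f2" "even n4" "even n8" using parf by simp_all
      obtain j l where j: "n4 = 4 ^ j" and l: "n8 = 4 ^ l" using n4 n8 by blast
      have "j > 0" "l > 0" using even j l by (auto intro: gr0I)
      \<comment> \<open>The factors found so far only guarantee 2 * 2 * 4 * 4 = 64. The next
        possible values are excluded by a relation modulo 2 between the coefficients.\<close>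
      have "2 ^ 8 \<le> \<bar>f1 * f2 * n4 * n8\<bar>"
      proof (rule ccontr)
        assume *: "\<not> ?thesis"
        obtain a b where a: "f1 = 2 * a" and b: "f2 = 2 * b" using even by (metis evenE)
        have Sab: "a \<in> signed_two_powers" "b \<in> signed_two_powers"
          using Sf a b by (simp_all add: signed_two_powers_mult_iff)
        then have ab1: "1 \<le> \<bar>a\<bar> * \<bar>b\<bar>" by (auto simp: signed_two_powers_def simp flip: power_add)
        have lt: "\<bar>a\<bar> * \<bar>b\<bar> * 4 ^ (j + l) < 64" using * by (simp add: a b j l abs_mult power_add)
        have "1 * 4 ^ (j + l) \<le> \<bar>a\<bar> * \<bar>b\<bar> * (4::int) ^ (j + l)" using ab1 by (intro mult_right_mono) auto
        then have "(4::int) ^ (j + l) < 64" using lt by (simp only: mult_1)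
        then have "(4::int) ^ (j + l) < 4 ^ 3" by simp
        then have "j + l < 3" by (rule power_less_imp_less_exp[rotated]) simp
        then have "j = 1" "l = 1" using \<open>j > 0\<close> \<open>l > 0\<close> by auto
        then have n: "n4 = 4" "n8 = 4" and "\<bar>a\<bar> * \<bar>b\<bar> < 4" using j l lt by simp_all
        have "4 dvd (r 0 - r 2)\<^sup>2 + (r 1 - r 3)\<^sup>2" using n(1) by (simp add: n4_def)
        then have "even (r 0 - r 2)" "even (r 1 - r 3)" by (blast dest: even_if_4_dvd_sum_squares)+
        then obtain p q where p: "r 0 - r 2 = 2 * p" and q: "r 1 - r 3 = 2 * q" by (metis evenE)
        have pq: "p\<^sup>2 + q\<^sup>2 = 1" using n(1) unfolding n4_def p q by (simp add: power_mult_distrib)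
        have ab: "r 0 = (a + b) div 2 + p" "r 2 = (a + b) div 2 - p" "even (a + b)"
          "r 1 + r 3 = a - b" "r 0 + r 2 = a + b"
          using a b p unfolding f1_def f2_def by presburger+
        have "odd a"
        proof
          assume "even a"
          then have "even b" using ab(3) by simp
          then have "2 * 2 \<le> \<bar>a\<bar> * \<bar>b\<bar>"
            using \<open>even a\<close> Sab by (intro mult_mono signed_two_powers_even) auto
          then show False using \<open>\<bar>a\<bar> * \<bar>b\<bar> < 4\<close> by simp
        qed
        have "odd (p + q)" 
        proof
          assume "even (p + q)"
          then have "even (p\<^sup>2 + q\<^sup>2)" by simp
          then show False using pq by simp
        qed
        \<comment> \<open>Here \<open>r 0 - r 1 = b + p - q\<close>, where \<open>b\<close> and
          \<open>p + q\<close> are odd. So all coefficients agree modulo 2, and the norm at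
          \<open>zeta8\<close> cannot be 4.\<close>
        have "even (r 0 - r 2)" "even (r 1 - r 3)" "even (r 0 - r 1)"
          using p q ab \<open>odd a\<close> \<open>odd (p + q)\<close> by presburger+
        then have "even (f 0 - f 4 - (f 1 - f 5))" "even (f 0 - f 4 - (f 2 - f 6))" "even (f 0 - f 4 - (f 3 - f 7))"
          unfolding r_def by (simp; presburger)+
        from norm8_square_neq_4[OF this] show False using n(2) by (simp add: n8_def P_def Q_def)
      qed
      then show ?thesis unfolding det by simp
    qed
  qed
qed

subsection \<open>Units in group rings of elementary abelian $2$-groups\<close>

lemma enorm_eq_0_iff: "enorm x = 0 \<longleftrightarrow> x = 0"
proof
  assume "enorm x = 0"
  moreover have "2 * enorm x = (eis_re x - eis_om x)\<^sup>2 + (eis_re x)\<^sup>2 + (eis_om x)\<^sup>2"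
    by (simp add: enorm_def power2_eq_square algebra_simps)
  ultimately have "(eis_re x - eis_om x)\<^sup>2 + (eis_re x)\<^sup>2 + (eis_om x)\<^sup>2 = 0" by simp
  then have "eis_re x = 0" "eis_om x = 0" by (simp_all add: add_nonneg_eq_0_iff)
  then show "x = 0" by (simp add: eis.expand)
qed (simp add: enorm_def)

lemma enorm_mod_3: "3 dvd enorm x - (emod x)\<^sup>2"
proof -
  have "enorm x - (emod x)\<^sup>2 = 3 * (- (eis_re x * eis_om x))"
    by (simp add: enorm_def emod_def power2_eq_square algebra_simps)
  then show ?thesis by simp
qed

text \<open>A norm is a square modulo 3 because conjugation is trivial modulo 1 - \<omega>; being a
  power of two it is not 0 there. Such a norm therefore leaves the residue, and so the sign,
  contributed by \<open>f\<close> unchanged.\<close>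

lemma enorm_two_power_mod_3:
  assumes "enorm x \<in> signed_two_powers"
  shows "3 dvd enorm x - 1"
proof -
  have "\<not> 3 dvd emod x"
  proof
    assume "3 dvd emod x"
    then have "3 dvd (emod x)\<^sup>2" by (simp add: power2_eq_square)
    then have "3 dvd enorm x" using dvd_diff_iff[OF enorm_mod_3] by blast
    then show False using signed_two_powers_not_dvd_3[OF assms] by blast
  qed
  from dvd_add[OF enorm_mod_3[of x] square_mod_3[OF this]] show ?thesis by simp
qed

text \<open>A unit is 1 or -1 modulo 1 - \<omega>. Its fourth and eighth powers are the determinants
  of its multiples of a group element on C_2^2 and C_2^3.\<close>

lemma emod_unit_power:
  assumes "enorm x = 1"
  shows "3 dvd emod ((x\<^sup>2)\<^sup>2) - 1" "3 dvd emod (((x\<^sup>2)\<^sup>2)\<^sup>2) - 1"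
proof -
  have sq: "3 dvd emod (y\<^sup>2) - 1" if "enorm y = 1" for y
  proof -
    have "3 dvd (emod y)\<^sup>2 - enorm y" using enorm_mod_3[of y] dvd_minus_iff[of 3 "enorm y - (emod y)\<^sup>2"] by simp
    from dvd_add[OF emod_mult[of y y] this] show ?thesis using that by (simp add: power2_eq_square)
  qed
  show "3 dvd emod ((x\<^sup>2)\<^sup>2) - 1" "3 dvd emod (((x\<^sup>2)\<^sup>2)\<^sup>2) - 1"
    by (rule sq, simp only: enorm_power2 assms power_one)+
qed

text \<open>Parseval: only one coefficient of such a unit is nonzero.\<close>

lemma C2C2_unit:
  assumes "enorm (a + b + c + d) = 1" "enorm (a - b + c - d) = 1"
    "enorm (a + b - c - d) = 1" "enorm (a - b - c + d) = 1"
  shows "3 dvd emod (det_C2C2 a b c d) - 1"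
proof -
  have "4 * (enorm a + enorm b + enorm c + enorm d) = enorm (a + b + c + d) + enorm (a - b + c - d) +
      enorm (a + b - c - d) + enorm (a - b - c + d)"
    by (simp add: enorm_def power2_eq_square algebra_simps)
  then have sum: "enorm a + enorm b + enorm c + enorm d = 1" using assms by simp
  have "(enorm a = 1 \<and> b = 0 \<and> c = 0 \<and> d = 0) \<or> (a = 0 \<and> enorm b = 1 \<and> c = 0 \<and> d = 0) \<or>
      (a = 0 \<and> b = 0 \<and> enorm c = 1 \<and> d = 0) \<or> (a = 0 \<and> b = 0 \<and> c = 0 \<and> enorm d = 1)"
    using sum enorm_nonneg[of a] enorm_nonneg[of b] enorm_nonneg[of c] enorm_nonneg[of d]
    unfolding enorm_eq_0_iff[symmetric] by linarith
  then obtain x where "enorm x = 1" "det_C2C2 a b c d = (x\<^sup>2)\<^sup>2"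
    by (elim disjE) (auto simp: det_C2C2_def power2_eq_square algebra_simps)
  then show ?thesis using emod_unit_power(1) by simp
qed

lemma eis_sel_of_int [simp]: "eis_re (of_int n) = n" "eis_om (of_int n) = 0"
  by (cases n; simp)+

lemma int_unit_from_eis:
  assumes "3 dvd emod (of_int n) - 1" "\<bar>n\<bar> = 1"
  shows "n = 1"
  using assms by (auto simp: emod_def abs_if split: if_splits)

lemma enorm_of_int: "enorm (of_int n) = n\<^sup>2"
  by (simp add: enorm_def)

text \<open>The integers are embedded in the Eisenstein integers, where Parseval has been applied;
  being 1 modulo 3 then rules out -1.\<close>

lemma C2C2_unit_int:
  fixes a b c d :: int
  assumes "\<bar>a + b + c + d\<bar> = 1" "\<bar>a - b + c - d\<bar> = 1" "\<bar>a + b - c - d\<bar> = 1" "\<bar>a - b - c + d\<bar> = 1"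
  shows "det_C2C2 a b c d = 1"
proof (rule int_unit_from_eis)
  have "3 dvd emod (det_C2C2 (of_int a) (of_int b) (of_int c) (of_int d)) - 1"
    using assms by (intro C2C2_unit) (simp_all add: enorm_of_int abs_square_eq_1 flip: of_int_add of_int_diff)
  then show "3 dvd emod (of_int (det_C2C2 a b c d)) - 1" by (simp add: det_C2C2_def)
  show "\<bar>det_C2C2 a b c d\<bar> = 1" using assms by (simp add: det_C2C2_def abs_mult)
qed

subsection \<open>The group $C_2 \times C_{12}$\<close>

lemma signed_two_powers_4_dvd: "x \<in> signed_two_powers \<Longrightarrow> even x \<Longrightarrow> \<bar>x\<bar> \<noteq> 2 \<Longrightarrow> 4 dvd x \<and> 4 \<le> \<bar>x\<bar>"
proof -
  assume x: "x \<in> signed_two_powers" "even x" "\<bar>x\<bar> \<noteq> 2"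
  then obtain y where y: "x = 2 * y" by auto
  then have Sy: "y \<in> signed_two_powers" using x by (simp add: signed_two_powers_mult_iff)
  have "even y"
  proof (rule ccontr)
    assume "odd y"
    then show False using signed_two_powers_odd[OF Sy] x(3) y by simp
  qed
  then show ?thesis using signed_two_powers_even[OF Sy] y by auto
qed

lemma C4_parity_int:
  fixes a b c d :: int
  shows "even (a - b + c - d) \<longleftrightarrow> even (a + b + c + d)"
    and "even ((a - c)\<^sup>2 + (b - d)\<^sup>2) \<longleftrightarrow> even (a + b + c + d)"
  by auto

text \<open>Three even factors give only 8, but they cannot all have absolute value 2. If the first
  two do, their sum \<open>2 * (a + c)\<close> is divisible by 4, so \<open>a - c\<close> is even;
  an even third factor then makes \<open>b - d\<close> even too, and that factor is divisible by
  4.\<close>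

lemma det_C4_even_ge_16:
  fixes a b c d :: int
  assumes "det_C4 a b c d \<in> signed_two_powers" "even (a + b + c + d)"
  shows "16 \<le> \<bar>det_C4 a b c d\<bar>"
proof -
  define x y z where "x = a + b + c + d" and "y = a - b + c - d" and "z = (a - c)\<^sup>2 + (b - d)\<^sup>2"
  have det: "det_C4 a b c d = x * y * z" by (simp add: det_C4_def x_def y_def z_def)
  have S: "x \<in> signed_two_powers" "y \<in> signed_two_powers" "z \<in> signed_two_powers"
    using assms(1) by (simp_all add: det signed_two_powers_mult_iff)
  have even: "even x" "even y" "even z" using assms(2) by (auto simp: x_def y_def z_def)
  have prod: "k * l * m \<le> \<bar>x * y * z\<bar>" if "k \<le> \<bar>x\<bar>" "l \<le> \<bar>y\<bar>" "m \<le> \<bar>z\<bar>" "0 \<le> k" "0 \<le> l" "0 \<le> m" for k l m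
    unfolding abs_mult using that by (intro mult_mono) auto
  note ge2 = S[THEN signed_two_powers_even]
  have "\<bar>x\<bar> \<noteq> 2 \<or> \<bar>y\<bar> \<noteq> 2 \<or> \<bar>z\<bar> \<noteq> 2"
  proof (rule ccontr)
    assume "\<not> ?thesis"
    then have *: "\<bar>x\<bar> = 2" "\<bar>y\<bar> = 2" "z = 2" by (auto simp: z_def)
    have "x + y = 2 * (a + c)" by (simp add: x_def y_def)
    moreover have "x = 2 \<or> x = - 2" "y = 2 \<or> y = - 2" using *(1,2) by linarith+
    then have "4 dvd x + y" by (elim disjE) simp_all
    ultimately have "even (a - c)" by presburger
    moreover have "even z" using *(3) by simp
    ultimately have "even (b - d)" by (simp add: z_def)
    with \<open>even (a - c)\<close> obtain k l where "a - c = 2 * k" "b - d = 2 * l" by (meson evenE)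
    then have "z = 4 * (k\<^sup>2 + l\<^sup>2)" unfolding z_def by (simp add: power2_eq_square)
    then show False using *(3) by presburger
  qed
  then consider "4 \<le> \<bar>x\<bar>" | "4 \<le> \<bar>y\<bar>" | "4 \<le> \<bar>z\<bar>"
    using signed_two_powers_4_dvd S even by blast
  then have "16 \<le> \<bar>x * y * z\<bar>"
    using prod[of 4 2 2] prod[of 2 4 2] prod[of 2 2 4] ge2 even by cases simp_all
  then show ?thesis by (simp add: det)
qed

lemma enorm_det_C4_even_ge_64:
  assumes "enorm (det_C4 a b c d) \<in> signed_two_powers" "2 dvd a + b + c + d"
  shows "64 \<le> enorm (det_C4 a b c d)"
proof -
  have "2 dvd a - b + c - d" "2 dvd (a - c)\<^sup>2 + (b - d)\<^sup>2"
    using C4_parity[where a = a and b = b and c = c and d = d, THEN dvd_diff_iff] assms(2)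
    by (simp_all add: even_eis_power_iff)
  then have "4 * 4 * 4 \<le> enorm (a + b + c + d) * enorm (a - b + c - d) * enorm ((a - c)\<^sup>2 + (b - d)\<^sup>2)"
    using assms by (intro mult_mono enorm_even_ge) (simp_all add: det_C4_def enorm_mult signed_two_powers_mult_iff enorm_nonneg)
  then show ?thesis by (simp add: det_C4_def enorm_mult)
qed

lemma C4_block_unit:
  assumes S: "det_C4 a b c d \<in> signed_two_powers" and g: "enorm (det_C4 a' b' c' d') = 1"
    and fg: "3 dvd a - emod a'" "3 dvd b - emod b'" "3 dvd c - emod c'" "3 dvd d - emod d'"
  shows "\<exists>j. (a - c)\<^sup>2 + (b - d)\<^sup>2 = 4 ^ j"
proof (rule C4_unit)
  have S1: "x * y = 1 \<Longrightarrow> 0 \<le> x \<Longrightarrow> x = 1 \<and> y = 1" for x y :: int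
    using zmult_eq_1_iff by auto
  have *: "enorm (a' + b' + c' + d') = 1 \<and> enorm (a' - b' + c' - d') = 1 \<and> enorm ((a' - c')\<^sup>2 + (b' - d')\<^sup>2) = 1"
    using g unfolding det_C4_def enorm_mult by (metis S1 enorm_nonneg mult_nonneg_nonneg)
  then show "enorm ((a' + c') + (b' + d')) = 1" "enorm ((a' + c') - (b' + d')) = 1"
    "enorm ((a' - c')\<^sup>2 + (b' - d')\<^sup>2) = 1"
    by (simp_all add: algebra_simps)
  show "2 dvd (a' + c') - (a' - c')" "2 dvd (b' + d') - (b' - d')" by (simp_all flip: mult_2)
  show "3 dvd a - c - emod (a' - c')" "3 dvd b - d - emod (b' - d')"
    by (intro emod_cong fg)+
  show "(a - c)\<^sup>2 + (b - d)\<^sup>2 \<in> signed_two_powers"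
    using S by (simp add: det_C4_def signed_two_powers_mult_iff)
qed

text \<open>The two blocks of \<open>det_C2C4\<close> have the same \<open>a + b\<close> modulo \<open>2\<close>, so an even number of their four
  factors \<open>w\<close> and \<open>m\<close> is even; this excludes the exponents \<open>9\<close>, \<open>10\<close> and \<open>11\<close>.\<close>

lemma C4_block_unit_even:
  fixes a b c d :: int
  assumes S: "det_C4 a b c d \<in> signed_two_powers" and N: "(a - c)\<^sup>2 + (b - d)\<^sup>2 = 4 ^ j"
    and even: "even (a + b + c + d)"
  shows "\<exists>w m. det_C4 a b c d = 16 * w * m \<and> (odd w \<and> \<bar>w\<bar> = 1 \<or> even w \<and> 4 \<le> \<bar>w\<bar>) \<and>
    (odd m \<and> \<bar>m\<bar> = 1 \<or> even m \<and> 4 \<le> \<bar>m\<bar>) \<and> even (w + m + a + b)"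
proof -
  have "even ((a - c)\<^sup>2 + (b - d)\<^sup>2)" using even by (simp only: C4_parity_int)
  then have "j > 0" using N by (auto intro: gr0I)
  then obtain i where i: "j = Suc i" using gr0_implies_Suc by blast
  have "4 dvd (a - c)\<^sup>2 + (b - d)\<^sup>2" using N i by simp
  then obtain p q where p: "a - c = 2 * p" and q: "b - d = 2 * q"
    using even_if_4_dvd_sum_squares by (meson evenE)
  have m: "p\<^sup>2 + q\<^sup>2 = 4 ^ i" using N i unfolding p q by (simp add: power_mult_distrib)
  obtain x y where x: "a + b + c + d = 2 * x" and y: "a - b + c - d = 2 * y"
  proof -
    have "even (a - b + c - d)" using even by simp
    then show ?thesis using that even by (meson evenE)
  qed
  \<comment> \<open>Exactly, \<open>x + y = a + c\<close>, of the same parity as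
    \<open>a - c\<close>, and \<open>x + p + q = a + b\<close>.\<close>
  have xy: "even (x + y)" "even (x + p + q + a + b)"
    using x y p q by presburger+
  have Sxy: "x \<in> signed_two_powers" "y \<in> signed_two_powers"
    using S unfolding det_C4_def x y by (simp_all add: signed_two_powers_mult_iff)
  have "det_C4 a b c d = 16 * (x * y) * 4 ^ i"
    unfolding det_C4_def x y N i by simp
  \<comment> \<open>The two factors have equal parity and are powers of two up to sign, so their
    product skips the absolute value 2.\<close>
  moreover have "odd (x * y) \<and> \<bar>x * y\<bar> = 1 \<or> even (x * y) \<and> 4 \<le> \<bar>x * y\<bar>"
  proof (cases "even x")
    case True
    then have "2 * 2 \<le> \<bar>x\<bar> * \<bar>y\<bar>" using xy Sxy by (intro mult_mono signed_two_powers_even) auto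
    then show ?thesis using True by (simp add: abs_mult)
  next
    case False
    then have "\<bar>x\<bar> = 1" "\<bar>y\<bar> = 1" using xy(1) Sxy by (auto intro!: signed_two_powers_odd)
    then show ?thesis using False xy(1) by (simp add: abs_mult)
  qed
  moreover have "odd ((4::int) ^ i) \<and> \<bar>(4::int) ^ i\<bar> = 1 \<or> even ((4::int) ^ i) \<and> 4 \<le> \<bar>(4::int) ^ i\<bar>"
  proof (cases i)
    case (Suc k)
    have "(1::int) \<le> 4 ^ k" by simp
    then have "(4::int) * 1 \<le> 4 * 4 ^ k" by (rule mult_left_mono) simp
    then show ?thesis using Suc by simp
  qed simp
  moreover have "even (x * y + 4 ^ i + a + b)"
    using xy unfolding m[symmetric] by (auto simp: power2_eq_square)
  ultimately show ?thesis by blast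
qed

text \<open>The characters are regrouped by order. Those of order at most 2 give the determinant on
  the quotient C_2 x C_2 by the squares; the others form two conjugate pairs, hence two norms of
  Gaussian integers. This ties together factors lying in different C_4 blocks.\<close>

lemma det_C2C4_split:
  fixes f :: "nat \<Rightarrow> 'a::comm_ring_1"
  shows "det_C2C4 f = det_C2C2 (f 0 + f 2) (f 1 + f 3) (f 4 + f 6) (f 5 + f 7) *
    (((f 0 + f 4 - (f 2 + f 6))\<^sup>2 + (f 1 + f 5 - (f 3 + f 7))\<^sup>2) *
     ((f 0 - f 4 - (f 2 - f 6))\<^sup>2 + (f 1 - f 5 - (f 3 - f 7))\<^sup>2))"
proof -
  have eq: "f 0 + f 2 + (f 1 + f 3) + (f 4 + f 6) + (f 5 + f 7) = f 0 + f 4 + (f 1 + f 5) + (f 2 + f 6) + (f 3 + f 7)"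
    "f 0 + f 2 - (f 1 + f 3) + (f 4 + f 6) - (f 5 + f 7) = f 0 + f 4 - (f 1 + f 5) + (f 2 + f 6) - (f 3 + f 7)"
    "f 0 + f 2 + (f 1 + f 3) - (f 4 + f 6) - (f 5 + f 7) = f 0 - f 4 + (f 1 - f 5) + (f 2 - f 6) + (f 3 - f 7)"
    "f 0 + f 2 - (f 1 + f 3) - (f 4 + f 6) + (f 5 + f 7) = f 0 - f 4 - (f 1 - f 5) + (f 2 - f 6) - (f 3 - f 7)"
    by (simp_all add: algebra_simps)
  show ?thesis
    unfolding det_C2C4_def det_C4_def det_C2C2_def eq by (simp only: mult_ac)
qed

lemma det_C2C4_two_power:
  assumes fg: "\<forall>u<8. 3 dvd f u - emod (g u)"
    and S: "det_C2C4 f * enorm (det_C2C4 g) \<in> signed_two_powers"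
  shows "(\<exists>k. det_C2C4 f * enorm (det_C2C4 g) = (- 2) ^ k \<and> (k = 0 \<or> k = 8 \<or> 12 \<le> k)) \<or>
    2 ^ 20 \<le> \<bar>det_C2C4 f * enorm (det_C2C4 g)\<bar>"
proof -
  define r t where "r = (\<lambda>u. f u + f (u + 4))" and "t = (\<lambda>u. f u - f (u + 4))"
  define r' t' where "r' = (\<lambda>u. g u + g (u + 4))" and "t' = (\<lambda>u. g u - g (u + 4))"
  define R T where "R = det_C4 (r 0) (r 1) (r 2) (r 3)" and "T = det_C4 (t 0) (t 1) (t 2) (t 3)"
  define R' T' where "R' = det_C4 (r' 0) (r' 1) (r' 2) (r' 3)" and "T' = det_C4 (t' 0) (t' 1) (t' 2) (t' 3)"
  have detf: "det_C2C4 f = R * T" by (simp add: det_C2C4_def R_def T_def r_def t_def)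
  have detg: "det_C2C4 g = R' * T'" by (simp add: det_C2C4_def R'_def T'_def r'_def t'_def)
  have Sf: "R \<in> signed_two_powers" "T \<in> signed_two_powers"
    and Sg: "enorm R' \<in> signed_two_powers" "enorm T' \<in> signed_two_powers"
    using S by (simp_all add: detf detg enorm_mult signed_two_powers_mult_iff)
  let ?e = "even (r 0 + r 1 + r 2 + r 3)" and ?e' = "2 dvd r' 0 + r' 1 + r' 2 + r' 3"
  have e: "even (t 0 + t 1 + t 2 + t 3) \<longleftrightarrow> ?e" by (simp add: r_def t_def)
  have "2 dvd (r' 0 + r' 1 + r' 2 + r' 3) - (t' 0 + t' 1 + t' 2 + t' 3)"
  proof -
    have "(r' 0 + r' 1 + r' 2 + r' 3) - (t' 0 + t' 1 + t' 2 + t' 3) = 2 * (g 4 + g 5 + g 6 + g 7)"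
      by (simp add: r'_def t'_def algebra_simps)
    then show ?thesis by (metis dvd_triv_left)
  qed
  then have e': "2 dvd t' 0 + t' 1 + t' 2 + t' 3 \<longleftrightarrow> ?e'" by (simp only: dvd_diff_iff)
  have fg': "3 dvd f u - emod (g u)" if "u < 8" for u using fg that by blast
  have fg4: "3 dvd r u - emod (r' u)" "3 dvd t u - emod (t' u)" if "u < 4" for u
    unfolding r_def t_def r'_def t'_def using that by (intro emod_cong fg'; simp)+
  show ?thesis
  proof (cases ?e')
    case True
    have "64 * 64 \<le> enorm R' * enorm T'"
      using True e' Sg unfolding R'_def T'_def by (intro mult_mono enorm_det_C4_even_ge_64) (simp_all add: enorm_nonneg)
    then have g: "2 ^ 12 \<le> enorm (det_C2C4 g)" by (simp add: detg enorm_mult)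
    show ?thesis
    proof (cases ?e)
      case True
      have "16 * 16 \<le> \<bar>R\<bar> * \<bar>T\<bar>"
        using True e Sf unfolding R_def T_def by (intro mult_mono det_C4_even_ge_16) simp_all
      then have "256 \<le> \<bar>det_C2C4 f\<bar>" by (simp add: detf abs_mult)
      then have "256 * 2 ^ 12 \<le> \<bar>det_C2C4 f\<bar> * \<bar>enorm (det_C2C4 g)\<bar>" using g by (intro mult_mono) auto
      then show ?thesis by (simp add: abs_mult)
    next
      case False
      have block: "\<bar>a + b + c + d\<bar> = 1 \<and> \<bar>a - b + c - d\<bar> = 1 \<and> (a - c)\<^sup>2 + (b - d)\<^sup>2 = 1"
        if "det_C4 a b c d \<in> signed_two_powers" "odd (a + b + c + d)" for a b c d :: int
      proof -
        have "\<bar>(a - c)\<^sup>2 + (b - d)\<^sup>2\<bar> = 1" "\<bar>a + b + c + d\<bar> = 1" "\<bar>a - b + c - d\<bar> = 1"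
          using that unfolding det_C4_def signed_two_powers_mult_iff
          by (intro signed_two_powers_odd; simp only: C4_parity_int; simp)+
        then show ?thesis by simp
      qed
      have b1: "\<bar>r 0 + r 1 + r 2 + r 3\<bar> = 1 \<and> \<bar>r 0 - r 1 + r 2 - r 3\<bar> = 1 \<and> (r 0 - r 2)\<^sup>2 + (r 1 - r 3)\<^sup>2 = 1"
        by (rule block) (use False Sf in \<open>simp_all add: R_def\<close>)
      have b2: "\<bar>t 0 + t 1 + t 2 + t 3\<bar> = 1 \<and> \<bar>t 0 - t 1 + t 2 - t 3\<bar> = 1 \<and> (t 0 - t 2)\<^sup>2 + (t 1 - t 3)\<^sup>2 = 1"
        by (rule block) (use False Sf e in \<open>simp_all add: T_def\<close>)
      \<comment> \<open>An odd \<open>f\<close> has determinant 1, not merely 1 or -1, because the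
        quotient determinant of a unit is 1 and the two Gaussian norms are positive.\<close>
      have "det_C2C2 (f 0 + f 2) (f 1 + f 3) (f 4 + f 6) (f 5 + f 7) = 1"
        using b1 b2 by (intro C2C2_unit_int) (simp_all add: r_def t_def algebra_simps)
      then have "det_C2C4 f = 1"
        using b1 b2 unfolding det_C2C4_split by (simp add: r_def t_def)
      then have x: "det_C2C4 f * enorm (det_C2C4 g) = enorm (det_C2C4 g)" by simp
      obtain k where k: "enorm (det_C2C4 g) = (- 2) ^ k"
        using signed_two_powers_mod_3[of "enorm (det_C2C4 g)"] enorm_two_power_mod_3[of "det_C2C4 g"] S x by metis
      have "(2::int) ^ 12 \<le> 2 ^ k" 
      proof -
        have "\<bar>enorm (det_C2C4 g)\<bar> = 2 ^ k" unfolding k by (simp add: power_abs)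
        then show ?thesis using g by linarith
      qed
      then have "12 \<le> k" by (rule power_le_imp_le_exp[rotated]) simp
      then show ?thesis using k x by auto
    qed
  next
    case False
    have block: "enorm (a + b + c + d) = 1 \<and> enorm (a - b + c - d) = 1 \<and> enorm ((a - c)\<^sup>2 + (b - d)\<^sup>2) = 1"
      if "enorm (det_C4 a b c d) \<in> signed_two_powers" "\<not> 2 dvd (a + b + c + d)" for a b c d
      using that C4_parity[where a = a and b = b and c = c and d = d, THEN dvd_diff_iff]
      by (auto intro!: enorm_odd_eq_1 simp: det_C4_def enorm_mult signed_two_powers_mult_iff even_eis_power_iff)
    have b1: "enorm (r' 0 + r' 1 + r' 2 + r' 3) = 1 \<and> enorm (r' 0 - r' 1 + r' 2 - r' 3) = 1 \<and>
        enorm ((r' 0 - r' 2)\<^sup>2 + (r' 1 - r' 3)\<^sup>2) = 1"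
      by (rule block) (use False Sg in \<open>simp_all add: R'_def\<close>)
    have b2: "enorm (t' 0 + t' 1 + t' 2 + t' 3) = 1 \<and> enorm (t' 0 - t' 1 + t' 2 - t' 3) = 1 \<and>
        enorm ((t' 0 - t' 2)\<^sup>2 + (t' 1 - t' 3)\<^sup>2) = 1"
      by (rule block) (use False Sg e' in \<open>simp_all add: T'_def\<close>)
    have g1: "enorm R' = 1" "enorm T' = 1"
      using b1 b2 by (simp_all add: R'_def T'_def det_C4_def enorm_mult)
    then have x: "det_C2C4 f * enorm (det_C2C4 g) = R * T" by (simp add: detf detg enorm_mult)
    obtain j1 where j1: "(r 0 - r 2)\<^sup>2 + (r 1 - r 3)\<^sup>2 = 4 ^ j1"
    proof -
      have "\<exists>j. (r 0 - r 2)\<^sup>2 + (r 1 - r 3)\<^sup>2 = 4 ^ j"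
        by (rule C4_block_unit[OF Sf(1)[unfolded R_def] g1(1)[unfolded R'_def]]; rule fg4; simp)
      then show ?thesis using that by blast
    qed
    obtain j2 where j2: "(t 0 - t 2)\<^sup>2 + (t 1 - t 3)\<^sup>2 = 4 ^ j2"
    proof -
      have "\<exists>j. (t 0 - t 2)\<^sup>2 + (t 1 - t 3)\<^sup>2 = 4 ^ j"
        by (rule C4_block_unit[OF Sf(2)[unfolded T_def] g1(2)[unfolded T'_def]]; rule fg4; simp)
      then show ?thesis using that by blast
    qed
    \<comment> \<open>The Gaussian norms are powers of 4, hence 1 modulo 3, and the quotient
      determinant inherits its residue from that of \<open>g\<close>, a unit on C_2 x C_2.\<close>
    have "3 dvd R * T - 1"
    proof -
      let ?D = "det_C2C2 (f 0 + f 2) (f 1 + f 3) (f 4 + f 6) (f 5 + f 7)"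
      let ?D' = "det_C2C2 (g 0 + g 2) (g 1 + g 3) (g 4 + g 6) (g 5 + g 7)"
      have "3 dvd emod ?D' - 1"
        using b1 b2 by (intro C2C2_unit) (simp_all add: r'_def t'_def algebra_simps)
      moreover have "3 dvd ?D - emod ?D'"
        unfolding det_C2C2_def by (intro emod_cong fg'; simp)
      ultimately have D: "3 dvd ?D - 1" by presburger
      have "3 dvd (4::int) ^ n - 1" for n
        using two_power_mod_3[of "2 * n"] by (simp add: power_mult) presburger
      then have "[(4::int) ^ (j1 + j2) = 1] (mod 3)" "[?D = 1] (mod 3)"
        using D by (simp_all add: cong_iff_dvd_diff)
      then have "[?D * 4 ^ (j1 + j2) = 1 * 1] (mod 3)" by (intro cong_mult)
      moreover have "R * T = ?D * 4 ^ (j1 + j2)"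
        unfolding detf[symmetric] det_C2C4_split power_add j1[symmetric] j2[symmetric] by (simp add: r_def t_def)
      ultimately show ?thesis by (simp add: cong_iff_dvd_diff)
    qed
    then obtain k where k: "R * T = (- 2) ^ k"
      using signed_two_powers_mod_3[of "R * T"] Sf by (auto simp: signed_two_powers_mult_iff)
    then have abs: "\<bar>R * T\<bar> = 2 ^ k" by (simp add: power_abs)
    have "k = 0 \<or> k = 8 \<or> 12 \<le> k"
    proof (cases ?e)
      case True
      obtain w m where 1: "R = 16 * w * m" "odd w \<and> \<bar>w\<bar> = 1 \<or> even w \<and> 4 \<le> \<bar>w\<bar>"
        "odd m \<and> \<bar>m\<bar> = 1 \<or> even m \<and> 4 \<le> \<bar>m\<bar>" "even (w + m + r 0 + r 1)"
        using C4_block_unit_even[OF _ j1] Sf True unfolding R_def by blast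
      obtain v n where 2: "T = 16 * v * n" "odd v \<and> \<bar>v\<bar> = 1 \<or> even v \<and> 4 \<le> \<bar>v\<bar>"
        "odd n \<and> \<bar>n\<bar> = 1 \<or> even n \<and> 4 \<le> \<bar>n\<bar>" "even (v + n + t 0 + t 1)"
        using C4_block_unit_even[OF _ j2] Sf True e unfolding T_def by blast
      have par: "even (w + m + v + n)" using 1(4) 2(4) by (simp add: r_def t_def) presburger
      have RT: "\<bar>R * T\<bar> = 2 ^ 8 * (\<bar>w\<bar> * \<bar>m\<bar> * (\<bar>v\<bar> * \<bar>n\<bar>))" by (simp add: 1(1) 2(1) abs_mult)
      \<comment> \<open>By \<open>par\<close>, one even factor forces a second; each contributes at
        least 4, so the exponent jumps from 8 to at least 12.\<close>
      have "\<bar>w\<bar> * \<bar>m\<bar> * (\<bar>v\<bar> * \<bar>n\<bar>) = 1 \<or> 16 \<le> \<bar>w\<bar> * \<bar>m\<bar> * (\<bar>v\<bar> * \<bar>n\<bar>)"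
      proof -
        have ge: "1 \<le> \<bar>w\<bar>" "1 \<le> \<bar>m\<bar>" "1 \<le> \<bar>v\<bar>" "1 \<le> \<bar>n\<bar>" using 1(2,3) 2(2,3) by linarith+
        have mono: "a * b * (c * d) \<le> \<bar>w\<bar> * \<bar>m\<bar> * (\<bar>v\<bar> * \<bar>n\<bar>)"
          if "a \<le> \<bar>w\<bar>" "b \<le> \<bar>m\<bar>" "c \<le> \<bar>v\<bar>" "d \<le> \<bar>n\<bar>" "0 \<le> a" "0 \<le> b" "0 \<le> c" "0 \<le> d" for a b c d
          using that by (intro mult_mono) auto
        show ?thesis
        proof (cases "odd w \<and> odd m \<and> odd v \<and> odd n")
          case True
          then have "\<bar>w\<bar> = 1" "\<bar>m\<bar> = 1" "\<bar>v\<bar> = 1" "\<bar>n\<bar> = 1" using 1(2,3) 2(2,3) by blast+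
          then show ?thesis by simp
        next
          case False
          then have "(even w \<and> even m) \<or> (even w \<and> even v) \<or> (even w \<and> even n) \<or>
              (even m \<and> even v) \<or> (even m \<and> even n) \<or> (even v \<and> even n)"
            using par by auto
          moreover have "even w \<Longrightarrow> 4 \<le> \<bar>w\<bar>" "even m \<Longrightarrow> 4 \<le> \<bar>m\<bar>" "even v \<Longrightarrow> 4 \<le> \<bar>v\<bar>" "even n \<Longrightarrow> 4 \<le> \<bar>n\<bar>"
            using 1(2,3) 2(2,3) by blast+
          ultimately have "16 \<le> \<bar>w\<bar> * \<bar>m\<bar> * (\<bar>v\<bar> * \<bar>n\<bar>)"
            using ge mono[of 4 4 1 1] mono[of 4 1 4 1] mono[of 4 1 1 4] mono[of 1 4 4 1]
              mono[of 1 4 1 4] mono[of 1 1 4 4]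
            by (elim disjE conjE) simp_all
          then show ?thesis by blast
        qed
      qed
      note alternatives = this
      have "(2::int) ^ k = 2 ^ 8 \<or> (2::int) ^ 12 \<le> 2 ^ k" 
      proof -
        have "2 ^ 8 * z = 2 ^ 8 \<or> 2 ^ 12 \<le> 2 ^ 8 * z" if "z = 1 \<or> 16 \<le> z" for z :: int
          using that by auto
        then show ?thesis using alternatives unfolding abs[symmetric] RT by blast
      qed
      then show ?thesis
        using power_inject_exp[of "2::int" k 8] power_le_imp_le_exp[of "2::int" 12 k] by linarith
    next
      case False
      have "odd R" "odd T" using False e unfolding R_def T_def det_C4_def even_mult_iff C4_parity_int by blast+
      then have "\<bar>R * T\<bar> = 1" using Sf signed_two_powers_odd by (simp add: abs_mult)
      then show ?thesis using abs by auto
    qed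
    then show ?thesis using k x by auto
  qed
qed

subsection \<open>The group $C_2 \times C_2 \times C_6$\<close>

lemma walsh_sign_cases: "(walsh_sign r u :: 'a::comm_ring_1) = 1 \<or> walsh_sign r u = (- 1 :: 'a)"
proof -
  have n: "(- 1 :: 'a) ^ n = 1 \<or> (- 1 :: 'a) ^ n = - 1" for n
    by (cases "even n") simp_all
  show ?thesis
    unfolding walsh_sign_def
    using n[of "(r div 4) * (u div 4)"] n[of "(r div 2 mod 2) * (u div 2 mod 2)"] n[of "(r mod 2) * (u mod 2)"]
    by (elim disjE) simp_all
qed

lemma walsh_parity:
  fixes F :: "nat \<Rightarrow> 'a::comm_ring_1"
  shows "2 dvd walsh F r - walsh F s"
proof -
  have "2 dvd walsh_sign r u - (walsh_sign s u :: 'a)" for u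
    using walsh_sign_cases[of r u, where 'a = 'a] walsh_sign_cases[of s u, where 'a = 'a]
    by (elim disjE) (simp_all flip: mult_2 add: one_add_one)
  then have "2 dvd (\<Sum>u<8. F u * (walsh_sign r u - walsh_sign s u))"
    by (intro dvd_sum dvd_mult)
  then show ?thesis by (simp add: walsh_def right_diff_distrib sum_subtractf)
qed

lemma less_8_cases: "h < 8 \<Longrightarrow> h = 0 \<or> h = 1 \<or> h = 2 \<or> h = 3 \<or> h = 4 \<or> h = 5 \<or> h = 6 \<or> h = (7::nat)"
  by arith

lemma walsh_inversion:
  fixes f :: "nat \<Rightarrow> int"
  assumes "h < 8"
  shows "(\<Sum>r<8. walsh_sign r h * walsh f r) = 8 * f h"
proof -
  have "(\<Sum>r<8. walsh_sign r h * walsh_sign r u) = (if u = h then 8 else 0 :: int)" if "u < 8" for u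
    using less_8_cases[OF assms] less_8_cases[OF that]
    by (elim disjE; simp add: sum_lessThan_8 walsh_sign_def)
  then have "(\<Sum>u<8. f u * (\<Sum>r<8. walsh_sign r h * walsh_sign r u)) = (\<Sum>u<8. f u * (if u = h then 8 else 0))"
    by (intro sum.cong) auto
  also have "\<dots> = 8 * f h" using assms by (simp add: if_distrib cong: if_cong)
  finally have "(\<Sum>u<8. \<Sum>r<8. f u * (walsh_sign r h * walsh_sign r u)) = 8 * f h"
    by (simp add: sum_distrib_left)
  then show ?thesis
    unfolding walsh_def sum_distrib_left by (subst sum.swap) (simp add: mult_ac)
qed

text \<open>Parseval, on the two halves and then across them, makes the norms of the coefficients
  sum to 1; they are nonnegative integers.\<close>

lemma C2C2C2_unit:
  assumes "\<And>r. r < 8 \<Longrightarrow> enorm (walsh g r) = 1"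
  shows "\<exists>h<8. enorm (g h) = 1 \<and> (\<forall>k<8. k \<noteq> h \<longrightarrow> g k = 0)"
proof -
  have Parseval: "4 * (enorm a + enorm b + enorm c + enorm d) = enorm (a + b + c + d) + enorm (a - b + c - d) +
      enorm (a + b - c - d) + enorm (a - b - c + d)" for a b c d
    by (simp add: enorm_def power2_eq_square algebra_simps)
  have "enorm (walsh g 0) = 1" "enorm (walsh g 1) = 1" "enorm (walsh g 2) = 1" "enorm (walsh g 3) = 1"
    "enorm (walsh g 4) = 1" "enorm (walsh g 5) = 1" "enorm (walsh g 6) = 1" "enorm (walsh g 7) = 1"
    by (rule assms; simp)+
  note w = this[unfolded walsh_eqs]
  have half: "enorm (g 0 + g 4) + enorm (g 1 + g 5) + enorm (g 2 + g 6) + enorm (g 3 + g 7) = 1"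
    "enorm (g 0 - g 4) + enorm (g 1 - g 5) + enorm (g 2 - g 6) + enorm (g 3 - g 7) = 1"
    using Parseval[of "g 0 + g 4" "g 1 + g 5" "g 2 + g 6" "g 3 + g 7"]
      Parseval[of "g 0 - g 4" "g 1 - g 5" "g 2 - g 6" "g 3 - g 7"]
    unfolding w by simp_all
  have two: "enorm (a + b) + enorm (a - b) = 2 * (enorm a + enorm b)" for a b
    by (simp add: enorm_def power2_eq_square algebra_simps)
  have sum: "(\<Sum>k<8. enorm (g k)) = 1"
  proof -
    have "2 * (\<Sum>k<8. enorm (g k)) = 2 * (enorm (g 0) + enorm (g 4)) + 2 * (enorm (g 1) + enorm (g 5)) +
        2 * (enorm (g 2) + enorm (g 6)) + 2 * (enorm (g 3) + enorm (g 7))"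
      by (simp add: sum_lessThan_8)
    also have "\<dots> = (enorm (g 0 + g 4) + enorm (g 1 + g 5) + enorm (g 2 + g 6) + enorm (g 3 + g 7)) +
        (enorm (g 0 - g 4) + enorm (g 1 - g 5) + enorm (g 2 - g 6) + enorm (g 3 - g 7))"
      unfolding two[symmetric] by (simp only: ac_simps)
    also have "\<dots> = 1 + 1" by (simp only: half)
    finally show ?thesis by simp
  qed
  then obtain h where h: "h < 8" "enorm (g h) \<noteq> 0" by (metis lessThan_iff sum.neutral zero_neq_one)
  have rest: "enorm (g h) + (\<Sum>k\<in>{..<8} - {h}. enorm (g k)) = 1"
    using h(1) sum sum.remove[of "{..<8}" h "\<lambda>k. enorm (g k)"] by simp
  have nonneg: "0 \<le> (\<Sum>k\<in>{..<8} - {h}. enorm (g k))" by (simp add: sum_nonneg enorm_nonneg)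
  have 1: "enorm (g h) = 1" "(\<Sum>k\<in>{..<8} - {h}. enorm (g k)) = 0"
    using rest nonneg h(2) enorm_nonneg[of "g h"] by linarith+
  have "\<forall>k\<in>{..<8} - {h}. enorm (g k) = 0"
    using 1(2) by (subst (asm) sum_nonneg_eq_0_iff) (auto simp: enorm_nonneg)
  then show ?thesis using h(1) 1(1) by (auto simp: enorm_eq_0_iff)
qed

text \<open>Only one coefficient survives, so the determinant is its eighth power times the product
  of all signs at one group element. That product is 1, because either none or exactly four of the
  signs are -1.\<close>

lemma det_C2C2C2_unit:
  assumes "\<And>r. r < 8 \<Longrightarrow> enorm (walsh g r) = 1"
  shows "3 dvd emod (det_C2C2C2 g) - 1"
proof -
  obtain h where h: "h < 8" "enorm (g h) = 1" "\<And>k. k < 8 \<Longrightarrow> k \<noteq> h \<Longrightarrow> g k = 0"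
    using C2C2C2_unit[OF assms] by blast
  have w: "walsh g r = g h * walsh_sign r h" if "r < 8" for r
  proof -
    have "walsh g r = (\<Sum>u\<in>{h}. g u * walsh_sign r u)"
      unfolding walsh_def using h by (intro sum.mono_neutral_right) auto
    then show ?thesis by simp
  qed
  have sign: "(\<Prod>r<8. walsh_sign r h :: eis) = 1"
    using less_8_cases[OF h(1)] by (elim disjE; simp add: prod_lessThan_8 walsh_sign_def)
  have "det_C2C2C2 g = (\<Prod>r<8. g h * walsh_sign r h)"
    unfolding prod_walsh[symmetric] by (intro prod.cong) (simp_all add: w)
  also have "\<dots> = (((g h)\<^sup>2)\<^sup>2)\<^sup>2" by (simp add: prod.distrib sign)
  finally show ?thesis using emod_unit_power(2)[OF h(2)] by simp
qed

lemma det_C2C2C2_unit_int: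
  fixes f :: "nat \<Rightarrow> int"
  assumes "\<And>r. r < 8 \<Longrightarrow> \<bar>walsh f r\<bar> = 1"
  shows "det_C2C2C2 f = 1"
proof (rule int_unit_from_eis)
  have "walsh (\<lambda>u. of_int (f u)) r = (of_int (walsh f r) :: eis)" for r
    by (simp add: walsh_def walsh_sign_def)
  then have "3 dvd emod (det_C2C2C2 (\<lambda>u. of_int (f u))) - 1"
    using assms by (intro det_C2C2C2_unit) (simp add: enorm_of_int abs_square_eq_1)
  then show "3 dvd emod (of_int (det_C2C2C2 f)) - 1" by (simp add: det_C2C2C2_def det_C2C2_def)
  show "\<bar>det_C2C2C2 f\<bar> = 1" using assms by (simp add: abs_prod flip: prod_walsh)
qed

text \<open>In other words, \<open>e\<close> is affine modulo \<open>2\<close> in the three binary digits of its argument.\<close>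

lemma walsh_half_affine:
  fixes f e :: "nat \<Rightarrow> int"
  assumes "\<forall>r<8. walsh f r = 2 * e r"
  shows "even (e 3) \<longleftrightarrow> (even (e 0) \<longleftrightarrow> (even (e 1) \<longleftrightarrow> even (e 2)))"
    and "even (e 5) \<longleftrightarrow> (even (e 0) \<longleftrightarrow> (even (e 1) \<longleftrightarrow> even (e 4)))"
    and "even (e 6) \<longleftrightarrow> (even (e 0) \<longleftrightarrow> (even (e 2) \<longleftrightarrow> even (e 4)))"
    and "even (e 7) \<longleftrightarrow> (even (e 1) \<longleftrightarrow> (even (e 2) \<longleftrightarrow> even (e 4)))"
proof -
  have w: "walsh f 0 = 2 * e 0" "walsh f 1 = 2 * e 1" "walsh f 2 = 2 * e 2" "walsh f 3 = 2 * e 3"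
    "walsh f 4 = 2 * e 4" "walsh f 5 = 2 * e 5" "walsh f 6 = 2 * e 6" "walsh f 7 = 2 * e 7"
    by (simp_all add: assms)
  \<comment> \<open>Each sum runs over an affine plane of indices; cancellation leaves two
    coefficients, each with a factor 4 up to sign.\<close>
  have "2 * (e 0 + e 1 + e 2 + e 3) = 2 * (2 * (f 0 + f 4))" "2 * (e 0 + e 1 + e 4 + e 5) = 2 * (2 * (f 0 + f 2))"
    "2 * (e 0 + e 2 + e 4 + e 6) = 2 * (2 * (f 0 + f 1))" "2 * (e 1 + e 2 + e 4 + e 7) = 2 * (2 * (f 0 - f 7))"
    unfolding distrib_left w[symmetric] walsh_eqs by simp_all
  then have "e 0 + e 1 + e 2 + e 3 = 2 * (f 0 + f 4)" "e 0 + e 1 + e 4 + e 5 = 2 * (f 0 + f 2)"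
    "e 0 + e 2 + e 4 + e 6 = 2 * (f 0 + f 1)" "e 1 + e 2 + e 4 + e 7 = 2 * (f 0 - f 7)"
    by (simp_all only: mult_cancel_left zero_neq_numeral[symmetric] simp_thms)
  then have "even (e 0 + e 1 + e 2 + e 3)" "even (e 0 + e 1 + e 4 + e 5)"
    "even (e 0 + e 2 + e 4 + e 6)" "even (e 1 + e 2 + e 4 + e 7)"
    by simp_all
  then show "even (e 3) \<longleftrightarrow> (even (e 0) \<longleftrightarrow> (even (e 1) \<longleftrightarrow> even (e 2)))"
    "even (e 5) \<longleftrightarrow> (even (e 0) \<longleftrightarrow> (even (e 1) \<longleftrightarrow> even (e 4)))"
    "even (e 6) \<longleftrightarrow> (even (e 0) \<longleftrightarrow> (even (e 2) \<longleftrightarrow> even (e 4)))"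
    "even (e 7) \<longleftrightarrow> (even (e 1) \<longleftrightarrow> (even (e 2) \<longleftrightarrow> even (e 4)))"
    by auto
qed

text \<open>The zero set of an affine function on F_2^3 is empty, a plane or everything.\<close>

lemma card_even_walsh_half:
  fixes f e :: "nat \<Rightarrow> int"
  assumes "\<forall>r<8. walsh f r = 2 * e r"
  shows "card {r. r < 8 \<and> even (e r)} = 0 \<or> card {r. r < 8 \<and> even (e r)} = 4 \<or> card {r. r < 8 \<and> even (e r)} = 8"
proof -
  have "card {r. r < 8 \<and> even (e r)} = (\<Sum>r<8. of_bool (even (e r)))"
    by (simp add: Int_def lessThan_def conj_commute)
  then show ?thesis
    unfolding sum_lessThan_8 walsh_half_affine[OF assms]
    by (cases "even (e 0)"; cases "even (e 1)"; cases "even (e 2)"; cases "even (e 4)") simp_all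
qed

text \<open>For odd x and y, 4 divides (x - 1)(y - 1), so x y - 1 and (x - 1) + (y - 1) agree modulo
  4. This turns the sums known from Fourier inversion into signs of products.\<close>

lemma prod_odd_mod_4:
  fixes x :: "'i \<Rightarrow> int"
  assumes "finite A" "\<And>i. i \<in> A \<Longrightarrow> odd (x i)"
  shows "4 dvd (\<Prod>i\<in>A. x i) - 1 - (\<Sum>i\<in>A. x i - 1)"
  using assms
proof (induction A rule: finite_induct)
  case (insert i A)
  let ?P = "\<Prod>i\<in>A. x i" and ?S = "\<Sum>i\<in>A. x i - 1"
  have "odd ?P" using insert by (auto simp: even_prod_iff)
  then obtain k where k: "?P = 2 * k + 1" by (elim oddE)
  obtain l where l: "x i = 2 * l + 1" using insert.prems[of i] by (auto elim: oddE)
  have "x i * ?P - 1 - (x i - 1 + ?S) = (?P - 1 - ?S) + 4 * (l * k)"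
    unfolding k l by (simp add: algebra_simps)
  moreover have "4 dvd (?P - 1 - ?S) + 4 * (l * k)" using insert by (intro dvd_add) auto
  ultimately show ?case
    unfolding prod.insert[OF insert.hyps(1,2)] sum.insert[OF insert.hyps(1,2)] by metis
qed simp

lemma prod_even_ge:
  fixes x :: "nat \<Rightarrow> int"
  assumes "\<And>r. r < 8 \<Longrightarrow> x r \<in> signed_two_powers"
  shows "2 ^ card {r. r < 8 \<and> even (x r)} \<le> \<bar>\<Prod>r<8. x r\<bar>"
proof -
  have "(\<Prod>r<8. if even (x r) then 2 else 1) \<le> (\<Prod>r<8. \<bar>x r\<bar>)"
    using assms signed_two_powers_even signed_two_powers_odd by (intro prod_mono) force
  moreover have "(\<Prod>r<8. if even (x r) then 2 else 1 :: int) = 2 ^ card {r. r < 8 \<and> even (x r)}"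
    by (simp add: prod.If_cases Int_def lessThan_def)
  ultimately show ?thesis by (simp add: abs_prod)
qed

section \<open>Elements all of whose Walsh values are even\<close>

lemma det_walsh_half:
  fixes F e :: "nat \<Rightarrow> 'a::comm_ring_1"
  assumes "\<forall>r<8. walsh F r = 2 * e r"
  shows "det_C2C2C2 F = 2 ^ 8 * (\<Prod>r<8. e r)"
proof -
  have "det_C2C2C2 F = (\<Prod>r<8. 2 * e r)"
    unfolding prod_walsh[symmetric] by (intro prod.cong) (simp_all add: assms)
  then show ?thesis by (simp add: prod.distrib)
qed

lemma sum_walsh_half:
  fixes f e :: "nat \<Rightarrow> int"
  assumes "\<forall>r<8. walsh f r = 2 * e r" "h < 8"
  shows "(\<Sum>r<8. walsh_sign r h * e r) = 4 * f h"
proof -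
  have "2 * (\<Sum>r<8. walsh_sign r h * e r) = (\<Sum>r<8. walsh_sign r h * walsh f r)"
    unfolding sum_distrib_left by (intro sum.cong) (simp_all add: assms)
  then show ?thesis using walsh_inversion[OF assms(2)] by simp
qed

text \<open>Below 2^12 fewer than four halves can be even, hence none. Their product is then 1 or
  -1, and it is 1 modulo 4 because the sum of the eight halves is a multiple of 4.\<close>

lemma det_C2C2C2_even_small:
  fixes f :: "nat \<Rightarrow> int"
  assumes S: "det_C2C2C2 f \<in> signed_two_powers" and e: "\<forall>r<8. walsh f r = 2 * e r"
    and small: "\<bar>det_C2C2C2 f\<bar> < 2 ^ 12"
  shows "det_C2C2C2 f = 2 ^ 8"
proof -
  note det = det_walsh_half[OF e]
  have Se: "e r \<in> signed_two_powers" if "r < 8" for r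
  proof -
    have "e r dvd det_C2C2C2 f" unfolding det using that by (intro dvd_mult dvd_prodI) auto
    then show ?thesis using S by (auto elim!: dvdE simp: signed_two_powers_mult_iff)
  qed
  have "\<bar>\<Prod>r<8. e r\<bar> < 16" using small by (simp add: det abs_mult)
  then have "(2::int) ^ card {r. r < 8 \<and> even (e r)} < 2 ^ 4" using prod_even_ge[of e] Se by fastforce
  then have "card {r. r < 8 \<and> even (e r)} < 4" by (rule power_less_imp_less_exp[rotated]) simp
  then have "card {r. r < 8 \<and> even (e r)} = 0" using card_even_walsh_half[OF e] by linarith
  then have odd: "odd (e r)" if "r < 8" for r using that by auto
  then have "\<bar>\<Prod>r<8. e r\<bar> = 1" using Se by (simp add: abs_prod signed_two_powers_odd)
  moreover have "4 dvd (\<Prod>r<8. e r) - 1"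
  proof -
    have "4 dvd (\<Prod>r<8. e r) - 1 - (\<Sum>r<8. e r - 1)" by (rule prod_odd_mod_4) (use odd in auto)
    moreover have "(\<Sum>r<8. e r - 1) = 4 * (f 0 - 2)"
      using sum_walsh_half[OF e, of 0] by (simp add: walsh_sign_def sum_subtractf)
    ultimately show ?thesis by presburger
  qed
  ultimately have "(\<Prod>r<8. e r) = 1" by (auto simp: abs_if split: if_splits)
  then show ?thesis by (simp add: det)
qed

text \<open>Here \<open>f\<close> is, modulo 3, a single group element up to sign. Since 0, 4 or 8
  of the halves are even, the exponents 9, 10 and 11 are skipped by counting alone; 13 would need
  even halves of absolute values 2, 2, 2, 4, which Fourier inversion at \<open>h\<close> excludes
  modulo 4.\<close>

lemma det_C2C2C2_even_unit:
  fixes f :: "nat \<Rightarrow> int"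
  assumes S: "det_C2C2C2 f \<in> signed_two_powers" and e: "\<forall>r<8. walsh f r = 2 * e r"
    and h: "h < 8" "\<epsilon> = 1 \<or> \<epsilon> = - 1" "3 dvd f h - \<epsilon>" and rest: "\<And>k. k < 8 \<Longrightarrow> k \<noteq> h \<Longrightarrow> 3 dvd f k"
    and k: "\<bar>det_C2C2C2 f\<bar> = 2 ^ k"
  shows "k = 8 \<or> k = 12 \<or> 14 \<le> k"
proof -
  \<comment> \<open>Modulo 3, \<open>2 * e r\<close> is \<open>\<epsilon>\<close> times the Walsh
    sign, and 2 is -1; this factor makes every \<open>d r\<close> congruent to 1, hence a power of
    -2.\<close>
  define d where "d = (\<lambda>r. - \<epsilon> * walsh_sign r h * e r)"
  have unit: "- \<epsilon> * walsh_sign r h = 1 \<or> - \<epsilon> * walsh_sign r h = - 1" for r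
    using h(2) walsh_sign_cases[of r h, where 'a = int] by auto
  have abs: "\<bar>d r\<bar> = \<bar>e r\<bar>" for r
    unfolding d_def using unit[of r] by (elim disjE; simp only:; simp)
  have even: "even (d r) \<longleftrightarrow> even (e r)" for r
    using abs[of r] by (metis dvd_abs_iff)
  have Sd: "d r \<in> signed_two_powers" if "r < 8" for r
  proof -
    have "e r dvd det_C2C2C2 f" unfolding det_walsh_half[OF e] using that by (intro dvd_mult dvd_prodI) auto
    then have "e r \<in> signed_two_powers" using S by (auto elim!: dvdE simp: signed_two_powers_mult_iff)
    then show ?thesis using abs by (simp add: signed_two_powers_def)
  qed
  have mod3: "3 dvd d r - 1" if "r < 8" for r
  proof -
    have "walsh f r - f h * walsh_sign r h = (\<Sum>u\<in>{..<8} - {h}. f u * walsh_sign r u)"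
      unfolding walsh_def using h(1) by (subst sum.remove[of _ h]) auto
    moreover have "3 dvd (\<Sum>u\<in>{..<8} - {h}. f u * walsh_sign r u)"
      using rest by (intro dvd_sum dvd_mult2) auto
    ultimately have "3 dvd walsh f r - f h * walsh_sign r h" by simp
    moreover have "3 dvd (f h - \<epsilon>) * walsh_sign r h" using h(3) by simp
    ultimately have "3 dvd (walsh f r - f h * walsh_sign r h) + (f h - \<epsilon>) * walsh_sign r h" by (rule dvd_add)
    then have "3 dvd 2 * e r - \<epsilon> * walsh_sign r h" using e that by (simp add: algebra_simps)
    then show ?thesis
      unfolding d_def using h(2) walsh_sign_cases[of r h, where 'a = int] by (elim disjE; simp; presburger)
  qed
  have "\<exists>c. d r = (- 2) ^ c" if "r < 8" for r
    using signed_two_powers_mod_3[OF Sd mod3] that by metis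
  then obtain c where c: "\<And>r. r < 8 \<Longrightarrow> d r = (- 2) ^ c r" by metis
  have c0: "even (d r) \<longleftrightarrow> c r > 0" if "r < 8" for r using c[OF that] by simp
  define E where "E = {r. r < 8 \<and> even (d r)}"
  have E: "finite E" "E \<subseteq> {..<8}" by (auto simp: E_def)
  have "\<bar>det_C2C2C2 f\<bar> = 2 ^ 8 * (\<Prod>r<8. \<bar>d r\<bar>)"
    by (simp add: det_walsh_half[OF e] abs_mult abs_prod abs)
  also have "(\<Prod>r<8. \<bar>d r\<bar>) = (\<Prod>r<8. 2 ^ c r)"
    by (intro prod.cong) (simp_all add: c power_abs)
  finally have "(2::int) ^ k = 2 ^ (8 + (\<Sum>r<8. c r))" by (simp add: k power_add power_sum)
  then have k8: "k = 8 + (\<Sum>r<8. c r)" by (simp only: power_inject_exp)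
  have cE: "(\<Sum>r<8. c r) = (\<Sum>r\<in>E. c r)"
    by (rule sum.mono_neutral_right) (auto simp: E_def c0)
  have ge: "card B \<le> (\<Sum>r\<in>B. c r)" if "B \<subseteq> E" for B
  proof -
    have "(\<Sum>r\<in>B. 1) \<le> (\<Sum>r\<in>B. c r)" using that by (intro sum_mono) (auto simp: E_def c0)
    then show ?thesis by simp
  qed
  have "card E = 0 \<or> card E = 4 \<or> card E = 8"
    using card_even_walsh_half[OF e] by (simp add: E_def even)
  moreover have "(\<Sum>r\<in>E. c r) \<noteq> 5" if "card E = 4"
  proof
    assume 5: "(\<Sum>r\<in>E. c r) = 5"
    \<comment> \<open>Three further positive exponents leave at most 2 for \<open>c r\<close>, and
      for exponents 1 and 2 the power is \<open>2 * c r\<close> modulo 4. The even terms thus sum to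
      10 and the four odd terms, all equal to 1, bring the total to 14 modulo 4.\<close>
    have "4 dvd (- 2) ^ c r - 2 * int (c r)" if "r \<in> E" for r
    proof -
      have "c r + (\<Sum>r\<in>E - {r}. c r) = 5" using 5 E(1) that by (simp add: sum.remove[of E r])
      moreover have "3 \<le> (\<Sum>r\<in>E - {r}. c r)" using ge[of "E - {r}"] \<open>card E = 4\<close> E(1) that by simp
      ultimately have "c r \<le> 2" by linarith
      moreover have "0 < c r" using that by (auto simp: E_def c0)
      ultimately have "c r = 1 \<or> c r = 2" by linarith
      then show ?thesis by auto
    qed
    then have "4 dvd (\<Sum>r\<in>E. (- 2) ^ c r - 2 * int (c r))" by (rule dvd_sum)
    also have "\<dots> = (\<Sum>r\<in>E. d r) - 2 * int (\<Sum>r\<in>E. c r)"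
      using E(2) c by (simp add: sum_subtractf sum_distrib_left subset_iff)
    finally have E4: "4 dvd (\<Sum>r\<in>E. d r) - 10" by (simp add: 5)
    have "(\<Sum>r<8. d r) = (\<Sum>r\<in>E. d r) + (\<Sum>r\<in>{..<8} - E. d r)"
      using E(2) by (simp add: sum.subset_diff add.commute)
    also have "(\<Sum>r\<in>{..<8} - E. d r) = (\<Sum>r\<in>{..<8} - E. 1)"
      using c c0 by (intro sum.cong) (auto simp: E_def)
    also have "\<dots> = 4" using E \<open>card E = 4\<close> by (simp add: card_Diff_subset)
    finally have "4 dvd (\<Sum>r<8. d r) - 14" using E4 by simp
    moreover have "(\<Sum>r<8. d r) = - \<epsilon> * (4 * f h)"
      unfolding sum_walsh_half[OF e h(1), symmetric] by (simp add: d_def sum_distrib_left mult.assoc)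
    ultimately have "4 dvd - \<epsilon> * (4 * f h) - 14" by metis
    moreover have "4 dvd - \<epsilon> * (4 * f h)" by simp
    ultimately have "(4::int) dvd 14" by (simp only: dvd_diff_right_iff)
    then show False by simp
  qed
  ultimately show ?thesis
    using ge[of E] E(1) unfolding k8 cE by (elim disjE) auto
qed

text \<open>The six units are written as \<open>\<epsilon>\<close> times 1, \<omega> or \<omega>^2 =
  -1 - \<omega>, so that \<open>\<epsilon>\<close> is the residue modulo 1 - \<omega>.\<close>

lemma eis_unit_cases:
  assumes "enorm x = 1"
  shows "\<exists>\<epsilon>. (\<epsilon> = 1 \<or> \<epsilon> = - 1) \<and> (x = Eis \<epsilon> 0 \<or> x = Eis 0 \<epsilon> \<or> x = Eis (- \<epsilon>) (- \<epsilon>))"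
proof -
  obtain a b where x: "x = Eis a b" by (cases x)
  have "(a - b)\<^sup>2 + a\<^sup>2 + b\<^sup>2 = 2"
    using assms by (simp add: x enorm_def power2_eq_square algebra_simps)
  then have "a\<^sup>2 \<le> 2" "b\<^sup>2 \<le> 2" "(a - b)\<^sup>2 \<le> 2"
    using zero_le_power2[of a] zero_le_power2[of b] zero_le_power2[of "a - b"] by linarith+
  moreover have le1: "\<bar>z\<bar> \<le> 1" if "z\<^sup>2 \<le> 2" for z :: int
  proof (rule ccontr)
    assume "\<not> ?thesis"
    then have "2 * 2 \<le> \<bar>z\<bar> * \<bar>z\<bar>" by (intro mult_mono) auto
    then show False using that by (simp add: power2_eq_square)
  qed
  ultimately have "a = - 1 \<or> a = 0 \<or> a = 1" "b = - 1 \<or> b = 0 \<or> b = 1" "\<bar>a - b\<bar> \<le> 1" by (auto dest: le1)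
  then show ?thesis using assms by (elim disjE) (auto simp: x enorm_def)
qed

lemma eis_sel_sum: "eis_re (sum F A) = (\<Sum>i\<in>A. eis_re (F i))" "eis_om (sum F A) = (\<Sum>i\<in>A. eis_om (F i))"
  by (induction A rule: infinite_finite_induct) simp_all

lemma walsh_eis_coordinates:
  fixes e :: "nat \<Rightarrow> eis"
  assumes e: "\<forall>r<8. walsh g r = 2 * e r"
  shows "\<forall>r<8. walsh (\<lambda>u. eis_re (g u)) r = 2 * eis_re (e r)"
    and "\<forall>r<8. walsh (\<lambda>u. eis_om (g u)) r = 2 * eis_om (e r)"
proof -
  have ws: "walsh_sign r u = (of_int (walsh_sign r u) :: eis)" for r u
    by (simp add: walsh_sign_def)
  have sign: "eis_re (walsh_sign r u) = walsh_sign r u" "eis_om (walsh_sign r u) = 0" for r u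
    unfolding ws[of r u] by simp_all
  have "walsh (\<lambda>u. eis_re (g u)) r = eis_re (walsh g r)" "walsh (\<lambda>u. eis_om (g u)) r = eis_om (walsh g r)" for r
    by (simp_all add: walsh_def eis_sel_sum sign)
  then show "\<forall>r<8. walsh (\<lambda>u. eis_re (g u)) r = 2 * eis_re (e r)"
    "\<forall>r<8. walsh (\<lambda>u. eis_om (g u)) r = 2 * eis_om (e r)"
    using e by simp_all
qed

text \<open>Up to sign the units are \<open>1\<close>, \<open>\<omega>\<close> and \<open>\<omega>\<^sup>2\<close>, the nonzero residue classes modulo \<open>2\<close>, and \<open>e\<close> is
  an affine map into the four residue classes.\<close>

lemma walsh_half_eis_classes:
  fixes e :: "nat \<Rightarrow> eis"
  assumes e: "\<forall>r<8. walsh g r = 2 * e r"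
  shows "card {r. r < 8 \<and> 2 dvd e r} \<noteq> 1"
    and "\<forall>r<8. \<not> 2 dvd e r \<Longrightarrow> (\<forall>r<8. \<not> (odd (eis_re (e r)) \<and> even (eis_om (e r)))) \<or>
      (\<forall>r<8. \<not> (even (eis_re (e r)) \<and> odd (eis_om (e r)))) \<or>
      (\<forall>r<8. \<not> (odd (eis_re (e r)) \<and> odd (eis_om (e r))))"
proof -
  define p q where "p = (\<lambda>r. even (eis_re (e r)))" and "q = (\<lambda>r. even (eis_om (e r)))"
  note coord = walsh_eis_coordinates[OF e]
  have P: "p 3 \<longleftrightarrow> (p 0 \<longleftrightarrow> (p 1 \<longleftrightarrow> p 2))" "p 5 \<longleftrightarrow> (p 0 \<longleftrightarrow> (p 1 \<longleftrightarrow> p 4))"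
      "p 6 \<longleftrightarrow> (p 0 \<longleftrightarrow> (p 2 \<longleftrightarrow> p 4))" "p 7 \<longleftrightarrow> (p 1 \<longleftrightarrow> (p 2 \<longleftrightarrow> p 4))"
    unfolding p_def by (rule walsh_half_affine; use coord in blast)+
  have Q: "q 3 \<longleftrightarrow> (q 0 \<longleftrightarrow> (q 1 \<longleftrightarrow> q 2))" "q 5 \<longleftrightarrow> (q 0 \<longleftrightarrow> (q 1 \<longleftrightarrow> q 4))"
      "q 6 \<longleftrightarrow> (q 0 \<longleftrightarrow> (q 2 \<longleftrightarrow> q 4))" "q 7 \<longleftrightarrow> (q 1 \<longleftrightarrow> (q 2 \<longleftrightarrow> q 4))"
    unfolding q_def by (rule walsh_half_affine; use coord in blast)+
  have zero: "2 dvd e r \<longleftrightarrow> p r \<and> q r" for r by (simp add: even_eis_iff p_def q_def)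
  have "card {r. r < 8 \<and> 2 dvd e r} = (\<Sum>r<8. of_bool (p r \<and> q r))"
    by (simp add: Int_def lessThan_def conj_commute zero)
  \<comment> \<open>A nonempty fibre of an affine map from F_2^3 to F_2^2 has at least two points.
    The values at 0, 1, 2 and 4 determine the map, which leaves finitely many cases.\<close>
  also have "\<dots> \<noteq> 1"
    unfolding sum_lessThan_8 P Q
    by (cases "p 0"; cases "p 1"; cases "p 2"; cases "p 4"; cases "q 0"; cases "q 1"; cases "q 2"; cases "q 4") simp_all
  finally show "card {r. r < 8 \<and> 2 dvd e r} \<noteq> 1" .
  have all8: "(\<forall>r<8. R r) \<longleftrightarrow> R 0 \<and> R 1 \<and> R 2 \<and> R 3 \<and> R 4 \<and> R 5 \<and> R 6 \<and> R (7::nat)" for R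
    by (auto dest!: less_8_cases)
  assume "\<forall>r<8. \<not> 2 dvd e r"
  then have "\<forall>r<8. \<not> (p r \<and> q r)" by (simp add: zero)
  \<comment> \<open>An affine image that avoids 0 is not the whole plane, so it has at most two
    points and misses a nonzero class.\<close>
  then have "(\<forall>r<8. \<not> (\<not> p r \<and> q r)) \<or> (\<forall>r<8. \<not> (p r \<and> \<not> q r)) \<or> (\<forall>r<8. \<not> (\<not> p r \<and> \<not> q r))"
    unfolding all8 P Q
    by (cases "p 0"; cases "p 1"; cases "p 2"; cases "p 4"; cases "q 0"; cases "q 1"; cases "q 2"; cases "q 4") simp_all
  then show "(\<forall>r<8. \<not> (odd (eis_re (e r)) \<and> even (eis_om (e r)))) \<or>
      (\<forall>r<8. \<not> (even (eis_re (e r)) \<and> odd (eis_om (e r)))) \<or>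
      (\<forall>r<8. \<not> (odd (eis_re (e r)) \<and> odd (eis_om (e r))))"
    by (simp add: p_def q_def)
qed

text \<open>Beyond the factor 2^16 less than 4^2 is left, so at most one half is even; since exactly
  one is impossible, all eight are units. The product of their signs is then found modulo 4 from the
  vanishing of their sum modulo 4.\<close>

lemma det_C2C2C2_eis_even_small:
  assumes S: "enorm (det_C2C2C2 g) \<in> signed_two_powers" and e: "\<forall>r<8. walsh g r = 2 * e r"
    and small: "enorm (det_C2C2C2 g) < 2 ^ 20"
  shows "3 dvd emod (det_C2C2C2 g) - 1"
proof -
  note det = det_walsh_half[OF e]
  have enorm_prod: "enorm (\<Prod>r\<in>A. x r) = (\<Prod>r\<in>A. enorm (x r))" for A :: "nat set" and x
    by (induction A rule: infinite_finite_induct) (simp_all add: enorm_mult, simp_all add: enorm_def)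
  have "2 ^ 8 = (of_int 256 :: eis)" by simp
  then have "enorm (2 ^ 8) = 2 ^ 16" by (simp only: enorm_of_int) simp
  then have norm: "enorm (det_C2C2C2 g) = 2 ^ 16 * (\<Prod>r<8. enorm (e r))"
    by (simp only: det enorm_mult enorm_prod)
  have Se: "enorm (e r) \<in> signed_two_powers" if "r < 8" for r
  proof -
    have "enorm (e r) dvd enorm (det_C2C2C2 g)" unfolding norm using that by (intro dvd_mult dvd_prodI) auto
    then show ?thesis using S by (auto elim!: dvdE simp: signed_two_powers_mult_iff)
  qed
  let ?Z = "{r. r < 8 \<and> 2 dvd e r}"
  have "(4::int) ^ card ?Z = (\<Prod>r<8. if 2 dvd e r then 4 else 1)"
    by (simp add: prod.If_cases Int_def lessThan_def)
  also have "\<dots> \<le> (\<Prod>r<8. enorm (e r))"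
    using Se enorm_even_ge enorm_odd_eq_1 by (intro prod_mono) force
  also have "\<dots> < 4 ^ 2" using small by (simp add: norm)
  finally have "card ?Z < 2" by (rule power_less_imp_less_exp[rotated]) simp
  then have "card ?Z = 0" using walsh_half_eis_classes(1)[OF e] by linarith
  then have odd: "\<not> 2 dvd e r" if "r < 8" for r using that by auto
  have "\<exists>\<epsilon>. (\<epsilon> = 1 \<or> \<epsilon> = - 1) \<and> (e r = Eis \<epsilon> 0 \<or> e r = Eis 0 \<epsilon> \<or> e r = Eis (- \<epsilon>) (- \<epsilon>))" if "r < 8" for r
    using eis_unit_cases enorm_odd_eq_1 Se odd that by blast
  then obtain \<epsilon> where \<epsilon>: "\<And>r. r < 8 \<Longrightarrow> \<epsilon> r = 1 \<or> \<epsilon> r = - 1"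
    and e_eq: "\<And>r. r < 8 \<Longrightarrow> e r = Eis (\<epsilon> r) 0 \<or> e r = Eis 0 (\<epsilon> r) \<or> e r = Eis (- \<epsilon> r) (- \<epsilon> r)"
    by metis
  have \<epsilon>odd: "odd (\<epsilon> r)" if "r < 8" for r using \<epsilon>[OF that] by auto
  let ?a = "\<lambda>r. eis_re (e r)" and ?b = "\<lambda>r. eis_om (e r)"
  \<comment> \<open>These are the sums of signs over the halves equal, up to sign, to 1, \<omega>
    and \<omega>^2, told apart by their classes modulo 2. The sum of the halves is s0 + s1 \<omega>
    + s2 \<omega>^2, and \<omega>^2 = -1 - \<omega>.\<close>
  define s0 where "s0 = (\<Sum>r<8. if odd (?a r) \<and> even (?b r) then \<epsilon> r else 0)"
  define s1 where "s1 = (\<Sum>r<8. if even (?a r) \<and> odd (?b r) then \<epsilon> r else 0)"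
  define s2 where "s2 = (\<Sum>r<8. if odd (?a r) \<and> odd (?b r) then \<epsilon> r else 0)"
  have "(\<Sum>r<8. e r) = 4 * g 0"
  proof -
    have ws: "walsh (\<lambda>u. eis_re (g u)) r = 2 * ?a r" "walsh (\<lambda>u. eis_om (g u)) r = 2 * ?b r" if "r < 8" for r
      using walsh_eis_coordinates[OF e] that by blast+
    show ?thesis
      using sum_walsh_half[of "\<lambda>u. eis_re (g u)" ?a 0] sum_walsh_half[of "\<lambda>u. eis_om (g u)" ?b 0] ws
      by (intro eis.expand) (simp add: eis_sel_sum walsh_sign_def)
  qed
  then have "4 dvd (\<Sum>r<8. ?a r)" "4 dvd (\<Sum>r<8. ?b r)"
    unfolding eis_sel_sum[symmetric] by simp_all
  moreover have "(\<Sum>r<8. ?a r) = s0 - s2" "(\<Sum>r<8. ?b r) = s1 - s2"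
    unfolding s0_def s1_def s2_def sum_subtractf[symmetric]
    using e_eq \<epsilon>odd by (intro sum.cong; fastforce)+
  ultimately have s: "4 dvd s0 - s2" "4 dvd s1 - s2" by simp_all
  moreover have "s0 = 0 \<or> s1 = 0 \<or> s2 = 0"
  proof -
    have "\<forall>r<8. \<not> 2 dvd e r" using odd by blast
    from walsh_half_eis_classes(2)[OF e this] show ?thesis
    proof (elim disjE)
      assume "\<forall>r<8. \<not> (odd (?a r) \<and> even (?b r))"
      then have "s0 = 0" unfolding s0_def by (intro sum.neutral) auto
      then show ?thesis by blast
    next
      assume "\<forall>r<8. \<not> (even (?a r) \<and> odd (?b r))"
      then have "s1 = 0" unfolding s1_def by (intro sum.neutral) auto
      then show ?thesis by blast
    next
      assume "\<forall>r<8. \<not> (odd (?a r) \<and> odd (?b r))"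
      then have "s2 = 0" unfolding s2_def by (intro sum.neutral) auto
      then show ?thesis by blast
    qed
  qed
  \<comment> \<open>The three sums agree modulo 4 and one of them is 0, so all are multiples of
    4.\<close>
  ultimately have "4 dvd s0 + s1 + s2" by presburger
  moreover have "(\<Sum>r<8. \<epsilon> r) = s0 + s1 + s2"
    unfolding s0_def s1_def s2_def sum.distrib[symmetric]
    using e_eq \<epsilon>odd by (intro sum.cong; fastforce)
  ultimately have "4 dvd (\<Sum>r<8. \<epsilon> r)" by simp
  moreover have "4 dvd (\<Prod>r<8. \<epsilon> r) - 1 - (\<Sum>r<8. \<epsilon> r - 1)"
    by (rule prod_odd_mod_4) (use \<epsilon>odd in auto)
  moreover have "(\<Sum>r<8. \<epsilon> r - 1) = (\<Sum>r<8. \<epsilon> r) - 8" by (simp add: sum_subtractf)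
  ultimately have "4 dvd (\<Prod>r<8. \<epsilon> r) - 1" by presburger
  moreover have "\<bar>\<Prod>r<8. \<epsilon> r\<bar> = 1"
    unfolding abs_prod using \<epsilon> by (intro prod.neutral) fastforce
  ultimately have prod1: "(\<Prod>r<8. \<epsilon> r) = 1" by (auto simp: abs_if split: if_splits)
  have "3 dvd (\<Prod>r\<in>A. \<epsilon> r) - emod (\<Prod>r\<in>A. e r)" if "A \<subseteq> {..<8}" for A
  proof -
    have "finite A" using that finite_subset by blast
    then show ?thesis using that
    proof (induction A rule: finite_induct)
      case (insert r A)
      have "3 dvd \<epsilon> r - emod (e r)" using e_eq[of r] insert.prems by (auto simp: emod_def)
      then show ?case using insert by (simp add: emod_cong_mult)
    qed simp
  qed
  from this[of "{..<8}"] have "3 dvd 1 - emod (\<Prod>r<8. e r)" by (simp add: prod1)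
  \<comment> \<open>The factor 256 comes from the eight halvings and is 1 modulo 3.\<close>
  then have "3 dvd 256 * 1 - emod (256 * (\<Prod>r<8. e r))" by (intro emod_cong)
  then have "3 dvd 256 - emod (det_C2C2C2 g)" by (simp add: det)
  then show ?thesis by presburger
qed

lemma det_C2C2C2_two_power:
  assumes fg: "\<forall>u<8. 3 dvd f u - emod (g u)"
    and S: "det_C2C2C2 f * enorm (det_C2C2C2 g) \<in> signed_two_powers"
  shows "(\<exists>k. det_C2C2C2 f * enorm (det_C2C2C2 g) = (- 2) ^ k \<and> (k = 0 \<or> k = 8 \<or> k = 12 \<or> 14 \<le> k)) \<or>
    2 ^ 32 \<le> \<bar>det_C2C2C2 f * enorm (det_C2C2C2 g)\<bar>"
proof -
  have Sf: "det_C2C2C2 f \<in> signed_two_powers" and Sg: "enorm (det_C2C2C2 g) \<in> signed_two_powers"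
    using S by (simp_all add: signed_two_powers_mult_iff)
  have Sw: "walsh f r \<in> signed_two_powers" "enorm (walsh g r) \<in> signed_two_powers" if "r < 8" for r
  proof -
    have "walsh f r dvd det_C2C2C2 f" "walsh g r dvd det_C2C2C2 g"
      unfolding prod_walsh[symmetric] using that by (intro dvd_prodI; simp)+
    then show "walsh f r \<in> signed_two_powers" "enorm (walsh g r) \<in> signed_two_powers"
      using Sf Sg by (auto elim!: dvdE simp: enorm_mult signed_two_powers_mult_iff)
  qed
  have parf: "even (walsh f r) \<longleftrightarrow> even (walsh f 0)" and parg: "2 dvd walsh g r \<longleftrightarrow> 2 dvd walsh g 0" for r
    using dvd_diff_iff[OF walsh_parity] by blast+
  have cong_det: "3 dvd det_C2C2C2 f - emod (det_C2C2C2 g)"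
    unfolding det_C2C2C2_def det_C2C2_def by (intro emod_cong; use fg in simp)
  have absf: "\<exists>a. det_C2C2C2 f = (- 2) ^ a" if "3 dvd emod (det_C2C2C2 g) - 1"
  proof -
    have "3 dvd det_C2C2C2 f - 1" using dvd_add[OF cong_det that] by simp
    then show ?thesis using signed_two_powers_mod_3[OF Sf] by metis
  qed
  show ?thesis
  proof (cases "2 dvd walsh g 0")
    case False
    then have unit: "enorm (walsh g r) = 1" if "r < 8" for r
      using parg Sw that by (intro enorm_odd_eq_1) auto
    have x: "det_C2C2C2 f * enorm (det_C2C2C2 g) = det_C2C2C2 f"
    proof -
      have "enorm (\<Prod>r\<in>A. walsh g r) = (\<Prod>r\<in>A. enorm (walsh g r))" for A :: "nat set"
        by (induction A rule: infinite_finite_induct) (simp_all add: enorm_mult, simp_all add: enorm_def)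
      then have "enorm (det_C2C2C2 g) = (\<Prod>r<8. enorm (walsh g r))"
        unfolding prod_walsh[symmetric] by blast
      also have "\<dots> = 1" using unit by (intro prod.neutral) simp
      finally show ?thesis by simp
    qed
    obtain k where k: "det_C2C2C2 f = (- 2) ^ k" using absf det_C2C2C2_unit unit by blast
    have "k = 0 \<or> k = 8 \<or> k = 12 \<or> 14 \<le> k"
    proof (cases "even (walsh f 0)")
      case True
      then have "\<exists>e. walsh f r = 2 * e" for r using parf by (meson evenE)
      then obtain e where e: "\<forall>r<8. walsh f r = 2 * e r" by metis
      obtain h where h: "h < 8" "enorm (g h) = 1" "\<And>k. k < 8 \<Longrightarrow> k \<noteq> h \<Longrightarrow> g k = 0"
        using C2C2C2_unit[OF unit] by blast
      obtain \<epsilon> where \<epsilon>: "\<epsilon> = 1 \<or> \<epsilon> = - 1" "g h = Eis \<epsilon> 0 \<or> g h = Eis 0 \<epsilon> \<or> g h = Eis (- \<epsilon>) (- \<epsilon>)"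
        using eis_unit_cases[OF h(2)] by blast
      have "3 dvd \<epsilon> - emod (g h)" using \<epsilon>(2) by (auto simp: emod_def)
      moreover have "3 dvd f h - emod (g h)" using fg h(1) by blast
      ultimately have "3 dvd f h - \<epsilon>" by presburger
      moreover have "3 dvd f k" if "k < 8" "k \<noteq> h" for k
        using fg h(3)[OF that] that by (force simp: emod_def)
      moreover have "\<bar>det_C2C2C2 f\<bar> = 2 ^ k" by (simp add: k power_abs)
      ultimately show ?thesis using det_C2C2C2_even_unit[OF Sf e h(1) \<epsilon>(1)] by blast
    next
      case False
      then have "det_C2C2C2 f = 1"
        using parf Sw by (intro det_C2C2C2_unit_int signed_two_powers_odd) auto
      then have "\<bar>(- 2 :: int) ^ k\<bar> = 1" using k by simp
      then show ?thesis by (simp add: power_abs)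
    qed
    then show ?thesis using k x by auto
  next
    case True
    then have "\<exists>e. walsh g r = 2 * e" for r using parg by (meson dvdE)
    then obtain e' where e': "\<forall>r<8. walsh g r = 2 * e' r" by metis
    obtain k where k: "enorm (det_C2C2C2 g) = (- 2) ^ k"
      using signed_two_powers_mod_3[OF Sg enorm_two_power_mod_3[OF Sg]] by metis
    have "16 \<le> k"
    proof -
      have "enorm (2 ^ 8 * z) = 2 ^ 16 * enorm z" for z
        by (simp add: enorm_def power2_eq_square algebra_simps)
      then have "2 ^ 16 dvd enorm (det_C2C2C2 g)" unfolding det_walsh_half[OF e'] by (metis dvd_triv_left)
      moreover have "enorm (det_C2C2C2 g) > 0" using Sg enorm_nonneg[of "det_C2C2C2 g"] by (auto simp: signed_two_powers_def)
      ultimately have "2 ^ 16 \<le> enorm (det_C2C2C2 g)" by (rule zdvd_imp_le)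
      moreover have "\<bar>enorm (det_C2C2C2 g)\<bar> = 2 ^ k" unfolding k by (simp add: power_abs)
      ultimately have "(2::int) ^ 16 \<le> 2 ^ k" by linarith
      then show ?thesis by (rule power_le_imp_le_exp[rotated]) simp
    qed
    \<comment> \<open>With at least 16 from \<open>g\<close>, no gap in the exponents matters any
      more; only the sign of the determinant of \<open>f\<close> is left to settle.\<close>
    have fin: ?thesis if "det_C2C2C2 f = (- 2) ^ a" for a
    proof -
      have "det_C2C2C2 f * enorm (det_C2C2C2 g) = (- 2) ^ (a + k)" by (simp add: that k power_add)
      then show ?thesis using \<open>16 \<le> k\<close> by (intro disjI1 exI[of _ "a + k"]) simp
    qed
    show ?thesis
    proof (cases "even (walsh f 0)")
      case False
      then have "det_C2C2C2 f = 1"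
        using parf Sw by (intro det_C2C2C2_unit_int signed_two_powers_odd) auto
      then show ?thesis using fin[of 0] by simp
    next
      case True
      then have "\<exists>e. walsh f r = 2 * e" for r using parf by (meson evenE)
      then obtain e where e: "\<forall>r<8. walsh f r = 2 * e r" by metis
      show ?thesis
      proof (cases "\<bar>det_C2C2C2 f\<bar> < 2 ^ 12")
        case True
        then show ?thesis using det_C2C2C2_even_small[OF Sf e] fin[of 8] by simp
      next
        case False
        show ?thesis
        proof (cases "enorm (det_C2C2C2 g) < 2 ^ 20")
          case True
          then show ?thesis using det_C2C2C2_eis_even_small[OF Sg e'] absf fin by blast
        next
          case large: False
          have "2 ^ 12 * 2 ^ 20 \<le> \<bar>det_C2C2C2 f\<bar> * \<bar>enorm (det_C2C2C2 g)\<bar>"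
            using False large by (intro mult_mono) auto
          then show ?thesis by (simp add: abs_mult)
        qed
      qed
    qed
  qed
qed

subsection \<open>Attained determinants\<close>

text \<open>Eight consecutive exponents suffice, as \<open>b ^ 8\<close> is itself a determinant.
  The factor \<open>s\<close> carries the sign relative to powers of \<open>b\<close>, which
  multiplication by \<open>b ^ 8\<close> preserves.\<close>

lemma int_group_dets_powers:
  assumes "b ^ 8 \<in> int_group_dets TYPE('g::{finite,group_add})"
    and base: "\<And>j. m \<le> j \<Longrightarrow> j < m + 8 \<Longrightarrow> s * b ^ j \<in> int_group_dets TYPE('g)"
    and "m \<le> j"
  shows "s * b ^ j \<in> int_group_dets TYPE('g)"
  using assms(3)
proof (induction j rule: less_induct)
  case (less j)
  show ?case
  proof (cases "j < m + 8")
    case True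
    then show ?thesis using base less.prems by blast
  next
    case False
    then have "s * b ^ (j - 8) \<in> int_group_dets TYPE('g)" by (intro less.IH) auto
    from int_group_dets_mult[OF this assms(1)] show ?thesis
      using False by (simp add: mult.assoc flip: power_add)
  qed
qed

text \<open>The hypothesis is an executable form of the congruences, so that
  \<open>code_simp\<close> decides it on concrete lists.\<close>

lemma list_witness:
  assumes "list_all2 (\<lambda>a x. (a - emod x) mod 3 = 0) f g" "length f = 8"
  shows "\<forall>u<8. 3 dvd f ! u - emod (g ! u)"
  using assms by (auto simp: list_all2_conv_all_nth dvd_eq_mod_eq_0)

lemma C24_witness:
  assumes "list_all2 (\<lambda>a x. (a - emod x) mod 3 = 0) f g" "length f = 8"
    and "det_C8 (\<lambda>u. f ! u) * enorm (det_C8 (\<lambda>u. g ! u)) = x"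
  shows "x \<in> int_group_dets TYPE(24)"
  using list_witness[OF assms(1,2)] assms(3) unfolding int_group_dets_24 by blast

lemma C2_C12_witness:
  assumes "list_all2 (\<lambda>a x. (a - emod x) mod 3 = 0) f g" "length f = 8"
    and "det_C2C4 (\<lambda>u. f ! u) * enorm (det_C2C4 (\<lambda>u. g ! u)) = x"
  shows "x \<in> int_group_dets TYPE(2 \<times> 12)"
  using list_witness[OF assms(1,2)] assms(3) unfolding int_group_dets_2_12 by blast

lemma C2_C2_C6_witness:
  assumes "list_all2 (\<lambda>a x. (a - emod x) mod 3 = 0) f g" "length f = 8"
    and "det_C2C2C2 (\<lambda>u. f ! u) * enorm (det_C2C2C2 (\<lambda>u. g ! u)) = x"
  shows "x \<in> int_group_dets TYPE(2 \<times> 2 \<times> 6)"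
  using list_witness[OF assms(1,2)] assms(3) unfolding int_group_dets_2_2_6 by blast

lemma witnesses_C24:
  shows "- 1 \<in> int_group_dets TYPE(24)"
    and "2 ^ 8 \<in> int_group_dets TYPE(24)"
    and "2 ^ 9 \<in> int_group_dets TYPE(24)"
    and "2 ^ 10 \<in> int_group_dets TYPE(24)"
    and "2 ^ 11 \<in> int_group_dets TYPE(24)"
    and "2 ^ 12 \<in> int_group_dets TYPE(24)"
    and "2 ^ 13 \<in> int_group_dets TYPE(24)"
    and "2 ^ 14 \<in> int_group_dets TYPE(24)"
    and "2 ^ 15 \<in> int_group_dets TYPE(24)"
proof -
  \<comment> \<open>The negative of a group element of order 8: the 24 factors -1 cancel, and
    translation by it is an odd permutation.\<close>
  show "- 1 \<in> int_group_dets TYPE(24)"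
    by (rule C24_witness[of "[0, 0, 0, 0, 0, - 1, 0, 0]" "[0, 0, 0, 0, 0, - 1, 0, 0]"]; code_simp)
  \<comment> \<open>Twice a group element; as 2 is -1 modulo 3, its partner is a unit multiple of
    the same element.\<close>
  show "2 ^ 8 \<in> int_group_dets TYPE(24)"
    by (rule C24_witness[of "[0, 0, 0, 0, 2, 0, 0, 0]" "[0, 0, 0, 0, Eis 0 (- 1), 0, 0, 0]"]; code_simp)
  show "2 ^ 9 \<in> int_group_dets TYPE(24)"
    by (rule C24_witness[of "[0, 0, - 3, - 3, - 3, 0, 0, 1]" "[0, 0, 0, 0, 0, 0, 0, Eis 0 1]"]; code_simp)
  show "2 ^ 10 \<in> int_group_dets TYPE(24)"
    by (rule C24_witness[of "[- 1, 2, 0, - 1, 0, 2, - 1, - 3]" "[Eis 0 (- 1), Eis 0 (- 1), 0, Eis 1 1, 0, - 1, - 1, 0]"]; code_simp)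
  show "2 ^ 11 \<in> int_group_dets TYPE(24)"
    by (rule C24_witness[of "[2, - 5, 5, - 2, 6, - 2, 5, - 5]" "[Eis 0 (- 1), Eis 0 1, Eis 1 1, Eis (- 1) (- 1), 0, 1, - 1, Eis 0 1]"]; code_simp)
  show "2 ^ 12 \<in> int_group_dets TYPE(24)"
    by (rule C24_witness[of "[3, 0, 0, 0, 1, 0, 0, 0]" "[0, 0, 0, 0, Eis (- 1) (- 1), 0, 0, 0]"]; code_simp)
  show "2 ^ 13 \<in> int_group_dets TYPE(24)"
    by (rule C24_witness[of "[14, - 17, 17, - 14, 18, - 14, 17, - 17]" "[Eis 0 (- 1), Eis 0 1, Eis 1 1, Eis (- 1) (- 1), 0, 1, - 1, Eis 0 1]"]; code_simp)
  show "2 ^ 14 \<in> int_group_dets TYPE(24)"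
    by (rule C24_witness[of "[- 3, 0, 0, 0, - 3, 0, - 2, 0]" "[0, 0, 0, 0, 0, 0, Eis 0 1, 0]"]; code_simp)
  show "2 ^ 15 \<in> int_group_dets TYPE(24)"
    by (rule C24_witness[of "[- 1, - 1, 0, 0, 0, 0, - 1, 1]" "[Eis 0 (- 1), - 1, 0, 0, 0, 0, - 1, Eis 0 1]"]; code_simp)
qed

lemma witnesses_C2_C12:
  shows "(- 2) ^ 8 \<in> int_group_dets TYPE(2 \<times> 12)"
    and "(- 2) ^ 12 \<in> int_group_dets TYPE(2 \<times> 12)"
    and "(- 2) ^ 13 \<in> int_group_dets TYPE(2 \<times> 12)"
    and "(- 2) ^ 14 \<in> int_group_dets TYPE(2 \<times> 12)"
    and "(- 2) ^ 15 \<in> int_group_dets TYPE(2 \<times> 12)"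
    and "(- 2) ^ 17 \<in> int_group_dets TYPE(2 \<times> 12)"
    and "(- 2) ^ 18 \<in> int_group_dets TYPE(2 \<times> 12)"
    and "(- 2) ^ 19 \<in> int_group_dets TYPE(2 \<times> 12)"
    and "- ((- 2) ^ 20) \<in> int_group_dets TYPE(2 \<times> 12)"
    and "- ((- 2) ^ 21) \<in> int_group_dets TYPE(2 \<times> 12)"
    and "- ((- 2) ^ 22) \<in> int_group_dets TYPE(2 \<times> 12)"
    and "- ((- 2) ^ 23) \<in> int_group_dets TYPE(2 \<times> 12)"
    and "- ((- 2) ^ 24) \<in> int_group_dets TYPE(2 \<times> 12)"
    and "- ((- 2) ^ 25) \<in> int_group_dets TYPE(2 \<times> 12)"
    and "- ((- 2) ^ 26) \<in> int_group_dets TYPE(2 \<times> 12)"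
    and "- ((- 2) ^ 27) \<in> int_group_dets TYPE(2 \<times> 12)"
proof -
  show "(- 2) ^ 8 \<in> int_group_dets TYPE(2 \<times> 12)"
    by (rule C2_C12_witness[of "[0, 0, 2, 0, 0, 0, 0, 0]" "[0, 0, - 1, 0, 0, 0, 0, 0]"]; code_simp)
  show "(- 2) ^ 12 \<in> int_group_dets TYPE(2 \<times> 12)"
    by (rule C2_C12_witness[of "[0, - 1, 0, 0, 0, 0, 0, 0]" "[0, - 1, Eis (- 1) (- 2), 0, 0, 0, 0, 0]"]; code_simp)
  show "(- 2) ^ 13 \<in> int_group_dets TYPE(2 \<times> 12)"
    by (rule C2_C12_witness[of "[- 1, - 1, - 1, - 2, 0, 0, 0, 3]" "[Eis 1 1, Eis 0 (- 1), - 1, Eis 0 1, 0, 0, 0, 0]"]; code_simp)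
  show "(- 2) ^ 14 \<in> int_group_dets TYPE(2 \<times> 12)"
    by (rule C2_C12_witness[of "[- 3, 0, 2, 0, 0, 0, 3, 0]" "[0, 0, - 1, 0, 0, 0, 0, 0]"]; code_simp)
  show "(- 2) ^ 15 \<in> int_group_dets TYPE(2 \<times> 12)"
    by (rule C2_C12_witness[of "[- 3, 3, - 1, 3, 0, - 3, 0, - 3]" "[0, 0, - 1, 0, 0, 0, 0, 0]"]; code_simp)
  show "(- 2) ^ 17 \<in> int_group_dets TYPE(2 \<times> 12)"
    by (rule C2_C12_witness[of "[- 3, 3, 2, 3, 0, - 3, 3, - 3]" "[0, 0, - 1, 0, 0, 0, 0, 0]"]; code_simp)
  show "(- 2) ^ 18 \<in> int_group_dets TYPE(2 \<times> 12)"
    by (rule C2_C12_witness[of "[3, 3, - 1, 3, 0, 0, 0, 0]" "[0, 0, - 1, 0, 0, 0, 0, 0]"]; code_simp)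
  show "(- 2) ^ 19 \<in> int_group_dets TYPE(2 \<times> 12)"
    by (rule C2_C12_witness[of "[- 3, - 4, - 3, 0, - 3, 0, - 3, 0]" "[0, - 1, 0, 0, 0, 0, 0, 0]"]; code_simp)
  \<comment> \<open>The least case of the exceptional sign: \<open>f\<close> contributes -(2^8) and
    \<open>g\<close> the norm 2^12.\<close>
  show "- ((- 2) ^ 20) \<in> int_group_dets TYPE(2 \<times> 12)"
    by (rule C2_C12_witness[of "[- 1, - 1, 0, 0, 0, 0, - 1, 1]" "[Eis 0 (- 1), - 1, 0, 0, 0, 0, - 1, Eis 0 1]"]; code_simp)
  show "- ((- 2) ^ 21) \<in> int_group_dets TYPE(2 \<times> 12)"
    by (rule C2_C12_witness[of "[- 1, 2, - 1, 2, - 1, 0, 0, 1]" "[Eis 0 (- 1), Eis 0 (- 1), Eis 1 1, - 1, Eis 1 1, 0, 0, 1]"]; code_simp)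
  show "- ((- 2) ^ 22) \<in> int_group_dets TYPE(2 \<times> 12)"
    by (rule C2_C12_witness[of "[2, 2, 2, 2, - 1, 0, 0, 1]" "[Eis 0 (- 1), Eis 0 (- 1), Eis 1 1, - 1, Eis 1 1, 0, 0, 1]"]; code_simp)
  show "- ((- 2) ^ 23) \<in> int_group_dets TYPE(2 \<times> 12)"
    by (rule C2_C12_witness[of "[- 1, - 1, - 1, - 1, - 2, - 3, - 3, - 4]" "[- 1, - 1, Eis 1 1, Eis 0 (- 1), Eis (- 1) (- 1), 0, 0, Eis 0 (- 1)]"]; code_simp)
  show "- ((- 2) ^ 24) \<in> int_group_dets TYPE(2 \<times> 12)"
    by (rule C2_C12_witness[of "[- 1, - 1, 0, 0, - 1, 1, 0, 0]" "[- 1, - 1, 0, 0, - 1, 1, 0, 0]"]; code_simp)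
  show "- ((- 2) ^ 25) \<in> int_group_dets TYPE(2 \<times> 12)"
    by (rule C2_C12_witness[of "[- 1, - 1, 0, 0, 0, 3, 1, 2]" "[Eis 0 (- 1), Eis 0 (- 1), 0, 0, 0, 0, 1, - 1]"]; code_simp)
  show "- ((- 2) ^ 26) \<in> int_group_dets TYPE(2 \<times> 12)"
    by (rule C2_C12_witness[of "[- 1, - 1, - 1, - 1, - 1, 0, 0, 1]" "[Eis 0 (- 1), Eis 0 (- 1), Eis 1 1, - 1, - 1, 0, 0, Eis (- 1) (- 1)]"]; code_simp)
  show "- ((- 2) ^ 27) \<in> int_group_dets TYPE(2 \<times> 12)"
    by (rule C2_C12_witness[of "[- 2, 0, - 1, 0, 1, - 1, 0, 1]" "[Eis 0 1, 0, - 1, 0, Eis (- 1) (- 1), Eis 0 (- 1), 0, Eis 0 1]"]; code_simp)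
qed

lemma witnesses_C2_C2_C6:
  shows "(- 2) ^ 8 \<in> int_group_dets TYPE(2 \<times> 2 \<times> 6)"
    and "(- 2) ^ 12 \<in> int_group_dets TYPE(2 \<times> 2 \<times> 6)"
    and "(- 2) ^ 14 \<in> int_group_dets TYPE(2 \<times> 2 \<times> 6)"
    and "(- 2) ^ 15 \<in> int_group_dets TYPE(2 \<times> 2 \<times> 6)"
    and "(- 2) ^ 17 \<in> int_group_dets TYPE(2 \<times> 2 \<times> 6)"
    and "(- 2) ^ 18 \<in> int_group_dets TYPE(2 \<times> 2 \<times> 6)"
    and "(- 2) ^ 19 \<in> int_group_dets TYPE(2 \<times> 2 \<times> 6)"
    and "(- 2) ^ 21 \<in> int_group_dets TYPE(2 \<times> 2 \<times> 6)"
    and "- ((- 2) ^ 32) \<in> int_group_dets TYPE(2 \<times> 2 \<times> 6)"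
    and "- ((- 2) ^ 33) \<in> int_group_dets TYPE(2 \<times> 2 \<times> 6)"
    and "- ((- 2) ^ 34) \<in> int_group_dets TYPE(2 \<times> 2 \<times> 6)"
    and "- ((- 2) ^ 35) \<in> int_group_dets TYPE(2 \<times> 2 \<times> 6)"
    and "- ((- 2) ^ 36) \<in> int_group_dets TYPE(2 \<times> 2 \<times> 6)"
    and "- ((- 2) ^ 37) \<in> int_group_dets TYPE(2 \<times> 2 \<times> 6)"
    and "- ((- 2) ^ 38) \<in> int_group_dets TYPE(2 \<times> 2 \<times> 6)"
    and "- ((- 2) ^ 39) \<in> int_group_dets TYPE(2 \<times> 2 \<times> 6)"
proof -
  show "(- 2) ^ 8 \<in> int_group_dets TYPE(2 \<times> 2 \<times> 6)"
    by (rule C2_C2_C6_witness[of "[0, 0, 2, 0, 0, 0, 0, 0]" "[0, 0, - 1, 0, 0, 0, 0, 0]"]; code_simp)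
  show "(- 2) ^ 12 \<in> int_group_dets TYPE(2 \<times> 2 \<times> 6)"
    by (rule C2_C2_C6_witness[of "[0, 0, - 1, 0, - 3, 0, 0, 0]" "[0, 0, - 1, 0, 0, 0, 0, 0]"]; code_simp)
  show "(- 2) ^ 14 \<in> int_group_dets TYPE(2 \<times> 2 \<times> 6)"
    by (rule C2_C2_C6_witness[of "[- 3, 0, 2, 0, 0, 0, 0, - 3]" "[0, 0, - 1, 0, 0, 0, 0, 0]"]; code_simp)
  show "(- 2) ^ 15 \<in> int_group_dets TYPE(2 \<times> 2 \<times> 6)"
    by (rule C2_C2_C6_witness[of "[0, - 3, - 1, 0, 3, - 3, - 3, 3]" "[0, 0, - 1, 0, 0, 0, 0, 0]"]; code_simp)
  show "(- 2) ^ 17 \<in> int_group_dets TYPE(2 \<times> 2 \<times> 6)"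
    by (rule C2_C2_C6_witness[of "[- 3, 3, 2, 3, 3, 0, 3, - 3]" "[0, 0, - 1, 0, 0, 0, 0, 0]"]; code_simp)
  show "(- 2) ^ 18 \<in> int_group_dets TYPE(2 \<times> 2 \<times> 6)"
    by (rule C2_C2_C6_witness[of "[3, 3, - 1, 3, 0, 0, 0, 0]" "[0, 0, - 1, 0, 0, 0, 0, 0]"]; code_simp)
  show "(- 2) ^ 19 \<in> int_group_dets TYPE(2 \<times> 2 \<times> 6)"
    by (rule C2_C2_C6_witness[of "[4, 12, - 3, - 12, 3, 12, - 6, - 12]" "[1, 0, 0, 0, 0, 0, 0, 0]"]; code_simp)
  show "(- 2) ^ 21 \<in> int_group_dets TYPE(2 \<times> 2 \<times> 6)"
    by (rule C2_C2_C6_witness[of "[3, - 3, - 1, - 3, - 3, - 3, 3, 3]" "[0, 0, - 1, 0, 0, 0, 0, 0]"]; code_simp)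
  \<comment> \<open>Again both contributions are least possible for this sign: -(2^12) from
    \<open>f\<close> and the norm 2^20 from \<open>g\<close>.\<close>
  show "- ((- 2) ^ 32) \<in> int_group_dets TYPE(2 \<times> 2 \<times> 6)"
    by (rule C2_C2_C6_witness[of "[2, 1, 1, - 1, 1, 0, - 1, 1]" "[Eis 1 1, 1, 1, Eis 0 (- 1), 1, 0, Eis 0 (- 1), Eis 0 1]"]; code_simp)
  show "- ((- 2) ^ 33) \<in> int_group_dets TYPE(2 \<times> 2 \<times> 6)"
    by (rule C2_C2_C6_witness[of "[2, 1, 1, 2, 1, 0, - 1, - 2]" "[Eis 1 1, 1, 1, Eis 0 (- 1), 1, 0, Eis 0 (- 1), Eis 0 1]"]; code_simp)
  show "- ((- 2) ^ 34) \<in> int_group_dets TYPE(2 \<times> 2 \<times> 6)"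
    by (rule C2_C2_C6_witness[of "[1, 1, 2, - 1, 1, 1, - 1, 0]" "[Eis (- 2) 0, Eis 0 1, - 1, - 1, Eis (- 2) 0, Eis (- 1) (- 1), - 1, 0]"]; code_simp)
  show "- ((- 2) ^ 35) \<in> int_group_dets TYPE(2 \<times> 2 \<times> 6)"
    by (rule C2_C2_C6_witness[of "[1, - 2, - 1, 2, 1, 1, 2, 0]" "[Eis (- 2) 0, Eis 0 1, - 1, - 1, Eis (- 2) 0, Eis (- 1) (- 1), - 1, 0]"]; code_simp)
  show "- ((- 2) ^ 36) \<in> int_group_dets TYPE(2 \<times> 2 \<times> 6)"
    by (rule C2_C2_C6_witness[of "[0, 1, - 2, 1, - 1, - 1, - 1, - 1]" "[0, 1, 1, Eis 0 1, - 1, Eis 0 2, Eis 0 (- 1), - 1]"]; code_simp)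
  show "- ((- 2) ^ 37) \<in> int_group_dets TYPE(2 \<times> 2 \<times> 6)"
    by (rule C2_C2_C6_witness[of "[0, - 2, - 2, 1, 2, - 1, - 1, - 1]" "[0, 1, 1, Eis 0 1, - 1, Eis 0 2, Eis 0 (- 1), - 1]"]; code_simp)
  show "- ((- 2) ^ 38) \<in> int_group_dets TYPE(2 \<times> 2 \<times> 6)"
    by (rule C2_C2_C6_witness[of "[- 1, - 1, - 2, 1, - 1, - 1, 1, 0]" "[Eis 0 2, Eis 0 2, 1, 1, Eis 0 (- 1), Eis 0 (- 1), Eis 2 2, 0]"]; code_simp)
  show "- ((- 2) ^ 39) \<in> int_group_dets TYPE(2 \<times> 2 \<times> 6)"
    by (rule C2_C2_C6_witness[of "[- 1, 2, - 2, 1, - 1, - 1, - 2, 0]" "[Eis 0 2, Eis 0 2, 1, 1, Eis 0 (- 1), Eis 0 (- 1), Eis 2 2, 0]"]; code_simp)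
qed

lemma two_powers_C24:
  assumes "8 \<le> j"
  shows "2 ^ j \<in> int_group_dets TYPE(24)" "- (2 ^ j) \<in> int_group_dets TYPE(24)"
proof -
  have "1 * 2 ^ j \<in> int_group_dets TYPE(24)"
  proof (rule int_group_dets_powers[OF witnesses_C24(2) _ assms])
    fix j :: nat assume "8 \<le> j" "j < 8 + 8"
    then have "j = 8 \<or> j = 9 \<or> j = 10 \<or> j = 11 \<or> j = 12 \<or> j = 13 \<or> j = 14 \<or> j = 15" by arith
    then show "1 * 2 ^ j \<in> int_group_dets TYPE(24)"
      by (elim disjE) (simp_all only: mult_1 witnesses_C24)
  qed
  then show "2 ^ j \<in> int_group_dets TYPE(24)" by simp
  from int_group_dets_mult[OF witnesses_C24(1) this] show "- (2 ^ j) \<in> int_group_dets TYPE(24)" by simp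
qed

lemma two_powers_C2_C12:
  shows "13 \<le> j \<Longrightarrow> (- 2) ^ j \<in> int_group_dets TYPE(2 \<times> 12)"
    and "20 \<le> j \<Longrightarrow> - ((- 2) ^ j) \<in> int_group_dets TYPE(2 \<times> 12)"
proof -
  note w = witnesses_C2_C12
  \<comment> \<open>The exponents 16 = 8 + 8 and 20 = 8 + 12 come from products.\<close>
  have w': "(- 2) ^ 16 \<in> int_group_dets TYPE(2 \<times> 12)" "(- 2) ^ 20 \<in> int_group_dets TYPE(2 \<times> 12)"
    using int_group_dets_mult[OF w(1) w(1)] int_group_dets_mult[OF w(1) w(2)] by (simp_all flip: power_add)
  show "(- 2) ^ j \<in> int_group_dets TYPE(2 \<times> 12)" if "13 \<le> j"
  proof -
    have "1 * (- 2) ^ j \<in> int_group_dets TYPE(2 \<times> 12)"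
    proof (rule int_group_dets_powers[OF w(1) _ that])
      fix j :: nat assume "13 \<le> j" "j < 13 + 8"
      then have "j = 13 \<or> j = 14 \<or> j = 15 \<or> j = 16 \<or> j = 17 \<or> j = 18 \<or> j = 19 \<or> j = 20" by arith
      then show "1 * (- 2) ^ j \<in> int_group_dets TYPE(2 \<times> 12)"
        by (elim disjE) (simp_all only: mult_1 w w')
    qed
    then show ?thesis by simp
  qed
  show "- ((- 2) ^ j) \<in> int_group_dets TYPE(2 \<times> 12)" if "20 \<le> j"
  proof -
    have "- 1 * (- 2) ^ j \<in> int_group_dets TYPE(2 \<times> 12)"
    proof (rule int_group_dets_powers[OF w(1) _ that])
      fix j :: nat assume "20 \<le> j" "j < 20 + 8"
      then have "j = 20 \<or> j = 21 \<or> j = 22 \<or> j = 23 \<or> j = 24 \<or> j = 25 \<or> j = 26 \<or> j = 27" by arith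
      then show "- 1 * (- 2) ^ j \<in> int_group_dets TYPE(2 \<times> 12)"
        by (elim disjE) (simp_all only: mult_minus1 w)
    qed
    then show ?thesis by simp
  qed
qed

lemma two_powers_C2_C2_C6:
  shows "14 \<le> j \<Longrightarrow> (- 2) ^ j \<in> int_group_dets TYPE(2 \<times> 2 \<times> 6)"
    and "32 \<le> j \<Longrightarrow> - ((- 2) ^ j) \<in> int_group_dets TYPE(2 \<times> 2 \<times> 6)"
proof -
  note w = witnesses_C2_C2_C6
  have w': "(- 2) ^ 16 \<in> int_group_dets TYPE(2 \<times> 2 \<times> 6)" "(- 2) ^ 20 \<in> int_group_dets TYPE(2 \<times> 2 \<times> 6)"
    using int_group_dets_mult[OF w(1) w(1)] int_group_dets_mult[OF w(1) w(2)] by (simp_all flip: power_add)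
  show "(- 2) ^ j \<in> int_group_dets TYPE(2 \<times> 2 \<times> 6)" if "14 \<le> j"
  proof -
    have "1 * (- 2) ^ j \<in> int_group_dets TYPE(2 \<times> 2 \<times> 6)"
    proof (rule int_group_dets_powers[OF w(1) _ that])
      fix j :: nat assume "14 \<le> j" "j < 14 + 8"
      then have "j = 14 \<or> j = 15 \<or> j = 16 \<or> j = 17 \<or> j = 18 \<or> j = 19 \<or> j = 20 \<or> j = 21" by arith
      then show "1 * (- 2) ^ j \<in> int_group_dets TYPE(2 \<times> 2 \<times> 6)"
        by (elim disjE) (simp_all only: mult_1 w w')
    qed
    then show ?thesis by simp
  qed
  show "- ((- 2) ^ j) \<in> int_group_dets TYPE(2 \<times> 2 \<times> 6)" if "32 \<le> j"
  proof -
    have "- 1 * (- 2) ^ j \<in> int_group_dets TYPE(2 \<times> 2 \<times> 6)"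
    proof (rule int_group_dets_powers[OF w(1) _ that])
      fix j :: nat assume "32 \<le> j" "j < 32 + 8"
      then have "j = 32 \<or> j = 33 \<or> j = 34 \<or> j = 35 \<or> j = 36 \<or> j = 37 \<or> j = 38 \<or> j = 39" by arith
      then show "- 1 * (- 2) ^ j \<in> int_group_dets TYPE(2 \<times> 2 \<times> 6)"
        by (elim disjE) (simp_all only: mult_minus1 w)
    qed
    then show ?thesis by simp
  qed
qed

lemma signed_power_cases: "(2::int) ^ j = (- 2) ^ j \<and> - (2 ^ j) = - ((- 2 :: int) ^ j) \<or>
    (2::int) ^ j = - ((- 2) ^ j) \<and> - (2 ^ j) = (- 2 :: int) ^ j"
  by (cases "even j") simp_all

lemma signed_two_powers_large:
  assumes "x \<in> signed_two_powers" "2 ^ m \<le> \<bar>x\<bar>"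
  shows "x \<in> {2 ^ j | j::nat. m \<le> j} \<union> {- (2 ^ j) | j::nat. m \<le> j}"
proof -
  obtain j where j: "\<bar>x\<bar> = 2 ^ j" using assms(1) by (auto simp: signed_two_powers_def)
  have "m \<le> j" using assms(2) unfolding j by (rule power_le_imp_le_exp[rotated]) simp
  moreover have "x = 2 ^ j \<or> x = - (2 ^ j)" using j by linarith
  ultimately show ?thesis by blast
qed

text \<open>Common frame for the two noncyclic groups: from \<open>m\<close> on the powers of -2
  occur, from \<open>n\<close> on their negatives as well, so that both signs of
  \<open>2 ^ j\<close> are then attained.\<close>

lemma signed_two_powers_Int_eqI:
  fixes D :: "int set"
  assumes sub: "\<And>x. x \<in> D \<Longrightarrow> x \<in> signed_two_powers \<Longrightarrow>
      (\<exists>k. x = (- 2) ^ k \<and> (k = 0 \<or> k = 8 \<or> k = 12 \<or> m \<le> k)) \<or> 2 ^ n \<le> \<bar>x\<bar>"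
    and base: "1 \<in> D" "(- 2) ^ 8 \<in> D" "(- 2) ^ 12 \<in> D"
    and pos: "\<And>j. m \<le> j \<Longrightarrow> (- 2) ^ j \<in> D" and neg: "\<And>j. n \<le> j \<Longrightarrow> - ((- 2) ^ j) \<in> D"
    and n: "n = Suc l" "m \<le> n"
  shows "D \<inter> signed_two_powers = {1, 2 ^ 8, 2 ^ 12} \<union> {(- 2) ^ j | j::nat. m \<le> j \<and> j \<le> l} \<union>
    ({2 ^ j | j::nat. n \<le> j} \<union> {- (2 ^ j) | j::nat. n \<le> j})" (is "?L = ?R")
proof (intro equalityI subsetI)
  fix x assume "x \<in> ?L"
  then have x: "x \<in> D" "x \<in> signed_two_powers" by simp_all
  consider "2 ^ n \<le> \<bar>x\<bar>" | "x = (- 2) ^ 0" | "x = (- 2) ^ 8" | "x = (- 2) ^ 12" |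
      k where "x = (- 2) ^ k" "m \<le> k" "k \<le> l" | k where "x = (- 2) ^ k" "n \<le> k"
    using sub[OF x] n(1) not_less_eq_eq by blast
  then show "x \<in> ?R"
  proof cases
    case 1
    then show ?thesis using signed_two_powers_large[OF x(2)] by blast
  next
    case (5 k)
    then show ?thesis by blast
  next
    case (6 k)
    then show ?thesis using signed_power_cases[of k] by auto
  qed simp_all
next
  have abs: "\<bar>(- 2 :: int) ^ j\<bar> = 2 ^ j" for j by (simp add: power_abs)
  fix x assume "x \<in> ?R"
  then consider "x = 1" | "x = (- 2) ^ 8" | "x = (- 2) ^ 12" | j where "m \<le> j" "x = (- 2) ^ j"
    | j where "n \<le> j" "x = 2 ^ j \<or> x = - (2 ^ j)"
    by auto
  then have "x \<in> D \<and> (\<exists>k. \<bar>x\<bar> = 2 ^ k)"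
  proof cases
    case 1
    then show ?thesis using base(1) by (auto intro!: exI[of _ 0])
  next
    case 2
    then show ?thesis using base(2) abs[of 8] by metis
  next
    case 3
    then show ?thesis using base(3) abs[of 12] by metis
  next
    case (4 j)
    then show ?thesis using pos abs[of j] by metis
  next
    case (5 j)
    then have "x = (- 2) ^ j \<or> x = - ((- 2) ^ j)" using signed_power_cases[of j] by auto
    then have "x \<in> D" using pos[of j] neg[of j] 5(1) n(2) by auto
    moreover have "\<bar>x\<bar> = 2 ^ j" using 5(2) by auto
    ultimately show ?thesis by blast
  qed
  then show "x \<in> ?L" by (simp add: signed_two_powers_def)
qed

theorem corollary6p1:
  shows "int_group_dets TYPE(24) \<inter> signed_two_powers =
      {-1, 1} \<union> ({2 ^ j | j::nat. 8 \<le> j} \<union> {- (2 ^ j) | j::nat. 8 \<le> j})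
    \<and> int_group_dets TYPE(2 \<times> 12) \<inter> signed_two_powers =
      {1, 2 ^ 8, 2 ^ 12} \<union> {(- 2) ^ j | j::nat. 13 \<le> j \<and> j \<le> 19} \<union>
      ({2 ^ j | j::nat. 20 \<le> j} \<union> {- (2 ^ j) | j::nat. 20 \<le> j})
    \<and> int_group_dets TYPE(2 \<times> 2 \<times> 6) \<inter> signed_two_powers =
      {1, 2 ^ 8, 2 ^ 12} \<union> {(- 2) ^ j | j::nat. 14 \<le> j \<and> j \<le> 31} \<union>
      ({2 ^ j | j::nat. 32 \<le> j} \<union> {- (2 ^ j) | j::nat. 32 \<le> j})"
proof (intro conjI)
  show "int_group_dets TYPE(24) \<inter> signed_two_powers =
      {-1, 1} \<union> ({2 ^ j | j::nat. 8 \<le> j} \<union> {- (2 ^ j) | j::nat. 8 \<le> j})" (is "?L = ?R")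
  proof (intro equalityI subsetI)
    fix x assume x: "x \<in> ?L"
    then obtain f g where "x = det_C8 f * enorm (det_C8 g)" "\<forall>u<8. 3 dvd f u - emod (g u)"
      unfolding int_group_dets_24 by blast
    then have "\<bar>x\<bar> = 1 \<or> 2 ^ 8 \<le> \<bar>x\<bar>" using det_C8_two_power x by blast
    then show "x \<in> ?R"
    proof
      assume "\<bar>x\<bar> = 1"
      then have "x = 1 \<or> x = - 1" by linarith
      then show ?thesis by blast
    next
      assume "2 ^ 8 \<le> \<bar>x\<bar>"
      then show ?thesis using signed_two_powers_large[of x 8] x by blast
    qed
  next
    fix x assume "x \<in> ?R"
    then consider "x = - 1" | "x = 1" | j where "8 \<le> j" "x = 2 ^ j" | j where "8 \<le> j" "x = - (2 ^ j)"
      by blast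
    then have "x \<in> int_group_dets TYPE(24) \<and> (\<exists>k. \<bar>x\<bar> = 2 ^ k)"
      using witnesses_C24(1) one_in_int_group_dets two_powers_C24
      by cases (auto intro: exI[of _ 0])
    then show "x \<in> ?L" by (simp add: signed_two_powers_def)
  qed
  show "int_group_dets TYPE(2 \<times> 12) \<inter> signed_two_powers =
      {1, 2 ^ 8, 2 ^ 12} \<union> {(- 2) ^ j | j::nat. 13 \<le> j \<and> j \<le> 19} \<union>
      ({2 ^ j | j::nat. 20 \<le> j} \<union> {- (2 ^ j) | j::nat. 20 \<le> j})"
  proof (rule signed_two_powers_Int_eqI)
    fix x assume x: "x \<in> int_group_dets TYPE(2 \<times> 12)" "x \<in> signed_two_powers"
    then obtain f g where "x = det_C2C4 f * enorm (det_C2C4 g)" "\<forall>u<8. 3 dvd f u - emod (g u)"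
      unfolding int_group_dets_2_12 by blast
    then have "(\<exists>k. x = (- 2) ^ k \<and> (k = 0 \<or> k = 8 \<or> 12 \<le> k)) \<or> 2 ^ 20 \<le> \<bar>x\<bar>"
      using det_C2C4_two_power x by blast
    moreover have "12 \<le> k \<Longrightarrow> k = 12 \<or> 13 \<le> k" for k :: nat by linarith
    ultimately show "(\<exists>k. x = (- 2) ^ k \<and> (k = 0 \<or> k = 8 \<or> k = 12 \<or> 13 \<le> k)) \<or> 2 ^ 20 \<le> \<bar>x\<bar>"
      by blast
  qed (use one_in_int_group_dets witnesses_C2_C12(1,2) two_powers_C2_C12 in simp_all)
  show "int_group_dets TYPE(2 \<times> 2 \<times> 6) \<inter> signed_two_powers =
      {1, 2 ^ 8, 2 ^ 12} \<union> {(- 2) ^ j | j::nat. 14 \<le> j \<and> j \<le> 31} \<union>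
      ({2 ^ j | j::nat. 32 \<le> j} \<union> {- (2 ^ j) | j::nat. 32 \<le> j})"
  proof (rule signed_two_powers_Int_eqI)
    fix x assume x: "x \<in> int_group_dets TYPE(2 \<times> 2 \<times> 6)" "x \<in> signed_two_powers"
    then obtain f g where "x = det_C2C2C2 f * enorm (det_C2C2C2 g)" "\<forall>u<8. 3 dvd f u - emod (g u)"
      unfolding int_group_dets_2_2_6 by blast
    then show "(\<exists>k. x = (- 2) ^ k \<and> (k = 0 \<or> k = 8 \<or> k = 12 \<or> 14 \<le> k)) \<or> 2 ^ 32 \<le> \<bar>x\<bar>"
      using det_C2C2C2_two_power x by blast
  qed (use one_in_int_group_dets witnesses_C2_C2_C6(1,2) two_powers_C2_C2_C6 in simp_all)
qed

end
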